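(* Let $(x_i,f_i)_{i=1}^\infty$ be a Schauder frame for a Banach space $X$. Then $(x_i,f_i)_{i=1}^\infty$ is shrinking if and only if $(x_i,f_i)_{i=1}^\infty$ has a shrinking associated basis. Furthermore, $(x_i,f_i)_{i=1}^\infty$ is shrinking and boundedly complete if and only if $(x_i,f_i)_{i=1}^\infty$ has a reflexive associated space.
   Context: Let $X$ be an infinite dimensional separable Banach space. A sequence $(x_i,f_i)_{i=1}^\infty\subset X\times X^*$ is a Schauder frame for $X$ if $x=\sum_{i=1}^\infty f_i(x)x_i$ (norm convergence) for all $x\in X$. For $n\in\mathbb{N}$ let $T_n:X\to X$ be $T_n(x)=\sum_{i\ge n} f_i(x)x_i$. The frame is shrinking if $\|x^*\circ T_n\|\to 0$ for all $x^*\in X^*$. The frame is boundedly complete if $\sum_{i=1}^\infty x^{**}(f_i)x_i$ converges in norm to an element of $X$ for all $x^{**}\in X^{**}$. Let $Z$ be a Banach space with a (Schauder) basis $(z_i)_{i=1}^\infty$ and coordinate functionals $(z_i^* )_{i=1}^\infty$. $Z$ is an associated space to $(x_i,f_i)_{i=1}^\infty$, and $(z_i)_{i=1}^\infty$ is an associated basis, if the operators $T:X\to Z$, $T(x)=\sum f_i(x)z_i$, and $S:Z\to X$, $S(z)=\sum z_i^*(z)x_i$, are (well defined and) bounded. A shrinking associated basis is an associated basis which is a shrinking basis of $Z$ in the usual sense. *)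

theory Defs
  imports "HOL-Analysis.Analysis" "HOL-Library.Function_Algebras"
begin

text \<open>Scalars are real and sequences are indexed from 0. The given space is a type of class
  \<^class>\<open>banach\<close>; its dual and bidual are the types of bounded linear maps.\<close>

subsection \<open>Schauder frames\<close>

definition Schauder_frame :: "(nat \<Rightarrow> 'a::banach) \<Rightarrow> (nat \<Rightarrow> 'a \<Rightarrow>\<^sub>L real) \<Rightarrow> bool" where
  "Schauder_frame x f \<longleftrightarrow> (\<forall>u. (\<lambda>i. blinfun_apply (f i) u *\<^sub>R x i) sums u)"

definition frame_tail :: "(nat \<Rightarrow> 'a::banach) \<Rightarrow> (nat \<Rightarrow> 'a \<Rightarrow>\<^sub>L real) \<Rightarrow> nat \<Rightarrow> 'a \<Rightarrow> 'a" where
  "frame_tail x f n u = (\<Sum>i. blinfun_apply (f (i + n)) u *\<^sub>R x (i + n))"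

definition shrinking_frame :: "(nat \<Rightarrow> 'a::banach) \<Rightarrow> (nat \<Rightarrow> 'a \<Rightarrow>\<^sub>L real) \<Rightarrow> bool" where
  "shrinking_frame x f \<longleftrightarrow>
     (\<forall>g :: 'a \<Rightarrow>\<^sub>L real. (\<lambda>n. onorm (blinfun_apply g \<circ> frame_tail x f n)) \<longlonglongrightarrow> 0)"

definition boundedly_complete_frame ::
    "(nat \<Rightarrow> 'a::banach) \<Rightarrow> (nat \<Rightarrow> 'a \<Rightarrow>\<^sub>L real) \<Rightarrow> bool" where
  "boundedly_complete_frame x f \<longleftrightarrow>
     (\<forall>\<phi> :: ('a \<Rightarrow>\<^sub>L real) \<Rightarrow>\<^sub>L real. summable (\<lambda>i. blinfun_apply \<phi> (f i) *\<^sub>R x i))"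

subsection \<open>Banach spaces on a carrier\<close>

text \<open>The associated space is existentially quantified, so it cannot be a type. It is a linear
  subspace \<open>V\<close> of a real vector space type, with a norm \<open>N\<close> of its own; the values of \<open>N\<close>
  outside \<open>V\<close> are irrelevant. Any two vector spaces of the same dimension are isomorphic and a
  Banach space with a Schauder basis has dimension continuum, so every such space is isometric to
  one carried by (a subspace of) \<^typ>\<open>nat \<Rightarrow> real\<close>, for instance by its space of
  coordinate sequences.\<close>

instantiation "fun" :: (type, real_vector) real_vector
begin

definition scaleR_fun :: "real \<Rightarrow> ('a \<Rightarrow> 'b) \<Rightarrow> 'a \<Rightarrow> 'b" where
  "scaleR_fun c g = (\<lambda>t. c *\<^sub>R g t)"

instance
  by standard (simp_all add: scaleR_fun_def plus_fun_def fun_eq_iff algebra_simps)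

end

definition norm_conv :: "'v::real_vector set \<Rightarrow> ('v \<Rightarrow> real) \<Rightarrow> (nat \<Rightarrow> 'v) \<Rightarrow> 'v \<Rightarrow> bool" where
  "norm_conv V N s v \<longleftrightarrow> v \<in> V \<and> (\<lambda>n. N (s n - v)) \<longlonglongrightarrow> 0"

locale normed_space_on =
  fixes V :: "'v::real_vector set" and N :: "'v \<Rightarrow> real"
  assumes subspace: "subspace V"
    and nonneg: "v \<in> V \<Longrightarrow> 0 \<le> N v"
    and eq_zero_iff: "v \<in> V \<Longrightarrow> N v = 0 \<longleftrightarrow> v = 0"
    and scale: "v \<in> V \<Longrightarrow> N (c *\<^sub>R v) = \<bar>c\<bar> * N v"
    and triangle: "u \<in> V \<Longrightarrow> v \<in> V \<Longrightarrow> N (u + v) \<le> N u + N v"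

locale banach_space_on = normed_space_on +
  assumes complete:
    "range s \<subseteq> V \<Longrightarrow> (\<And>e. e > 0 \<Longrightarrow> \<exists>M. \<forall>m\<ge>M. \<forall>n\<ge>M. N (s m - s n) < e)
       \<Longrightarrow> \<exists>v. norm_conv V N s v"

text \<open>Bounded linear functionals on \<open>V\<close>, extended by \<open>0\<close> outside \<open>V\<close> so that they are
  determined by their values on \<open>V\<close>. They form a subspace of the function type, hence the
  construction can be iterated to give the bidual.\<close>

definition dual_space :: "'v::real_vector set \<Rightarrow> ('v \<Rightarrow> real) \<Rightarrow> ('v \<Rightarrow> real) set" where
  "dual_space V N =
     {g. (\<forall>u\<in>V. \<forall>v\<in>V. g (u + v) = g u + g v) \<and> (\<forall>c. \<forall>v\<in>V. g (c *\<^sub>R v) = c * g v) \<and>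
         (\<exists>C. \<forall>v\<in>V. \<bar>g v\<bar> \<le> C * N v) \<and> (\<forall>v. v \<notin> V \<longrightarrow> g v = 0)}"

definition dual_norm :: "'v::real_vector set \<Rightarrow> ('v \<Rightarrow> real) \<Rightarrow> ('v \<Rightarrow> real) \<Rightarrow> real" where
  "dual_norm V N g = (SUP v\<in>{v\<in>V. N v \<le> 1}. \<bar>g v\<bar>)"

definition bidual_space :: "'v::real_vector set \<Rightarrow> ('v \<Rightarrow> real) \<Rightarrow> (('v \<Rightarrow> real) \<Rightarrow> real) set" where
  "bidual_space V N = dual_space (dual_space V N) (dual_norm V N)"

definition canonical_embedding ::
    "'v::real_vector set \<Rightarrow> ('v \<Rightarrow> real) \<Rightarrow> 'v \<Rightarrow> ('v \<Rightarrow> real) \<Rightarrow> real" where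
  "canonical_embedding V N v = (\<lambda>g. if g \<in> dual_space V N then g v else 0)"

definition reflexive_space :: "'v::real_vector set \<Rightarrow> ('v \<Rightarrow> real) \<Rightarrow> bool" where
  "reflexive_space V N \<longleftrightarrow> canonical_embedding V N ` V = bidual_space V N"

subsection \<open>Schauder bases\<close>

definition expansion ::
    "'v::real_vector set \<Rightarrow> ('v \<Rightarrow> real) \<Rightarrow> (nat \<Rightarrow> 'v) \<Rightarrow> (nat \<Rightarrow> real) \<Rightarrow> 'v \<Rightarrow> bool" where
  "expansion V N z a v \<longleftrightarrow> norm_conv V N (\<lambda>n. \<Sum>i<n. a i *\<^sub>R z i) v"

definition Schauder_basis :: "'v::real_vector set \<Rightarrow> ('v \<Rightarrow> real) \<Rightarrow> (nat \<Rightarrow> 'v) \<Rightarrow> bool" where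
  "Schauder_basis V N z \<longleftrightarrow> range z \<subseteq> V \<and> (\<forall>v\<in>V. \<exists>!a. expansion V N z a v)"

definition coord ::
    "'v::real_vector set \<Rightarrow> ('v \<Rightarrow> real) \<Rightarrow> (nat \<Rightarrow> 'v) \<Rightarrow> nat \<Rightarrow> 'v \<Rightarrow> real" where
  "coord V N z i v = (THE a. expansion V N z a v) i"

definition closed_span :: "'v::real_vector set \<Rightarrow> ('v \<Rightarrow> real) \<Rightarrow> 'v set \<Rightarrow> 'v set" where
  "closed_span V N A = {v\<in>V. \<forall>e>0. \<exists>w\<in>span A. N (v - w) < e}"

text \<open>A basis is shrinking if, for every functional \<open>g\<close> in the dual, the norm of the restriction of
  \<open>g\<close> to the closed linear span of \<open>{z\<^sub>i | i \<ge> n}\<close> tends to 0.\<close>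

definition shrinking_basis :: "'v::real_vector set \<Rightarrow> ('v \<Rightarrow> real) \<Rightarrow> (nat \<Rightarrow> 'v) \<Rightarrow> bool" where
  "shrinking_basis V N z \<longleftrightarrow> Schauder_basis V N z \<and>
     (\<forall>g\<in>dual_space V N. (\<lambda>n. dual_norm (closed_span V N (z ` {n..})) N g) \<longlonglongrightarrow> 0)"

subsection \<open>Associated spaces\<close>

text \<open>The operators \<open>T\<close> and \<open>S\<close> below are determined on their domains by the series, and are
  therefore linear.\<close>

definition associated_basis ::
    "(nat \<Rightarrow> 'a::banach) \<Rightarrow> (nat \<Rightarrow> 'a \<Rightarrow>\<^sub>L real) \<Rightarrow>
     'v::real_vector set \<Rightarrow> ('v \<Rightarrow> real) \<Rightarrow> (nat \<Rightarrow> 'v) \<Rightarrow> bool" where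
  "associated_basis x f V N z \<longleftrightarrow> banach_space_on V N \<and> Schauder_basis V N z \<and>
     (\<exists>T. (\<forall>u. expansion V N z (\<lambda>i. blinfun_apply (f i) u) (T u)) \<and>
          (\<exists>C. \<forall>u. N (T u) \<le> C * norm u)) \<and>
     (\<exists>S. (\<forall>v\<in>V. (\<lambda>i. coord V N z i v *\<^sub>R x i) sums S v) \<and>
          (\<exists>C. \<forall>v\<in>V. norm (S v) \<le> C * N v))"

text \<open>The type argument is the vector space in which the carrier is sought.\<close>

definition has_shrinking_associated_basis ::
    "'v::real_vector itself \<Rightarrow> (nat \<Rightarrow> 'a::banach) \<Rightarrow> (nat \<Rightarrow> 'a \<Rightarrow>\<^sub>L real) \<Rightarrow> bool" where
  "has_shrinking_associated_basis _ x f \<longleftrightarrow>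
     (\<exists>(V :: 'v set) N z. associated_basis x f V N z \<and> shrinking_basis V N z)"

definition has_reflexive_associated_space ::
    "'v::real_vector itself \<Rightarrow> (nat \<Rightarrow> 'a::banach) \<Rightarrow> (nat \<Rightarrow> 'a \<Rightarrow>\<^sub>L real) \<Rightarrow> bool" where
  "has_reflexive_associated_space _ x f \<longleftrightarrow>
     (\<exists>(V :: 'v set) N z. associated_basis x f V N z \<and> reflexive_space V N)"

end

theory Submission
  imports Defs
begin

text \<open>
  For the implications from an associated space to the frame, functionals on the space are pulled back and
  pushed forward along the operators \<open>T\<close> and \<open>S\<close>. In the reflexive case a generalised limit along
  vectors \<open>T u\<close> with initial coordinates removed is an element of the bidual, hence a vector, and all its
  coordinates vanish.

  For the converse, let \<open>M\<close> be the supremum of the norms of the partial sums \<open>\<Sum>i<k. a i *\<^sub>R x i\<close>, the smallest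
  possible associated norm, and let \<open>W\<close> be the convex set of the sequences \<open>(f i (v i))\<close> with \<open>v\<close> of variation
  at most 1; it contains the truncated coefficient sequences of all unit vectors. The associated norm is
  obtained by interpolating between \<open>W\<close> and \<open>M\<close> as Davis, Figiel, Johnson and Pelczynski do: it is the
  Euclidean norm of the sequence of the gauges of \<open>2\<^sup>n W + 2\<^sup>-\<^sup>n B\<close>, \<open>B\<close> being the unit ball of \<open>M\<close>. Modulo
  small errors, a functional on it is bounded with respect to \<open>M\<close> and a vector lies in a multiple of \<open>W\<close>. An
  \<open>M\<close>-bounded functional has coordinates \<open>g i (x i)\<close> with \<open>g\<close> of bounded variation in the dual, so if the frame
  is shrinking then Abel summation makes it small on the far coordinates of \<open>W\<close>. If the frame is also boundedly
  complete, Abel summation in the bidual shows in the same way that the basis is boundedly complete; a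
  shrinking and boundedly complete basis spans a reflexive space.
\<close>

subsection \<open>The Hahn-Banach theorem\<close>

text \<open>The norm \<open>M\<close> alone does not suffice: a functional bounded for
  \<open>M\<close> becomes small on far coordinates only over \<open>W\<close>, not over the whole
  unit ball of \<open>M\<close>. With the gauge of \<open>W\<close> alone, functionals need no
  longer be bounded for \<open>M\<close>. Interpolation serves both sides, since its unit ball lies
  in a multiple of \<open>W\<close> of order \<open>2^n\<close> up to an error of order
  \<open>2^-n\<close> in \<open>M\<close>. Two degeneracies stand in the way. \<open>M\<close> is
  definite only if no \<open>x i\<close> vanishes, and \<open>W\<close> absorbs every finitely
  supported sequence only if no \<open>f i\<close> vanishes, whereas a frame may contain zeros. One
  additional small coordinate repairs both. The new system need not be a frame of the larger space,
  so the interpolation assumes convergence of the series and no reconstruction. All norms are first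
  defined on finitely supported scalar sequences and do not increase under truncation. This makes
  the unit sequences a basis of the completion and lets the completion be a set of
  sequences.\<close>

definition sublinear :: "('v::real_vector \<Rightarrow> real) \<Rightarrow> bool" where
  "sublinear p \<longleftrightarrow> (\<forall>u v. p (u + v) \<le> p u + p v) \<and> (\<forall>c\<ge>0. \<forall>v. p (c *\<^sub>R v) = c * p v)"

lemma sublinear_add: "sublinear p \<Longrightarrow> p (u + v) \<le> p u + p v"
  and sublinear_scale: "sublinear p \<Longrightarrow> 0 \<le> c \<Longrightarrow> p (c *\<^sub>R v) = c * p v"
  by (auto simp: sublinear_def)

lemma sublinear_zero: "sublinear p \<Longrightarrow> p 0 = 0"
  using sublinear_scale[of p 0 0] by simp

lemma sublinear_neg: "sublinear p \<Longrightarrow> - p (- v) \<le> p v"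
  using sublinear_add[of p v "- v"] sublinear_zero[of p] by simp

lemma sublinear_I:
  assumes "\<And>u v. p (u + v) \<le> p u + p v" "\<And>c v. c > 0 \<Longrightarrow> p (c *\<^sub>R v) \<le> c * p v" "p 0 = 0"
  shows "sublinear p"
  unfolding sublinear_def
proof (intro conjI allI impI)
  fix c :: real and v assume "c \<ge> 0"
  show "p (c *\<^sub>R v) = c * p v"
  proof (cases "c = 0")
    case False
    then have c: "c > 0" using \<open>c \<ge> 0\<close> by simp
    have "p ((1/c) *\<^sub>R (c *\<^sub>R v)) \<le> (1/c) * p (c *\<^sub>R v)"
      using c by (intro assms) auto
    then have "c * p v \<le> p (c *\<^sub>R v)" using c by (simp add: field_simps)
    with assms(2)[OF c, of v] show ?thesis by simp
  qed (use assms in simp)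
qed (use assms in auto)

text \<open>For fixed \<open>y\<close> the infimum \<open>r v\<close> of
  \<open>q (v + t y) - t q y\<close> over \<open>t \<ge> 0\<close> is sublinear and below
  \<open>q\<close>, so minimality forces \<open>r = q\<close>. Taking \<open>t = 1\<close> gives
  \<open>q u + q y \<le> q (u + y)\<close>, which together with subadditivity is additivity.\<close>

lemma minimal_sublinear_linear:
  assumes q: "sublinear q" and min: "\<And>q'. sublinear q' \<Longrightarrow> (\<And>v. q' v \<le> q v) \<Longrightarrow> q' = q"
  shows "linear q"
proof -
  have sup: "q u + q y \<le> q (u + y)" for u y
  proof -
    define r where "r v = (INF t\<in>{0..}. q (v + t *\<^sub>R y) - t * q y)" for v
    have low: "- q (- v) \<le> q (v + t *\<^sub>R y) - t * q y" if "t \<ge> 0" for t v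
      using sublinear_add[OF q, of "v + t *\<^sub>R y" "- v"] sublinear_scale[OF q that, of y] by simp
    have bdd: "bdd_below ((\<lambda>t. q (v + t *\<^sub>R y) - t * q y) ` {0..})" for v
      using low[of _ v] by (intro bdd_belowI2) auto
    have le: "r v \<le> q (v + t *\<^sub>R y) - t * q y" if "t \<ge> 0" for t v
      unfolding r_def using that by (intro cINF_lower[OF bdd]) auto
    have leq: "r v \<le> q v" for v using le[of 0 v] by simp
    have "sublinear r"
    proof (rule sublinear_I)
      fix v w
      have "r (v + w) - (q (v + t *\<^sub>R y) - t * q y) \<le> r w" if t: "t \<ge> 0" for t
        unfolding r_def[of w]
      proof (rule cINF_greatest)
        fix s :: real assume s: "s \<in> {0..}"
        have "r (v + w) \<le> q (v + w + (t + s) *\<^sub>R y) - (t + s) * q y"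
          using t s by (intro le) auto
        also have "q (v + w + (t + s) *\<^sub>R y) \<le> q (v + t *\<^sub>R y) + q (w + s *\<^sub>R y)"
          using sublinear_add[OF q, of "v + t *\<^sub>R y" "w + s *\<^sub>R y"] by (simp add: algebra_simps)
        finally show "r (v + w) - (q (v + t *\<^sub>R y) - t * q y) \<le> q (w + s *\<^sub>R y) - s * q y"
          by (simp add: algebra_simps)
      qed simp
      then have "r (v + w) - r w \<le> r v"
        unfolding r_def[of v] by (intro cINF_greatest) (force simp: algebra_simps)+
      then show "r (v + w) \<le> r v + r w" by simp
    next
      fix c :: real and v assume c: "c > 0"
      have "r (c *\<^sub>R v) / c \<le> r v"
        unfolding r_def[of v]
      proof (rule cINF_greatest)
        fix t :: real assume t: "t \<in> {0..}"
        have "r (c *\<^sub>R v) \<le> q (c *\<^sub>R v + (c * t) *\<^sub>R y) - (c * t) * q y"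
          using t c by (intro le) auto
        also have "q (c *\<^sub>R v + (c * t) *\<^sub>R y) = c * q (v + t *\<^sub>R y)"
          using sublinear_scale[OF q, of c "v + t *\<^sub>R y"] c by (simp add: algebra_simps)
        finally show "r (c *\<^sub>R v) / c \<le> q (v + t *\<^sub>R y) - t * q y"
          using c by (simp add: field_simps)
      qed simp
      then show "r (c *\<^sub>R v) \<le> c * r v" using c by (simp add: field_simps)
    next
      have "r 0 \<ge> 0"
        unfolding r_def using sublinear_zero[OF q] low[of _ 0] by (intro cINF_greatest) auto
      with leq[of 0] show "r 0 = 0" using sublinear_zero[OF q] by simp
    qed
    then have "r = q" using min leq by blast
    then show ?thesis using le[of 1 u] by simp
  qed
  have add: "q (u + v) = q u + q v" for u v
    using sup[of u v] sublinear_add[OF q, of u v] by simp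
  have neg: "q (- v) = - q v" for v
    using add[of v "- v"] sublinear_zero[OF q] by simp
  have "q (c *\<^sub>R v) = c * q v" for c v
  proof (cases "c \<ge> 0")
    case False
    then have "q (- (c *\<^sub>R v)) = (- c) * q v"
      using sublinear_scale[OF q, of "- c" v] by simp
    then show ?thesis by (simp add: neg)
  qed (use sublinear_scale[OF q] in simp)
  with add show ?thesis by (intro linearI) auto
qed

lemma exists_linear_below:
  assumes p: "sublinear p"
  shows "\<exists>H. linear H \<and> (\<forall>v. H v \<le> p v)"
proof -
  define A where "A = {q. sublinear q \<and> (\<forall>v. q v \<le> p v)}"
  \<comment> \<open>The order is reversed: \<open>P a b\<close> says that \<open>b\<close> lies
    below \<open>a\<close>, so that a maximal element in Zorn's lemma is a minimal sublinear
    functional.\<close>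
  define P where "P = (\<lambda>a b :: 'a \<Rightarrow> real. \<forall>v. b v \<le> a v)"
  have po: "partial_order_on A (relation_of P A)"
    unfolding partial_order_on_def preorder_on_def relation_of_def refl_on_def trans_def antisym_def P_def
    by (auto intro: order_trans) (auto simp: fun_eq_iff intro: antisym)
  have "\<exists>m\<in>A. \<forall>a\<in>A. P m a \<longrightarrow> a = m"
  proof (rule predicate_Zorn[OF po])
    fix C assume C: "C \<in> Chains (relation_of P A)"
    have CA: "C \<subseteq> A" using C by (auto simp: Chains_def relation_of_def)
    have ch: "P a b \<or> P b a" if "a \<in> C" "b \<in> C" for a b
      using C that by (auto simp: Chains_def relation_of_def)
    show "\<exists>u\<in>A. \<forall>a\<in>C. P a u"
    proof (cases "C = {}")
      case True
      then show ?thesis using p by (auto simp: A_def)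
    next
      case False
      define u where "u v = (INF q\<in>C. q v)" for v
      \<comment> \<open>A sublinear functional below \<open>p\<close> is bounded below by
        \<open>- p (- v)\<close>; this keeps the pointwise infimum over a chain finite.\<close>
      have low: "- p (- v) \<le> q v" if "q \<in> C" for q v
        proof -
        have "sublinear q" "q (- v) \<le> p (- v)" using CA that by (auto simp: A_def)
        then show ?thesis using sublinear_neg[of q v] by linarith
      qed
      have bdd: "bdd_below ((\<lambda>q. q v) ` C)" for v
        using low by (intro bdd_belowI2) auto
      have le: "u v \<le> q v" if "q \<in> C" for q v
        unfolding u_def using that by (intro cINF_lower[OF bdd]) auto
      have sl: "sublinear q" if "q \<in> C" for q using that CA by (auto simp: A_def)
      have "sublinear u"
      proof (rule sublinear_I)
        fix v w
        have "u (v + w) - q v \<le> u w" if q: "q \<in> C" for q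
          unfolding u_def[of w]
        proof (rule cINF_greatest[OF False])
          fix r assume r: "r \<in> C"
          \<comment> \<open>Of two members of a chain the smaller one, used at both vectors, bounds
            the infimum at the sum.\<close>
          consider "\<forall>v. q v \<le> r v" | "\<forall>v. r v \<le> q v" using ch[OF q r] by (auto simp: P_def)
          then show "u (v + w) - q v \<le> r w"
          proof cases
            case 1
            then show ?thesis using le[OF q, of "v + w"] sublinear_add[OF sl[OF q], of v w]
              by (smt (verit))
          next
            case 2
            then show ?thesis using le[OF r, of "v + w"] sublinear_add[OF sl[OF r], of v w]
              by (smt (verit))
          qed
        qed
        then have "u (v + w) - u w \<le> u v"
          unfolding u_def[of v] by (intro cINF_greatest[OF False]) (force simp: algebra_simps)
        then show "u (v + w) \<le> u v + u w" by simp
      next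
        fix c :: real and v assume c: "c > 0"
        have "u (c *\<^sub>R v) / c \<le> u v"
          unfolding u_def[of v]
        proof (rule cINF_greatest[OF False])
          fix q assume q: "q \<in> C"
          show "u (c *\<^sub>R v) / c \<le> q v"
            using le[OF q, of "c *\<^sub>R v"] sublinear_scale[OF sl[OF q], of c v] c by (simp add: field_simps)
        qed
        then show "u (c *\<^sub>R v) \<le> c * u v" using c by (simp add: field_simps)
      next
        have "(\<lambda>q. q 0) ` C = {0}" using False sl sublinear_zero by force
        then show "u 0 = 0" by (simp add: u_def)
      qed
      moreover have "u v \<le> p v" for v
        using False le CA by (force simp: A_def intro: order_trans)
      ultimately show ?thesis using le by (auto simp: A_def P_def)
    qed
  qed
  then obtain m where m: "m \<in> A" "\<And>a. a \<in> A \<Longrightarrow> P m a \<Longrightarrow> a = m" by blast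
  have "linear m"
    using m by (intro minimal_sublinear_linear) (auto simp: A_def P_def intro: order_trans)
  with m show ?thesis by (auto simp: A_def)
qed

text \<open>The functional \<open>h\<close> is absorbed into the sublinear bound \<open>r v\<close>,
  the infimum of \<open>p (v - s) + h s\<close> over \<open>s\<close> in \<open>S\<close>. A linear
  \<open>H\<close> below \<open>r\<close> satisfies \<open>H \<le> h\<close> on \<open>S\<close> by
  the choice \<open>s = v\<close>, hence equality there by passing to \<open>- v\<close>, and
  \<open>H \<le> p\<close> by the choice \<open>s = 0\<close>. This replaces the extension by one
  dimension at a time.\<close>

lemma Hahn_Banach_total:
  assumes p: "sublinear p" and S: "subspace S"
    and add: "\<And>u v. u \<in> S \<Longrightarrow> v \<in> S \<Longrightarrow> h (u + v) = h u + h v"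
    and scale: "\<And>c v. v \<in> S \<Longrightarrow> h (c *\<^sub>R v) = c * h v"
    and le: "\<And>v. v \<in> S \<Longrightarrow> h v \<le> p v"
  shows "\<exists>H. linear H \<and> (\<forall>v\<in>S. H v = h v) \<and> (\<forall>v. H v \<le> p v)"
proof -
  have S0: "0 \<in> S" and S1: "u \<in> S \<Longrightarrow> v \<in> S \<Longrightarrow> u + v \<in> S" and S2: "v \<in> S \<Longrightarrow> c *\<^sub>R v \<in> S" for u v c
    using S by (auto simp: subspace_def)
  have ne: "S \<noteq> {}" using S0 by auto
  have h0: "h 0 = 0" using scale[of 0 0] S0 by simp
  define r where "r v = (INF s\<in>S. p (v - s) + h s)" for v
  have low: "- p (- v) \<le> p (v - s) + h s" if s: "s \<in> S" for s v
  proof -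
    have "- h s = h (- s)" using scale[of s "-1"] s by simp
    also have "\<dots> \<le> p (- s)" using S2[of s "-1"] s by (intro le) auto
    also have "\<dots> \<le> p (v - s) + p (- v)" using sublinear_add[OF p, of "v - s" "- v"] by simp
    finally show ?thesis by simp
  qed
  have bdd: "bdd_below ((\<lambda>s. p (v - s) + h s) ` S)" for v
    using low by (intro bdd_belowI2) auto
  have rle: "r v \<le> p (v - s) + h s" if "s \<in> S" for s v
    unfolding r_def using that by (intro cINF_lower[OF bdd]) auto
  have "sublinear r"
  proof (rule sublinear_I)
    fix v w
    have "r (v + w) - (p (v - s) + h s) \<le> r w" if s: "s \<in> S" for s
      unfolding r_def[of w]
    proof (rule cINF_greatest[OF ne])
      fix t assume t: "t \<in> S"
      have "r (v + w) \<le> p (v + w - (s + t)) + h (s + t)" using s t S1 by (intro rle) auto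
      also have "p (v + w - (s + t)) \<le> p (v - s) + p (w - t)"
        using sublinear_add[OF p, of "v - s" "w - t"] by (simp add: algebra_simps)
      finally show "r (v + w) - (p (v - s) + h s) \<le> p (w - t) + h t"
        using add[OF s t] by simp
    qed
    then have "r (v + w) - r w \<le> r v"
      unfolding r_def[of v] by (intro cINF_greatest[OF ne]) (force simp: algebra_simps)
    then show "r (v + w) \<le> r v + r w" by simp
  next
    fix c :: real and v assume c: "c > 0"
    have "r (c *\<^sub>R v) / c \<le> r v"
      unfolding r_def[of v]
    proof (rule cINF_greatest[OF ne])
      fix s assume s: "s \<in> S"
      have "r (c *\<^sub>R v) \<le> p (c *\<^sub>R v - c *\<^sub>R s) + h (c *\<^sub>R s)" using s S2 by (intro rle) auto
      also have "p (c *\<^sub>R v - c *\<^sub>R s) = c * p (v - s)"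
        using sublinear_scale[OF p, of c "v - s"] c by (simp add: algebra_simps)
      finally show "r (c *\<^sub>R v) / c \<le> p (v - s) + h s"
        using c scale[OF s] by (simp add: field_simps)
    qed
    then show "r (c *\<^sub>R v) \<le> c * r v" using c by (simp add: field_simps)
  next
    have "0 \<le> r 0" unfolding r_def using low[of _ 0] sublinear_zero[OF p] by (intro cINF_greatest[OF ne]) auto
    with rle[OF S0, of 0] show "r 0 = 0" using sublinear_zero[OF p] h0 by simp
  qed
  then obtain H where H: "linear H" "\<And>v. H v \<le> r v" using exists_linear_below by blast
  have Hh: "H v \<le> h v" if "v \<in> S" for v
    using H(2)[of v] rle[OF that, of v] sublinear_zero[OF p] by simp
  have "H v = h v" if v: "v \<in> S" for v
    using Hh[OF v] Hh[OF S2[OF v, of "-1"]] scale[OF v, of "-1"] linear_neg[OF H(1)] by simp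
  moreover have "H v \<le> p v" for v
    using H(2)[of v] rle[OF S0, of v] h0 by simp
  ultimately show ?thesis using H(1) by blast
qed

text \<open>A linear projection onto \<open>V\<close> turns a bound known only on \<open>V\<close>
  into one on the whole type; norms on carriers are arbitrary outside their carrier.\<close>

theorem Hahn_Banach:
  fixes V S :: "'v::real_vector set"
  assumes V: "subspace V" and SV: "S \<subseteq> V" and S: "subspace S"
    and p_add: "\<And>u v. u \<in> V \<Longrightarrow> v \<in> V \<Longrightarrow> p (u + v) \<le> p u + p v"
    and p_scale: "\<And>c v. v \<in> V \<Longrightarrow> 0 \<le> c \<Longrightarrow> p (c *\<^sub>R v) = c * p v"
    and add: "\<And>u v. u \<in> S \<Longrightarrow> v \<in> S \<Longrightarrow> h (u + v) = h u + h v"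
    and scale: "\<And>c v. v \<in> S \<Longrightarrow> h (c *\<^sub>R v) = c * h v"
    and le: "\<And>v. v \<in> S \<Longrightarrow> h v \<le> p v"
  obtains H where "linear H" "\<And>v. v \<in> S \<Longrightarrow> H v = h v" "\<And>v. v \<in> V \<Longrightarrow> H v \<le> p v"
proof -
  obtain \<pi> :: "'v \<Rightarrow> 'v" where \<pi>: "range \<pi> \<subseteq> V" "linear \<pi>" "\<And>v. v \<in> V \<Longrightarrow> \<pi> v = v"
    using linear_exists_left_inverse_on[OF linear_id V] by auto
  have "sublinear (p \<circ> \<pi>)"
    unfolding sublinear_def
    using \<pi>(1) p_add p_scale by (auto simp: linear_add[OF \<pi>(2)] linear_scale[OF \<pi>(2)] image_subset_iff)
  then obtain H where "linear H" "\<forall>v\<in>S. H v = h v" "\<forall>v. H v \<le> (p \<circ> \<pi>) v"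
    using Hahn_Banach_total[of "p \<circ> \<pi>" S h, OF _ S add scale] le \<pi>(3) SV by force
  with \<pi>(3) that show ?thesis by (metis comp_apply)
qed

text \<open>Hahn-Banach extension of \<open>lim\<close> from the convergent to the bounded
  sequences, dominated by the supremum. \<open>L\<close> is total, but only on bounded sequences is
  it controlled; therefore the first bound asks for boundedness below as well.\<close>

lemma generalised_limit:
  obtains L :: "(nat \<Rightarrow> real) \<Rightarrow> real" where "linear L"
    "\<And>s c. (\<And>k. s k \<le> c) \<Longrightarrow> bdd_below (range s) \<Longrightarrow> L s \<le> c"
    "\<And>s c K. (\<And>k. k \<ge> K \<Longrightarrow> s k = c) \<Longrightarrow> L s = c"
proof -
  let ?V = "{s :: nat \<Rightarrow> real. Bseq s}"
  let ?S = "{s :: nat \<Rightarrow> real. convergent s}"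
  have bdd: "bdd_above (range s)" if "Bseq s" for s :: "nat \<Rightarrow> real"
    using that Bseq_eq_bounded bounded_imp_bdd_above by metis
  obtain L where L: "linear L" "\<And>s. s \<in> ?S \<Longrightarrow> L s = lim s"
      "\<And>s. s \<in> ?V \<Longrightarrow> L s \<le> (SUP k. s k)"
  proof (rule Hahn_Banach[of ?V ?S "\<lambda>s. SUP k. s k" lim])
    show "subspace ?V"
      using Bseq_add_iff unfolding subspace_def
      by (auto simp: zero_fun_def plus_fun_def scaleR_fun_def Bseq_eq_bounded intro: bounded_plus_comp bounded_scaling)
         (auto simp: Bseq_eq_bounded[symmetric] intro: Bseq_mult[of "\<lambda>_. _"])
    show "?S \<subseteq> ?V" using convergent_imp_Bseq by auto
    show "subspace ?S"
      unfolding subspace_def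
      by (auto simp: zero_fun_def plus_fun_def scaleR_fun_def convergent_const intro: convergent_add convergent_mult)
    show "(SUP k. (u + v) k) \<le> (SUP k. u k) + (SUP k. v k)" if "u \<in> ?V" "v \<in> ?V" for u v
      using that by (intro cSUP_least) (auto simp: plus_fun_def intro!: add_mono cSUP_upper bdd)
    show "(SUP k. (c *\<^sub>R v) k) = c * (SUP k. v k)" if "v \<in> ?V" "0 \<le> c" for c v
    proof (cases "c = 0")
      case True
      then show ?thesis by (simp add: zero_fun_def)
    next
      case False
      then have c: "c > 0" using that by simp
      have le: "c * v k \<le> c * (SUP k. v k)" for k
        using that by (intro mult_left_mono cSUP_upper bdd) auto
      have "(SUP k. v k) \<le> (SUP k. c * v k) / c"
      proof (rule cSUP_least)
        fix k
        have "c * v k \<le> (SUP k. c * v k)"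
          using le by (intro cSUP_upper bdd_aboveI2) auto
        then show "v k \<le> (SUP k. c * v k) / c" using c by (simp add: field_simps)
      qed simp
      moreover have "(SUP k. c * v k) \<le> c * (SUP k. v k)" using le by (intro cSUP_least) auto
      ultimately show ?thesis using c by (simp add: scaleR_fun_def field_simps)
    qed
    show "lim (u + v) = lim u + lim v" if "u \<in> ?S" "v \<in> ?S" for u v
      using that tendsto_add[of u "lim u" sequentially v "lim v"]
      by (auto simp: plus_fun_def convergent_LIMSEQ_iff intro: limI)
    show "lim (c *\<^sub>R v) = c * lim v" if "v \<in> ?S" for c v
      using that tendsto_mult_left[of v "lim v" sequentially c]
      by (auto simp: scaleR_fun_def convergent_LIMSEQ_iff intro: limI)
    show "lim v \<le> (SUP k. v k)" if "v \<in> ?S" for v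
      using that by (intro LIMSEQ_le_const2[of v])
        (auto simp: convergent_LIMSEQ_iff convergent_imp_Bseq intro!: cSUP_upper bdd)
  qed blast
  show thesis
  proof
    fix s :: "nat \<Rightarrow> real" and c assume s: "\<And>k. s k \<le> c" "bdd_below (range s)"
    then obtain b where "\<And>k. b \<le> s k" by (auto simp: bdd_below_def)
    then have "norm (s k) \<le> max \<bar>b\<bar> \<bar>c\<bar>" for k using s(1)[of k] by (smt (verit) real_norm_def)
    then have "Bseq s" by (rule BseqI')
    then have "L s \<le> (SUP k. s k)" using L(3) by simp
    also have "\<dots> \<le> c" using s by (intro cSUP_least) auto
    finally show "L s \<le> c" .
  next
    fix s :: "nat \<Rightarrow> real" and c K assume "\<And>k. k \<ge> K \<Longrightarrow> s k = c"
    then have "s \<longlonglongrightarrow> c" by (intro tendsto_eventually) (auto simp: eventually_sequentially)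
    then show "L s = c" using L(2)[of s] limI[of s c] by (auto simp: convergent_def)
  qed (rule L)
qed

subsection \<open>Uniform boundedness and Abel summation\<close>

text \<open>The inequality for the factor \<open>1/c\<close> at the point \<open>c u\<close> is the
  reverse inequality for \<open>c\<close>. Norms defined as suprema or infima satisfy the inequality
  directly, and this supplies the other half.\<close>

lemma abs_homogeneousI:
  fixes q :: "'v::real_vector \<Rightarrow> real"
  assumes le: "\<And>c u. u \<in> S \<Longrightarrow> q (c *\<^sub>R u) \<le> \<bar>c\<bar> * q u" and S: "subspace S"
    and nonneg: "\<And>u. u \<in> S \<Longrightarrow> 0 \<le> q u" and u: "u \<in> S"
  shows "q (c *\<^sub>R u) = \<bar>c\<bar> * q u"
proof (cases "c = 0")
  case True
  then show ?thesis using le[OF u, of 0] nonneg[OF subspace_0[OF S]] by simp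
next
  case False
  have "\<bar>c\<bar> * q ((1/c) *\<^sub>R (c *\<^sub>R u)) \<le> \<bar>c\<bar> * (\<bar>1/c\<bar> * q (c *\<^sub>R u))"
    by (intro mult_left_mono le subspace_scale[OF S] u) auto
  then show ?thesis using le[OF u, of c] False by (simp add: antisym)
qed

section \<open>Arithmetic of a norm on a carrier\<close>

context normed_space_on
begin

lemma zero_in: "0 \<in> V" and add_in: "u \<in> V \<Longrightarrow> v \<in> V \<Longrightarrow> u + v \<in> V"
  and scale_in: "v \<in> V \<Longrightarrow> c *\<^sub>R v \<in> V"
  using subspace by (auto simp: subspace_def)

lemma diff_in: "u \<in> V \<Longrightarrow> v \<in> V \<Longrightarrow> u - v \<in> V"
  using subspace by (rule subspace_diff)

lemma sum_in: "(\<And>i. i \<in> I \<Longrightarrow> s i \<in> V) \<Longrightarrow> sum s I \<in> V"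
  using subspace by (rule subspace_sum)

lemma N_zero: "N 0 = 0"
  using eq_zero_iff zero_in by blast

lemma N_minus: "v \<in> V \<Longrightarrow> N (- v) = N v"
  using scale[of v "-1"] by simp

lemma N_diff_commute: "u \<in> V \<Longrightarrow> v \<in> V \<Longrightarrow> N (u - v) = N (v - u)"
  using N_minus[OF diff_in, of u v] by simp

lemma N_diff_triangle: "u \<in> V \<Longrightarrow> v \<in> V \<Longrightarrow> w \<in> V \<Longrightarrow> N (u - w) \<le> N (u - v) + N (v - w)"
  using triangle[of "u - v" "v - w"] diff_in by simp

lemma N_reverse_triangle: "u \<in> V \<Longrightarrow> v \<in> V \<Longrightarrow> N u \<le> N (u - v) + N v"
  using triangle[of "u - v" v] diff_in by simp

lemma N_sum: "(\<And>i. i \<in> I \<Longrightarrow> s i \<in> V) \<Longrightarrow> N (sum s I) \<le> (\<Sum>i\<in>I. N (s i))"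
proof (induction I rule: infinite_finite_induct)
  case (insert i I)
  then have "N (s i + sum s I) \<le> N (s i) + N (sum s I)" by (intro triangle sum_in) auto
  with insert show ?case by fastforce
qed (auto simp: N_zero)

lemma norm_conv_unique:
  assumes "norm_conv V N s u" "norm_conv V N s v" "range s \<subseteq> V"
  shows "u = v"
proof -
  have uv: "u \<in> V" "v \<in> V" "\<And>n. s n \<in> V" using assms by (auto simp: norm_conv_def)
  have "(\<lambda>n. N (s n - u) + N (s n - v)) \<longlonglongrightarrow> 0 + 0"
    using assms by (intro tendsto_add) (auto simp: norm_conv_def)
  moreover have "N (u - v) \<le> N (s n - u) + N (s n - v)" for n
    using N_diff_triangle[of u "s n" v] N_diff_commute[of u "s n"] uv by simp
  ultimately have "N (u - v) \<le> 0" by (intro LIMSEQ_le_const[of _ 0]) auto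
  then show ?thesis using nonneg[of "u - v"] eq_zero_iff[of "u - v"] diff_in uv by simp
qed

end

text \<open>Zabreiko's lemma: the open mapping and uniform boundedness theorems in one statement.\<close>

lemma (in banach_space_on) countably_subadditive_bounded:
  assumes p_nonneg: "\<And>v. v \<in> V \<Longrightarrow> 0 \<le> p v"
    and p_scale: "\<And>c v. v \<in> V \<Longrightarrow> p (c *\<^sub>R v) = \<bar>c\<bar> * p v"
    and p_add: "\<And>u v. u \<in> V \<Longrightarrow> v \<in> V \<Longrightarrow> p (u + v) \<le> p u + p v"
    and p_sums: "\<And>s v. range s \<subseteq> V \<Longrightarrow> norm_conv V N (\<lambda>n. \<Sum>i<n. s i) v \<Longrightarrow>
        summable (\<lambda>i. p (s i)) \<Longrightarrow> p v \<le> (\<Sum>i. p (s i))"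
  shows "\<exists>C. \<forall>v\<in>V. p v \<le> C * N v"
proof -
  \<comment> \<open>Symmetry and nonnegativity of a metric are demanded on the whole type, whereas
    \<open>N\<close> is controlled only on \<open>V\<close>; hence the value 0 outside.\<close>
  define d where "d u v = (if u \<in> V \<and> v \<in> V then N (u - v) else 0)" for u v
  interpret M: Metric_space V d
    using nonneg diff_in N_diff_commute N_diff_triangle eq_zero_iff
    by unfold_locales (auto simp: d_def)
  have complete_M: "M.mcomplete"
    unfolding M.mcomplete_def
  proof (intro allI impI)
    fix s assume s: "M.MCauchy s"
    then have sV: "range s \<subseteq> V" by (simp add: M.MCauchy_def)
    have d: "d (s m) (s n) = N (s m - s n)" for m n using sV by (auto simp: d_def)
    have "\<exists>v. norm_conv V N s v"
    proof (rule complete[OF sV])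
      fix e :: real assume "e > 0"
      then show "\<exists>M. \<forall>m\<ge>M. \<forall>n\<ge>M. N (s m - s n) < e"
        using s d unfolding M.MCauchy_def by metis
    qed
    then obtain v where v: "v \<in> V" "(\<lambda>n. N (s n - v)) \<longlonglongrightarrow> 0" by (auto simp: norm_conv_def)
    have "\<exists>K. \<forall>n\<ge>K. s n \<in> V \<and> d (s n) v < e" if "e > 0" for e
      using order_tendstoD(2)[OF v(2) that] sV v(1)
      by (auto simp: eventually_sequentially d_def)
    then show "\<exists>x. limitin M.mtopology s x sequentially"
      using v(1) by (auto simp: M.limit_metric_sequentially)
  qed
  \<comment> \<open>By the Baire category theorem some sublevel set of \<open>p\<close> is dense in
    a ball.\<close>
  define A where "A m = {v \<in> V. p v \<le> real m}" for m :: nat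
  have "\<exists>m. M.mtopology interior_of (M.mtopology closure_of (A m)) \<noteq> {}"
  proof (rule ccontr)
    assume "\<not> ?thesis"
    then have "M.mtopology interior_of \<Union>(range (\<lambda>m. M.mtopology closure_of (A m))) = {}"
      by (intro M.metric_Baire_category_alt complete_M) auto
    moreover have "\<Union>(range (\<lambda>m. M.mtopology closure_of (A m))) = V"
    proof
      show "\<Union>(range (\<lambda>m. M.mtopology closure_of (A m))) \<subseteq> V"
        using closure_of_subset_topspace[of M.mtopology] by (auto simp: subset_iff)
      show "V \<subseteq> \<Union>(range (\<lambda>m. M.mtopology closure_of (A m)))"
      proof
        fix v assume v: "v \<in> V"
        obtain m where "p v \<le> real m" using real_arch_simple by blast
        then have "v \<in> A m" using v by (simp add: A_def)
        moreover have "A m \<subseteq> M.mtopology closure_of A m"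
          by (intro closure_of_subset) (auto simp: A_def)
        ultimately show "v \<in> \<Union>(range (\<lambda>m. M.mtopology closure_of (A m)))" by blast
      qed
    qed
    ultimately have "V = {}" using interior_of_topspace[of M.mtopology] by simp
    then show False using zero_in by simp
  qed
  then obtain m u0 where "u0 \<in> M.mtopology interior_of (M.mtopology closure_of (A m))" by blast
  then obtain r where u0: "u0 \<in> V" and r: "r > 0" and ball: "M.mball u0 r \<subseteq> M.mtopology closure_of (A m)"
    by (auto simp: M.metric_interior_of)
  have near: "\<exists>a\<in>A m. N (v - a) < e" if v: "v \<in> V" "N (u0 - v) < r" "e > 0" for v e
  proof -
    have "v \<in> M.mball u0 r" using v u0 by (simp add: d_def)
    then have "v \<in> M.mtopology closure_of (A m)" using ball by blast
    then obtain a where "a \<in> A m" "a \<in> M.mball v e"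
      using v(3) by (auto simp: M.metric_closure_of)
    then show ?thesis by (auto simp: d_def)
  qed
  \<comment> \<open>Differences of two approximants, of \<open>u0 + w\<close> and of
    \<open>u0\<close>, move the ball to the origin at the price of doubling the bound on
    \<open>p\<close>.\<close>
  have small: "\<exists>a\<in>V. p a \<le> 2 * real m \<and> N (w - a) < e" if w: "w \<in> V" "N w < r" and e: "e > 0" for w e
  proof -
    have "\<exists>a\<in>A m. N (u0 + w - a) < e/2"
      using w u0 e N_minus[OF w(1)] by (intro near add_in) auto
    moreover have "\<exists>b\<in>A m. N (u0 - b) < e/2"
      using u0 r e N_zero by (intro near) auto
    ultimately obtain a b where a: "a \<in> V" "p a \<le> m" "N (u0 + w - a) < e/2"
      and b: "b \<in> V" "p b \<le> m" "N (u0 - b) < e/2" by (auto simp: A_def)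
    have "p (a + (-1) *\<^sub>R b) \<le> 2 * real m"
      using p_add[of a "(-1) *\<^sub>R b"] p_scale[of b "-1"] a b scale_in[OF b(1), of "-1"] by simp
    moreover have "N (w - (a - b)) \<le> N (u0 + w - a) + N (b - u0)"
      using triangle[of "u0 + w - a" "b - u0"] u0 w a b add_in diff_in by (simp add: algebra_simps)
    ultimately show ?thesis
      using a b N_diff_commute[OF b(1) u0] diff_in by (intro bexI[of _ "a - b"]) auto
  qed
  \<comment> \<open>On vectors of norm below \<open>r\<close> the bound is \<open>2 m\<close>;
    scaling \<open>v\<close> to norm \<open>r/2\<close> gives the factor
    \<open>2 m / (r/2)\<close>.\<close>
  define c where "c = 4 * real m / r"
  have c0: "c \<ge> 0" using r by (simp add: c_def)
  have approx: "\<exists>a\<in>V. p a \<le> c * N v \<and> N (v - a) < e" if v: "v \<in> V" and e: "e > 0" for v e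
  proof (cases "N v = 0")
    case True
    then have "v = 0" using v eq_zero_iff by simp
    then show ?thesis using e N_zero zero_in p_scale[OF zero_in, of 0] by (intro bexI[of _ 0]) auto
  next
    case False
    then have Nv: "N v > 0" using nonneg[OF v] by simp
    define t where "t = r / 2 / N v"
    have t: "t > 0" using r Nv by (simp add: t_def)
    have "N (t *\<^sub>R v) < r" using v t r Nv by (simp add: scale t_def)
    then obtain a where a: "a \<in> V" "p a \<le> 2 * real m" "N (t *\<^sub>R v - a) < e * t"
      using small[of "t *\<^sub>R v" "e * t"] v scale_in e t by auto
    have "p ((1/t) *\<^sub>R a) \<le> c * N v"
      using p_scale[OF a(1), of "1/t"] a(2) t Nv r by (simp add: t_def c_def field_simps)
    moreover have "N (v - (1/t) *\<^sub>R a) = (1/t) * N (t *\<^sub>R v - a)"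
      using scale[of "t *\<^sub>R v - a" "1/t"] a v t diff_in scale_in by (simp add: scaleR_diff_right)
    then have "N (v - (1/t) *\<^sub>R a) < e" using a(3) t by (simp add: pos_divide_less_eq)
    ultimately show ?thesis using scale_in[OF a(1)] by blast
  qed
  have "p v \<le> (2 * c) * N v" if v: "v \<in> V" for v
  proof (cases "N v = 0")
    case True
    then have "v = 0" using v eq_zero_iff by simp
    then show ?thesis using p_scale[OF zero_in, of 0] N_zero by simp
  next
    case False
    then have Nv: "N v > 0" using nonneg[OF v] by simp
    \<comment> \<open>\<open>w n\<close> will be the remainder after \<open>n\<close>
      approximations. Its bound halves each time, so \<open>v\<close> is the sum of pieces whose
      values under \<open>p\<close> are dominated by a geometric series with sum
      \<open>2 c N v\<close>.\<close>
    define P where "P n w = (w \<in> V \<and> N w \<le> N v * (1/2)^n)" for n :: nat and w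
    have "\<exists>w. \<forall>n. P n (w n) \<and> p (w n - w (Suc n)) \<le> c * (N v * (1/2)^n) \<and> (n = 0 \<longrightarrow> w n = v)"
    proof -
      have step: "\<exists>w'. P (Suc n) w' \<and> p (w - w') \<le> c * (N v * (1/2)^n)" if "P n w" for n w
      proof -
        have w: "w \<in> V" "N w \<le> N v * (1/2)^n" using that by (auto simp: P_def)
        obtain a where a: "a \<in> V" "p a \<le> c * N w" "N (w - a) < N v * (1/2)^(Suc n)"
          using approx[OF w(1), of "N v * (1/2)^(Suc n)"] Nv by auto
        moreover have "c * N w \<le> c * (N v * (1/2)^n)" using w(2) c0 by (intro mult_left_mono) auto
        ultimately show ?thesis
          using w(1) diff_in by (intro exI[of _ "w - a"]) (auto simp: P_def)
      qed
      have "\<exists>w. w 0 = v \<and> (\<forall>n. P n (w n) \<and> p (w n - w (Suc n)) \<le> c * (N v * (1/2)^n))"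
      proof -
        define g where "g n w = (SOME w'. P (Suc n) w' \<and> p (w - w') \<le> c * (N v * (1/2)^n))" for n w
        have g: "P (Suc n) (g n w) \<and> p (w - g n w) \<le> c * (N v * (1/2)^n)" if "P n w" for n w
          unfolding g_def by (rule someI_ex[OF step[OF that]])
        define W where "W = rec_nat v g"
        have W: "W 0 = v" "W (Suc n) = g n (W n)" for n by (auto simp: W_def)
        have "P n (W n)" for n by (induction n) (use v g in \<open>auto simp: W P_def[of 0]\<close>)
        then show ?thesis using W g by metis
      qed
      then show ?thesis by blast
    qed
    then obtain w where wP: "\<And>n. P n (w n)" and pw: "\<And>n. p (w n - w (Suc n)) \<le> c * (N v * (1/2)^n)"
      and w0: "w 0 = v" by blast
    define s where "s n = w n - w (Suc n)" for n
    have sV: "range s \<subseteq> V" using wP diff_in by (auto simp: s_def P_def)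
    have part: "(\<Sum>i<n. s i) = v - w n" for n
      by (induction n) (auto simp: s_def w0)
    have "(\<lambda>n. N (w n)) \<longlonglongrightarrow> 0"
    proof (rule tendsto_sandwich[of "\<lambda>_. 0"])
      show "(\<lambda>n. N v * (1/2)^n) \<longlonglongrightarrow> 0" by (intro tendsto_mult_right_zero LIMSEQ_power_zero) auto
    qed (use wP nonneg in \<open>auto simp: P_def\<close>)
    then have conv: "norm_conv V N (\<lambda>n. \<Sum>i<n. s i) v"
      using v wP N_minus by (auto simp: norm_conv_def part P_def)
    have geo: "(\<lambda>n. c * (N v * (1/2)^n)) sums (c * (N v * 2))"
      using geometric_sums[of "1/2::real"] by (intro sums_mult) auto
    have ps: "p (s n) \<le> c * (N v * (1/2)^n)" for n using pw by (simp add: s_def)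
    have sm: "summable (\<lambda>n. p (s n))"
    proof (rule summable_comparison_test'[OF sums_summable[OF geo], of 0])
      show "norm (p (s n)) \<le> c * (N v * (1/2)^n)" for n
        using ps[of n] p_nonneg[of "s n"] sV by (simp add: image_subset_iff)
    qed
    have "p v \<le> (\<Sum>n. p (s n))" by (rule p_sums[OF sV conv sm])
    also have "\<dots> \<le> c * (N v * 2)"
      using suminf_le[OF ps sm sums_summable[OF geo]] sums_unique[OF geo] by simp
    finally show ?thesis by simp
  qed
  then show ?thesis by blast
qed

lemma banach_space_on_UNIV: "banach_space_on (UNIV :: 'a::banach set) norm"
proof unfold_locales
  fix s :: "nat \<Rightarrow> 'a"
  assume *: "\<And>e. e > 0 \<Longrightarrow> \<exists>M. \<forall>m\<ge>M. \<forall>n\<ge>M. norm (s m - s n) < e"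
  have "Cauchy s" by (rule CauchyI) (use * in blast)
  then obtain v where "s \<longlonglongrightarrow> v" using Cauchy_convergent convergent_def by blast
  then show "\<exists>v. norm_conv UNIV norm s v"
    using tendsto_norm_zero[OF LIM_zero[of s v]] by (auto simp: norm_conv_def)
qed (auto simp: norm_triangle_ineq)

text \<open>The supremum of the \<open>q n\<close> is countably subadditive because each
  \<open>q n\<close> is continuous, so Zabreiko's lemma applies to it.\<close>

lemma uniform_boundedness:
  fixes q :: "nat \<Rightarrow> 'a::banach \<Rightarrow> real"
  assumes q_scale: "\<And>n c u. q n (c *\<^sub>R u) = \<bar>c\<bar> * q n u"
    and add: "\<And>n u v. q n (u + v) \<le> q n u + q n v"
    and cont: "\<And>n u. q n u \<le> c n * norm u"
    and bdd: "\<And>u. bdd_above (range (\<lambda>n. q n u))"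
  obtains K where "K \<ge> 0" "\<And>n u. q n u \<le> K * norm u"
proof -
  have q_nonneg: "q n u \<ge> 0" for n u
    using add[of n u "-1 *\<^sub>R u"] q_scale[of n "-1" u] q_scale[of n 0 0] by simp
  define p where "p u = (SUP n. q n u)" for u
  have le: "q n u \<le> p u" for n u unfolding p_def by (intro cSUP_upper bdd) auto
  have p_least: "p u \<le> C" if "\<And>n. q n u \<le> C" for u C
    unfolding p_def using that by (intro cSUP_least) auto
  interpret banach_space_on "UNIV :: 'a set" norm by (rule banach_space_on_UNIV)
  have "\<exists>C. \<forall>u\<in>UNIV. p u \<le> C * norm u"
  proof (rule countably_subadditive_bounded)
    show "0 \<le> p u" for u using q_nonneg[of 0 u] le[of 0 u] by simp
    have *: "p (c *\<^sub>R u) \<le> \<bar>c\<bar> * p u" for c u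
      by (intro p_least) (auto simp: q_scale intro!: mult_left_mono le)
    show "p (c *\<^sub>R u) = \<bar>c\<bar> * p u" for c u
      by (rule abs_homogeneousI[where S = UNIV]) (use * order_trans[OF q_nonneg le] in auto)
    show "p (u + v) \<le> p u + p v" for u v
      using le add by (intro p_least) (meson add_mono order_trans)
    fix s :: "nat \<Rightarrow> 'a" and v
    assume s: "norm_conv UNIV norm (\<lambda>n. \<Sum>i<n. s i) v" and sm: "summable (\<lambda>i. p (s i))"
    show "p v \<le> (\<Sum>i. p (s i))"
    proof (rule p_least)
      fix n
      have part: "q n (\<Sum>i<m. s i) \<le> (\<Sum>i. p (s i))" for m
      proof -
        have "q n (\<Sum>i<m. s i) \<le> (\<Sum>i<m. q n (s i))"
        proof (induction m)
          case 0 then show ?case using q_scale[of n 0 0] by simp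
        next
          case (Suc m) then show ?case using add[of n "\<Sum>i<m. s i" "s m"] by simp
        qed
        also have "\<dots> \<le> (\<Sum>i<m. p (s i))" by (intro sum_mono le)
        also have "\<dots> \<le> (\<Sum>i. p (s i))"
          using sm order_trans[OF q_nonneg le] by (intro sum_le_suminf) auto
        finally show ?thesis .
      qed
      have "q n v \<le> (\<Sum>i. p (s i)) + c n * norm ((\<Sum>i<m. s i) - v)" for m
        using part[of m] add[of n "\<Sum>i<m. s i" "v - (\<Sum>i<m. s i)"] cont[of n "v - (\<Sum>i<m. s i)"]
        by (simp add: norm_minus_commute)
      moreover have "(\<lambda>m. (\<Sum>i. p (s i)) + c n * norm ((\<Sum>i<m. s i) - v)) \<longlonglongrightarrow> (\<Sum>i. p (s i)) + c n * 0"
        using s by (intro tendsto_intros) (simp add: norm_conv_def)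
      ultimately show "q n v \<le> (\<Sum>i. p (s i))" by (intro LIMSEQ_le_const[of _ "(\<Sum>i. p (s i))"]) auto
    qed
  qed
  then obtain C where C: "p u \<le> C * norm u" for u by auto
  show thesis
  proof
    show "q n u \<le> max C 0 * norm u" for n u
      using le[of n u] C[of u] mult_right_mono[of C "max C 0" "norm u"] by simp
  qed simp
qed

section \<open>Partial sums of pointwise convergent series of operators, Abel summation\<close>

lemma partial_sums_bounded:
  fixes B :: "nat \<Rightarrow> 'a::banach \<Rightarrow> 'b::real_normed_vector"
  assumes bl: "\<And>i. bounded_linear (B i)" and sm: "\<And>u. summable (\<lambda>i. B i u)"
  obtains K where "K \<ge> 0" "\<And>n u. norm (\<Sum>i<n. B i u) \<le> K * norm u"
proof (rule uniform_boundedness[of "\<lambda>n u. norm (\<Sum>i<n. B i u)" "\<lambda>n. onorm (\<lambda>u. \<Sum>i<n. B i u)"])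
  have bls: "bounded_linear (\<lambda>u. \<Sum>i<n. B i u)" for n
    using bl by (intro bounded_linear_sum)
  show "norm (\<Sum>i<n. B i (c *\<^sub>R u)) = \<bar>c\<bar> * norm (\<Sum>i<n. B i u)" for n c u
    using linear_scale[OF bounded_linear.linear[OF bls[of n]], of c u] by simp
  show "norm (\<Sum>i<n. B i (u + v)) \<le> norm (\<Sum>i<n. B i u) + norm (\<Sum>i<n. B i v)" for n u v
    using linear_add[OF bounded_linear.linear[OF bls[of n]], of u v] norm_triangle_ineq by simp
  show "norm (\<Sum>i<n. B i u) \<le> onorm (\<lambda>u. \<Sum>i<n. B i u) * norm u" for n u
    by (rule onorm[OF bls])
  show "bdd_above (range (\<lambda>n. norm (\<Sum>i<n. B i u)))" for u
  proof -
    have "Bseq (\<lambda>n. \<Sum>i<n. B i u)"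
      using sm by (intro convergent_imp_Bseq) (simp add: summable_iff_convergent)
    then obtain C where "\<And>n. norm (\<Sum>i<n. B i u) \<le> C" by (auto simp: Bseq_def)
    then show ?thesis by (intro bdd_aboveI2) auto
  qed
qed (use that in auto)

text \<open>Operators in place of scalar factors let one identity serve for vectors, for functionals
  and for elements of the bidual. Each difference of \<open>v\<close> meets a block sum of the
  \<open>B i\<close>, and block sums are what the applications can bound.\<close>

lemma sum_by_parts:
  fixes B :: "nat \<Rightarrow> 'a::real_normed_vector \<Rightarrow> 'b::real_normed_vector"
  assumes bl: "\<And>i. bounded_linear (B i)" and "k \<le> l"
  shows "(\<Sum>i=k..<l. B i (v i)) = (\<Sum>j=k..<l. \<Sum>i=k..j. B i (v j - v (Suc j))) + (\<Sum>i=k..<l. B i (v l))"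
  using \<open>k \<le> l\<close>
proof (induction l rule: dec_induct)
  case (step l)
  have *: "B i (v l) = B i (v l - v (Suc l)) + B i (v (Suc l))" for i
    using linear_add[OF bounded_linear.linear[OF bl[of i]], of "v l - v (Suc l)" "v (Suc l)"] by simp
  have "(\<Sum>i=k..<Suc l. B i (v l)) = (\<Sum>i=k..l. B i (v l - v (Suc l))) + (\<Sum>i=k..<Suc l. B i (v (Suc l)))"
    by (simp add: atLeastLessThanSuc_atLeastAtMost sum.distrib[symmetric] * [symmetric])
  with step show ?case by simp
qed simp

text \<open>The mechanism behind both hypotheses on the frame: convergence for every fixed argument
  extends to arguments that change with \<open>i\<close> but have finite total variation. It is
  applied to functionals for shrinking and to elements of the bidual for bounded
  completeness.\<close>

lemma summable_bounded_variation:
  fixes B :: "nat \<Rightarrow> 'a::banach \<Rightarrow> 'b::banach"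
  assumes bl: "\<And>i. bounded_linear (B i)" and sm: "\<And>u. summable (\<lambda>i. B i u)"
    and bv: "summable (\<lambda>i. norm (v i - v (Suc i)))"
  shows "summable (\<lambda>i. B i (v i))"
proof -
  obtain K where K: "K \<ge> 0" "\<And>n u. norm (\<Sum>i<n. B i u) \<le> K * norm u"
    using partial_sums_bounded[OF bl sm] by blast
  have K2: "norm (\<Sum>i=k..<l. B i u) \<le> (2 * K) * norm u" if "k \<le> l" for k l u
  proof -
    have "(\<Sum>i=k..<l. B i u) = (\<Sum>i<l. B i u) - (\<Sum>i<k. B i u)"
      using sum.atLeastLessThan_concat[of 0 k l "\<lambda>i. B i u"] that by (simp add: atLeast0LessThan algebra_simps)
    then show ?thesis using norm_triangle_ineq4[of "\<Sum>i<l. B i u" "\<Sum>i<k. B i u"] K(2)[of u l] K(2)[of u k] by simp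
  qed
  have "summable (\<lambda>i. v (Suc i) - v i)"
    by (rule summable_norm_cancel, subst norm_minus_commute, rule bv)
  then obtain w' where w': "(\<lambda>n. \<Sum>i<n. v (Suc i) - v i) \<longlonglongrightarrow> w'"
    unfolding summable_def sums_def by blast
  define w where "w = w' + v 0"
  have w: "v \<longlonglongrightarrow> w"
    using tendsto_add[OF w' tendsto_const, of "v 0"] unfolding w_def sum_lessThan_telescope by simp
  show ?thesis
    unfolding summable_Cauchy
  proof (intro allI impI)
    fix e :: real assume e: "e > 0"
    \<comment> \<open>Three error terms get at most \<open>e/4\<close> each: the differences of
      \<open>v\<close>, the distance of \<open>v l\<close> from the limit \<open>w\<close>, and a
      block of the series at \<open>w\<close>.\<close>
    define e' where "e' = e / (4 * (2 * K + 1))"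
    have e': "e' > 0" and Ke: "(2 * K) * e' \<le> e / 4"
      using e K(1) by (auto simp: e'_def field_simps)
    obtain k1 where k1: "\<And>k l. k \<ge> k1 \<Longrightarrow> norm (\<Sum>i=k..<l. norm (v i - v (Suc i))) < e'"
      using bv e' unfolding summable_Cauchy by blast
    obtain k2 where k2: "\<And>k. k \<ge> k2 \<Longrightarrow> norm (v k - w) < e'"
      using w e' by (meson LIMSEQ_D)
    obtain k3 where k3: "\<And>k l. k \<ge> k3 \<Longrightarrow> norm (\<Sum>i=k..<l. B i w) < e/4"
      using sm[of w] e unfolding summable_Cauchy by (meson divide_pos_pos zero_less_numeral)
    show "\<exists>M. \<forall>m\<ge>M. \<forall>n. norm (\<Sum>i=m..<n. B i (v i)) < e"
    proof (intro exI allI impI)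
      fix k l assume k: "k \<ge> max k1 (max k2 k3)"
      show "norm (\<Sum>i=k..<l. B i (v i)) < e"
      proof (cases "k \<le> l")
        case True
        have "norm (\<Sum>j=k..<l. \<Sum>i=k..j. B i (v j - v (Suc j))) \<le> (\<Sum>j=k..<l. (2 * K) * norm (v j - v (Suc j)))"
          using K2[of k "Suc _"] by (intro sum_norm_le) (simp add: atLeastLessThanSuc_atLeastAtMost)
        also have "\<dots> \<le> (2 * K) * e'"
          unfolding sum_distrib_left[symmetric] using k1[of k l] k K(1) by (intro mult_left_mono) auto
        finally have 1: "norm (\<Sum>j=k..<l. \<Sum>i=k..j. B i (v j - v (Suc j))) \<le> e/4" using Ke by simp
        have "(\<Sum>i=k..<l. B i (v l)) = (\<Sum>i=k..<l. B i (v l - w)) + (\<Sum>i=k..<l. B i w)"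
          unfolding sum.distrib[symmetric]
          using linear_add[OF bounded_linear.linear[OF bl], of _ "v l - w" w] by simp
        moreover have "norm (\<Sum>i=k..<l. B i (v l - w)) \<le> e/4"
        proof -
          have "norm (\<Sum>i=k..<l. B i (v l - w)) \<le> (2 * K) * norm (v l - w)" by (rule K2[OF True])
          also have "\<dots> \<le> (2 * K) * e'" using k2[of l] k True K(1) by (intro mult_left_mono) auto
          finally show ?thesis using Ke by simp
        qed
        ultimately have 2: "norm (\<Sum>i=k..<l. B i (v l)) < e/2"
          using k3[of k l] k norm_triangle_ineq[of "\<Sum>i=k..<l. B i (v l - w)" "\<Sum>i=k..<l. B i w"] by auto
        show ?thesis
          unfolding sum_by_parts[where B = B and v = v, OF bl True]
          using 1 2 norm_triangle_ineq[of "\<Sum>j=k..<l. \<Sum>i=k..j. B i (v j - v (Suc j))" "\<Sum>i=k..<l. B i (v l)"] e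
          by linarith
      qed (use e in simp)
    qed
  qed
qed

subsection \<open>Duals of spaces on a carrier\<close>

text \<open>The vector \<open>v\<close> certifies that the supremum is taken over a nonempty
  set.\<close>

lemma dual_norm_least:
  assumes "v \<in> W" "N v \<le> 1" "\<And>v. v \<in> W \<Longrightarrow> N v \<le> 1 \<Longrightarrow> \<bar>g v\<bar> \<le> C"
  shows "dual_norm W N g \<le> C"
  unfolding dual_norm_def using assms by (intro cSUP_least) auto

lemma dual_spaceI:
  assumes "\<And>u v. u \<in> V \<Longrightarrow> v \<in> V \<Longrightarrow> g (u + v) = g u + g v"
    "\<And>c v. v \<in> V \<Longrightarrow> g (c *\<^sub>R v) = c * g v"
    "\<And>v. v \<in> V \<Longrightarrow> \<bar>g v\<bar> \<le> C * N v"
    "\<And>v. v \<notin> V \<Longrightarrow> g v = 0"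
  shows "g \<in> dual_space V N"
  unfolding dual_space_def using assms by blast

context normed_space_on
begin

lemma dual_space_bounded:
  assumes "g \<in> dual_space V N"
  obtains C where "C \<ge> 0" "\<And>v. v \<in> V \<Longrightarrow> \<bar>g v\<bar> \<le> C * N v"
proof -
  obtain C where C: "\<And>v. v \<in> V \<Longrightarrow> \<bar>g v\<bar> \<le> C * N v"
    using assms unfolding dual_space_def by blast
  have "\<bar>g v\<bar> \<le> max C 0 * N v" if "v \<in> V" for v
    using C[OF that] mult_right_mono[of C "max C 0" "N v"] nonneg[OF that] by simp
  then show thesis by (intro that[of "max C 0"]) auto
qed

text \<open>Stated for a subset \<open>W\<close> that contains the line through \<open>v\<close>,
  because the definition of a shrinking basis takes norms over closed spans of tails of the
  basis.\<close>

lemma dual_norm_apply: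
  assumes g: "g \<in> dual_space V N" and W: "W \<subseteq> V" "\<And>c. c *\<^sub>R v \<in> W"
  shows "\<bar>g v\<bar> \<le> dual_norm W N g * N v"
proof -
  obtain C where C: "C \<ge> 0" "\<And>v. v \<in> V \<Longrightarrow> \<bar>g v\<bar> \<le> C * N v" using dual_space_bounded[OF g] by blast
  have v: "v \<in> V" using W(1) W(2)[of 1] by auto
  show ?thesis
  proof (cases "N v = 0")
    case True
    then show ?thesis using C(2)[OF v] by simp
  next
    case False
    then have Nv: "N v > 0" using nonneg[OF v] by simp
    have gs: "g ((1 / N v) *\<^sub>R v) = (1 / N v) * g v"
      using g v by (simp add: dual_space_def)
    have "\<bar>g ((1 / N v) *\<^sub>R v)\<bar> \<le> dual_norm W N g"
      unfolding dual_norm_def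
    proof (rule cSUP_upper)
      show "(1 / N v) *\<^sub>R v \<in> {v \<in> W. N v \<le> 1}" using W Nv v by (simp add: scale)
      have "\<bar>g w\<bar> \<le> C" if "w \<in> {v \<in> W. N v \<le> 1}" for w
        using C(2)[of w] mult_left_mono[of "N w" 1 C] C(1) that W(1) by auto
      then show "bdd_above ((\<lambda>v. \<bar>g v\<bar>) ` {v \<in> W. N v \<le> 1})" by (intro bdd_aboveI2) auto
    qed
    then show ?thesis using Nv by (simp add: gs abs_mult field_simps)
  qed
qed

lemma dual_norm_bound: "g \<in> dual_space V N \<Longrightarrow> v \<in> V \<Longrightarrow> \<bar>g v\<bar> \<le> dual_norm V N g * N v"
  using dual_norm_apply[of g V v] scale_in by simp

lemma dual_norm_nonneg:
  assumes g: "g \<in> dual_space V N" and W: "W \<subseteq> V" "0 \<in> W"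
  shows "0 \<le> dual_norm W N g"
proof -
  obtain C where C: "C \<ge> 0" "\<And>v. v \<in> V \<Longrightarrow> \<bar>g v\<bar> \<le> C * N v" using dual_space_bounded[OF g] by blast
  have "\<bar>g w\<bar> \<le> C" if "w \<in> {v \<in> W. N v \<le> 1}" for w
    using C(2)[of w] mult_left_mono[of "N w" 1 C] C(1) that W by auto
  then have "\<bar>g 0\<bar> \<le> dual_norm W N g"
    unfolding dual_norm_def using W(2) by (intro cSUP_upper bdd_aboveI2) (auto simp: N_zero)
  then show ?thesis by linarith
qed

lemma dual_space_add: "g \<in> dual_space V N \<Longrightarrow> h \<in> dual_space V N \<Longrightarrow> g + h \<in> dual_space V N"
proof -
  assume gh: "g \<in> dual_space V N" "h \<in> dual_space V N"
  obtain C where C: "\<And>v. v \<in> V \<Longrightarrow> \<bar>g v\<bar> \<le> C * N v" using dual_space_bounded[OF gh(1)] by blast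
  obtain D where D: "\<And>v. v \<in> V \<Longrightarrow> \<bar>h v\<bar> \<le> D * N v" using dual_space_bounded[OF gh(2)] by blast
  show ?thesis
  proof (rule dual_spaceI[where C = "C + D"])
    show "\<bar>(g + h) v\<bar> \<le> (C + D) * N v" if "v \<in> V" for v
      using C[OF that] D[OF that] by (simp add: plus_fun_def distrib_right)
  qed (use gh in \<open>auto simp: dual_space_def plus_fun_def algebra_simps\<close>)
qed

lemma dual_space_scale: "g \<in> dual_space V N \<Longrightarrow> c *\<^sub>R g \<in> dual_space V N"
proof -
  assume g: "g \<in> dual_space V N"
  obtain C where C: "\<And>v. v \<in> V \<Longrightarrow> \<bar>g v\<bar> \<le> C * N v" using dual_space_bounded[OF g] by blast
  show ?thesis
  proof (rule dual_spaceI[where C = "\<bar>c\<bar> * C"])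
    show "\<bar>(c *\<^sub>R g) v\<bar> \<le> \<bar>c\<bar> * C * N v" if "v \<in> V" for v
      using mult_left_mono[OF C[OF that], of "\<bar>c\<bar>"] by (simp add: scaleR_fun_def abs_mult)
  qed (use g in \<open>auto simp: dual_space_def scaleR_fun_def algebra_simps\<close>)
qed

lemma zero_in_dual_space: "0 \<in> dual_space V N"
  by (rule dual_spaceI[where C = 0]) (auto simp: zero_fun_def)

lemma subspace_dual_space: "Real_Vector_Spaces.subspace (dual_space V N)"
  using dual_space_add dual_space_scale zero_in_dual_space by (auto simp: Real_Vector_Spaces.subspace_def)

end

subsection \<open>Schauder bases on a carrier\<close>

locale banach_basis = banach_space_on V N for V :: "'v::real_vector set" and N +
  fixes z :: "nat \<Rightarrow> 'v"
  assumes basis: "Schauder_basis V N z"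
begin

abbreviation crd :: "nat \<Rightarrow> 'v \<Rightarrow> real" where "crd \<equiv> coord V N z"

lemma z_in: "z i \<in> V"
  using basis by (auto simp: Schauder_basis_def)

lemma partial_sum_in: "(\<Sum>i\<in>I. a i *\<^sub>R z i) \<in> V"
  by (intro sum_in scale_in z_in)

lemma expansion_in: "expansion V N z a v \<Longrightarrow> v \<in> V"
  by (simp add: expansion_def norm_conv_def)

lemma coord_eqI: "expansion V N z a v \<Longrightarrow> crd i v = a i"
proof -
  assume a: "expansion V N z a v"
  then have "\<exists>!a. expansion V N z a v" using basis expansion_in by (simp add: Schauder_basis_def)
  then have "(THE a. expansion V N z a v) = a" by (rule the1_equality) (rule a)
  then show ?thesis by (simp add: coord_def)
qed

lemma expansion_coord:
  assumes "v \<in> V" shows "expansion V N z (\<lambda>i. crd i v) v"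
proof -
  obtain a where a: "expansion V N z a v" using basis assms by (auto simp: Schauder_basis_def)
  then have "(\<lambda>i. crd i v) = a" using coord_eqI by blast
  with a show ?thesis by simp
qed

lemma expansion_add:
  assumes "expansion V N z a u" "expansion V N z b v"
  shows "expansion V N z (\<lambda>i. a i + b i) (u + v)"
proof -
  have uv: "u \<in> V" "v \<in> V" using assms expansion_in by auto
  have "(\<lambda>n. N ((\<Sum>i<n. (a i + b i) *\<^sub>R z i) - (u + v))) \<longlonglongrightarrow> 0"
  proof (rule tendsto_sandwich[of "\<lambda>_. 0"])
    show "(\<lambda>n. N ((\<Sum>i<n. a i *\<^sub>R z i) - u) + N ((\<Sum>i<n. b i *\<^sub>R z i) - v)) \<longlonglongrightarrow> 0"
      using assms tendsto_add[of _ 0 _ _ 0] by (auto simp: expansion_def norm_conv_def)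
    show "\<forall>\<^sub>F n in sequentially. N ((\<Sum>i<n. (a i + b i) *\<^sub>R z i) - (u + v)) \<le>
        N ((\<Sum>i<n. a i *\<^sub>R z i) - u) + N ((\<Sum>i<n. b i *\<^sub>R z i) - v)"
    proof (intro always_eventually allI)
      fix n
      have "(\<Sum>i<n. (a i + b i) *\<^sub>R z i) - (u + v) = ((\<Sum>i<n. a i *\<^sub>R z i) - u) + ((\<Sum>i<n. b i *\<^sub>R z i) - v)"
        by (simp add: scaleR_add_left sum.distrib)
      also have "N \<dots> \<le> N ((\<Sum>i<n. a i *\<^sub>R z i) - u) + N ((\<Sum>i<n. b i *\<^sub>R z i) - v)"
        by (intro triangle diff_in partial_sum_in uv)
      finally show "N ((\<Sum>i<n. (a i + b i) *\<^sub>R z i) - (u + v)) \<le>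
        N ((\<Sum>i<n. a i *\<^sub>R z i) - u) + N ((\<Sum>i<n. b i *\<^sub>R z i) - v)" .
    qed
    show "\<forall>\<^sub>F n in sequentially. 0 \<le> N ((\<Sum>i<n. (a i + b i) *\<^sub>R z i) - (u + v))"
      using uv by (intro always_eventually allI nonneg diff_in partial_sum_in add_in)
  qed auto
  then show ?thesis using uv add_in by (simp add: expansion_def norm_conv_def)
qed

lemma expansion_scale:
  assumes "expansion V N z a u"
  shows "expansion V N z (\<lambda>i. c * a i) (c *\<^sub>R u)"
proof -
  have u: "u \<in> V" using assms expansion_in by auto
  have "N ((\<Sum>i<n. (c * a i) *\<^sub>R z i) - c *\<^sub>R u) = \<bar>c\<bar> * N ((\<Sum>i<n. a i *\<^sub>R z i) - u)" for n
    using scale[of "(\<Sum>i<n. a i *\<^sub>R z i) - u" c] diff_in partial_sum_in u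
    by (simp add: scaleR_diff_right scaleR_sum_right)
  then show ?thesis
    using assms u scale_in tendsto_mult_left[of _ 0 _ "\<bar>c\<bar>"] by (simp add: expansion_def norm_conv_def)
qed

lemma coord_add: "u \<in> V \<Longrightarrow> v \<in> V \<Longrightarrow> crd i (u + v) = crd i u + crd i v"
  by (intro coord_eqI expansion_add expansion_coord)

lemma coord_scale: "u \<in> V \<Longrightarrow> crd i (c *\<^sub>R u) = c * crd i u"
  by (intro coord_eqI expansion_scale expansion_coord)

lemma coord_diff: "u \<in> V \<Longrightarrow> v \<in> V \<Longrightarrow> crd i (u - v) = crd i u - crd i v"
  using coord_add[of u "(-1) *\<^sub>R v" i] coord_scale[of v i "-1"] scale_in[of v "-1"] by simp

lemma expansion_finite: "expansion V N z (\<lambda>i. if i < n then a i else 0) (\<Sum>i<n. a i *\<^sub>R z i)"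
proof -
  have "(\<Sum>i<m. (if i < n then a i else 0) *\<^sub>R z i) = (\<Sum>i<n. a i *\<^sub>R z i)" if "m \<ge> n" for m
    using that by (intro sum.mono_neutral_cong_right) auto
  then have "\<forall>\<^sub>F m in sequentially. N ((\<Sum>i<m. (if i < n then a i else 0) *\<^sub>R z i) - (\<Sum>i<n. a i *\<^sub>R z i)) = 0"
    by (auto simp: eventually_sequentially N_zero intro!: exI[of _ n])
  then show ?thesis by (simp add: expansion_def norm_conv_def partial_sum_in tendsto_eventually)
qed

lemma coord_partial_sum: "crd i (\<Sum>j<n. a j *\<^sub>R z j) = (if i < n then a i else 0)"
  using coord_eqI[OF expansion_finite] .

lemma N_z_pos: "N (z j) > 0"
proof -
  have "z j \<noteq> 0"
  proof
    assume "z j = 0"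
    then have "(\<Sum>i<Suc j. (if i = j then 1 else 0) *\<^sub>R z i) = 0"
      by (intro sum.neutral) auto
    moreover have "crd j 0 = 0" using coord_scale[OF zero_in, of j 0] by simp
    ultimately show False using coord_partial_sum[of j "\<lambda>i. if i = j then 1 else 0" "Suc j"] by simp
  qed
  then show ?thesis using nonneg[OF z_in[of j]] eq_zero_iff[OF z_in[of j]] by simp
qed

text \<open>A coordinate is the difference of two consecutive partial sums. The estimate does
  without continuity of the coordinates, which is not yet available here.\<close>

lemma coord_le_projection:
  assumes "\<And>n. N (\<Sum>i<n. crd i v *\<^sub>R z i) \<le> B"
  shows "\<bar>crd i v\<bar> \<le> 2 / N (z i) * B"
proof -
  let ?P = "\<lambda>n. \<Sum>i<n. crd i v *\<^sub>R z i"
  have "N (crd i v *\<^sub>R z i) = N (?P (Suc i) + (-1) *\<^sub>R ?P i)" by simp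
  also have "\<dots> \<le> N (?P (Suc i)) + N ((-1) *\<^sub>R ?P i)"
    by (intro triangle scale_in partial_sum_in)
  also have "N ((-1) *\<^sub>R ?P i) = N (?P i)"
    using scale[OF partial_sum_in, of "-1" "\<lambda>i. crd i v" "{..<i}"] by simp
  finally have "N (crd i v *\<^sub>R z i) \<le> 2 * B" using assms[of "Suc i"] assms[of i] by linarith
  then show ?thesis using N_z_pos[of i] by (simp add: scale z_in field_simps)
qed

text \<open>Zabreiko's lemma for the supremum of the norms of the partial sums; its countable
  subadditivity takes the place of completeness of \<open>V\<close> under the equivalent norm. The
  coordinates of the terms \<open>s i\<close> of a series for \<open>v\<close> are summed to
  \<open>a\<close>, and the point is that \<open>a\<close> expands \<open>v\<close>.\<close>

lemma basis_projection_bounded: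
  obtains K where "K \<ge> 0" "\<And>n v. v \<in> V \<Longrightarrow> N (\<Sum>i<n. crd i v *\<^sub>R z i) \<le> K * N v"
proof -
  define P where "P n v = (\<Sum>i<n. crd i v *\<^sub>R z i)" for n v
  have P_in: "P n v \<in> V" for n v by (simp add: P_def partial_sum_in)
  have P_add: "P n (u + v) = P n u + P n v" if "u \<in> V" "v \<in> V" for n u v
    using that by (simp add: P_def coord_add scaleR_add_left sum.distrib)
  have P_scale: "P n (c *\<^sub>R v) = c *\<^sub>R P n v" if "v \<in> V" for n c v
    using that by (simp add: P_def coord_scale scaleR_sum_right)
  have P_conv: "(\<lambda>n. N (P n v - v)) \<longlonglongrightarrow> 0" if "v \<in> V" for v
    using expansion_coord[OF that] by (simp add: expansion_def norm_conv_def P_def)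
  have bdd: "bdd_above (range (\<lambda>n. N (P n v)))" if v: "v \<in> V" for v
  proof -
    obtain B where B: "\<And>n. \<bar>N (P n v - v)\<bar> \<le> B"
      using convergent_imp_Bseq[of "\<lambda>n. N (P n v - v)"] P_conv[OF v] by (auto simp: convergent_def Bseq_def)
    have "N (P n v) \<le> B + N v" for n
      using N_reverse_triangle[OF P_in v, of n v] B[of n] by linarith
    then show ?thesis by (intro bdd_aboveI2) auto
  qed
  define p where "p v = (SUP n. N (P n v))" for v
  have le: "N (P n v) \<le> p v" if "v \<in> V" for n v
    unfolding p_def using bdd[OF that] by (intro cSUP_upper) auto
  have p_least: "p v \<le> C" if "\<And>n. N (P n v) \<le> C" for v C
    unfolding p_def using that by (intro cSUP_least) auto
  have "\<exists>C. \<forall>v\<in>V. p v \<le> C * N v"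
  proof (rule countably_subadditive_bounded)
    show p_nonneg: "0 \<le> p v" if "v \<in> V" for v
      using order_trans[OF nonneg[OF P_in] le[OF that]] .
    have *: "p (c *\<^sub>R v) \<le> \<bar>c\<bar> * p v" if "v \<in> V" for c v
      using that by (intro p_least) (auto simp: P_scale scale P_in intro!: mult_left_mono le)
    show "p (c *\<^sub>R v) = \<bar>c\<bar> * p v" if v: "v \<in> V" for c v
      by (rule abs_homogeneousI[OF * subspace p_nonneg v])
    show "p (u + v) \<le> p u + p v" if uv: "u \<in> V" "v \<in> V" for u v
    proof (rule p_least)
      show "N (P n (u + v)) \<le> p u + p v" for n
        using triangle[OF P_in P_in, of n u n v] le[OF uv(1), of n] le[OF uv(2), of n] P_add[OF uv] by simp
    qed
    fix s v
    assume sV: "range s \<subseteq> V" and conv: "norm_conv V N (\<lambda>n. \<Sum>i<n. s i) v" and sm: "summable (\<lambda>i. p (s i))"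
    have s_in: "s i \<in> V" for i using sV by auto
    have v: "v \<in> V" using conv by (simp add: norm_conv_def)
    have sm_crd: "summable (\<lambda>i. crd j (s i))" for j
    proof (rule summable_comparison_test'[of "\<lambda>i. 2 / N (z j) * p (s i)" 0])
      show "norm (crd j (s i)) \<le> 2 / N (z j) * p (s i)" for i
        using coord_le_projection[of "s i" "p (s i)" j] le[OF s_in] by (simp add: P_def)
    qed (use sm in \<open>rule summable_mult\<close>)
    define a where "a j = (\<Sum>i. crd j (s i))" for j
    define w where "w n = (\<Sum>j<n. a j *\<^sub>R z j)" for n
    have w_in: "w n \<in> V" for n by (simp add: w_def partial_sum_in)
    \<comment> \<open>This bound on the tail of the series does not depend on \<open>n\<close>; the
      uniformity permits the exchange of the two limits below.\<close>
    define R where "R m = (\<Sum>i. p (s (i + m)))" for m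
    have R: "R \<longlonglongrightarrow> 0"
      unfolding R_def by (rule suminf_exist_split2[OF sm])
    have partP: "(\<Sum>i<m. P n (s i)) = (\<Sum>j<n. (\<Sum>i<m. crd j (s i)) *\<^sub>R z j)" for m n
      unfolding P_def by (subst sum.swap) (simp add: scaleR_sum_left)
    have conv_w: "(\<lambda>m. N ((\<Sum>i<m. P n (s i)) - w n)) \<longlonglongrightarrow> 0" for n
    proof (rule tendsto_sandwich[of "\<lambda>_. 0"])
      have "(\<lambda>m. \<Sum>j<n. \<bar>(\<Sum>i<m. crd j (s i)) - a j\<bar> * N (z j)) \<longlonglongrightarrow> (\<Sum>j<n. \<bar>a j - a j\<bar> * N (z j))"
        unfolding a_def by (intro tendsto_intros summable_LIMSEQ sm_crd)
      then show "(\<lambda>m. \<Sum>j<n. \<bar>(\<Sum>i<m. crd j (s i)) - a j\<bar> * N (z j)) \<longlonglongrightarrow> 0" by simp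
      show "\<forall>\<^sub>F m in sequentially. N ((\<Sum>i<m. P n (s i)) - w n) \<le> (\<Sum>j<n. \<bar>(\<Sum>i<m. crd j (s i)) - a j\<bar> * N (z j))"
      proof (intro always_eventually allI)
        fix m
        have "(\<Sum>i<m. P n (s i)) - w n = (\<Sum>j<n. ((\<Sum>i<m. crd j (s i)) - a j) *\<^sub>R z j)"
          by (simp add: partP w_def scaleR_diff_left sum_subtractf)
        then show "N ((\<Sum>i<m. P n (s i)) - w n) \<le> (\<Sum>j<n. \<bar>(\<Sum>i<m. crd j (s i)) - a j\<bar> * N (z j))"
          using N_sum[of "{..<n}" "\<lambda>j. ((\<Sum>i<m. crd j (s i)) - a j) *\<^sub>R z j"] z_in scale_in by (simp add: scale)
      qed
      show "\<forall>\<^sub>F m in sequentially. 0 \<le> N ((\<Sum>i<m. P n (s i)) - w n)"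
        by (intro always_eventually allI nonneg diff_in sum_in P_in w_in)
    qed auto
    have tail: "N ((\<Sum>i<m. P n (s i)) - w n) \<le> R m" for m n
    proof -
      have in1: "(\<Sum>i<m. P n (s i)) \<in> V" for m by (intro sum_in P_in)
      have step: "N ((\<Sum>i<m. P n (s i)) - w n) \<le> R m + N ((\<Sum>i<l. P n (s i)) - w n)" if l: "l \<ge> m" for l
      proof -
        have "(\<Sum>i<l. P n (s i)) = (\<Sum>i<m. P n (s i)) + (\<Sum>i=m..<l. P n (s i))"
          using sum.atLeastLessThan_concat[of 0 m l "\<lambda>i. P n (s i)"] l by (simp add: atLeast0LessThan)
        then have "N ((\<Sum>i<m. P n (s i)) - (\<Sum>i<l. P n (s i))) = N (\<Sum>i=m..<l. P n (s i))"
          using N_minus[OF sum_in[where s = "\<lambda>i. P n (s i)" and I = "{m..<l}", OF P_in]] by simp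
        also have "\<dots> \<le> (\<Sum>i=m..<l. N (P n (s i)))" by (intro N_sum P_in)
        also have "\<dots> \<le> (\<Sum>i=m..<l. p (s i))" by (intro sum_mono le s_in)
        also have "\<dots> = (\<Sum>i<l-m. p (s (i + m)))"
          using sum.shift_bounds_nat_ivl[of "\<lambda>i. p (s i)" 0 m "l - m"] l by (simp add: atLeast0LessThan)
        also have "\<dots> \<le> R m"
          unfolding R_def
        proof (rule sum_le_suminf)
          show "summable (\<lambda>i. p (s (i + m)))" by (subst summable_iff_shift) (rule sm)
        qed (use p_nonneg[OF s_in] in auto)
        finally show ?thesis
          using N_diff_triangle[OF in1[of m] in1[of l] w_in[of n]] by simp
      qed
      show ?thesis
      proof (rule LIMSEQ_le_const)
        show "(\<lambda>l. R m + N ((\<Sum>i<l. P n (s i)) - w n)) \<longlonglongrightarrow> R m"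
          using tendsto_add[OF tendsto_const conv_w, of "R m" n] by simp
        show "\<exists>l0. \<forall>l\<ge>l0. N ((\<Sum>i<m. P n (s i)) - w n) \<le> R m + N ((\<Sum>i<l. P n (s i)) - w n)"
          using step by blast
      qed
    qed
    have "(\<lambda>n. N (w n - v)) \<longlonglongrightarrow> 0"
    proof (rule LIMSEQ_I)
      fix e :: real assume e: "e > 0"
      have "\<forall>\<^sub>F m in sequentially. R m < e/3" using R e by (intro order_tendstoD(2)[of R 0]) auto
      moreover have "\<forall>\<^sub>F m in sequentially. N ((\<Sum>i<m. s i) - v) < e/3"
        using conv e by (intro order_tendstoD(2)[of _ 0]) (auto simp: norm_conv_def)
      ultimately have "\<forall>\<^sub>F m in sequentially. R m < e/3 \<and> N ((\<Sum>i<m. s i) - v) < e/3" by (rule eventually_conj)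
      \<comment> \<open>\<open>m\<close> is fixed before \<open>n\<close>: the finite sum
        \<open>u\<close> is close to \<open>v\<close> and its own expansion converges, so three
        errors of at most \<open>e/3\<close> remain.\<close>
      then obtain m where m1: "R m < e/3" and m2: "N ((\<Sum>i<m. s i) - v) < e/3"
        by (auto simp: eventually_sequentially)
      define u where "u = (\<Sum>i<m. s i)"
      have u: "u \<in> V" unfolding u_def by (intro sum_in s_in)
      have Pu: "P n u = (\<Sum>i<m. P n (s i))" for n
        unfolding u_def
      proof (induction m)
        case 0
        then show ?case using P_scale[OF zero_in, of n 0] by simp
      next
        case (Suc m)
        then show ?case using P_add[OF sum_in[where s = s and I = "{..<m}"] s_in[of m], of n] s_in by simp
      qed
      have "\<forall>\<^sub>F n in sequentially. N (P n u - u) < e/3"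
        using P_conv[OF u] e by (intro order_tendstoD(2)[of _ 0]) auto
      then obtain n0 where n0: "\<And>n. n \<ge> n0 \<Longrightarrow> N (P n u - u) < e/3" by (auto simp: eventually_sequentially)
      have "norm (N (w n - v) - 0) < e" if n: "n \<ge> n0" for n
      proof -
        have "N (w n - v) \<le> N (w n - P n u) + (N (P n u - u) + N (u - v))"
          using N_diff_triangle[OF w_in[of n] P_in[of n u] v] N_diff_triangle[OF P_in[of n u] u v] by simp
        moreover have "N (w n - P n u) \<le> R m"
          using tail[where m = m and n = n] N_diff_commute[OF w_in[of n] P_in[of n u]] by (simp add: Pu)
        ultimately show ?thesis
          using n0[OF n] m1 m2 nonneg[OF diff_in[OF w_in v], of n] by (simp add: u_def)
      qed
      then show "\<exists>no. \<forall>n\<ge>no. norm (N (w n - v) - 0) < e" by blast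
    qed
    then have "expansion V N z a v" using v by (simp add: expansion_def norm_conv_def w_def)
    \<comment> \<open>Uniqueness of the expansion identifies the termwise sums with the coordinates
      of \<open>v\<close>.\<close>
    then have "P n v = w n" for n by (simp add: P_def w_def coord_eqI)
    moreover have "N (w n) \<le> (\<Sum>i. p (s i))" for n
      using tail[where m = 0 and n = n] N_minus[OF w_in] by (simp add: R_def)
    ultimately show "p v \<le> (\<Sum>i. p (s i))" by (intro p_least) simp
  qed
  then obtain C where C: "\<And>v. v \<in> V \<Longrightarrow> p v \<le> C * N v" by blast
  show thesis
  proof
    show "N (\<Sum>i<n. crd i v *\<^sub>R z i) \<le> max C 0 * N v" if v: "v \<in> V" for n v
      using le[OF v, of n] C[OF v] mult_right_mono[of C "max C 0" "N v"] nonneg[OF v] by (simp add: P_def)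
  qed simp
qed

lemma coord_in_dual_space: "(\<lambda>v. if v \<in> V then crd i v else 0) \<in> dual_space V N"
proof -
  obtain K where K: "K \<ge> 0" "\<And>n v. v \<in> V \<Longrightarrow> N (\<Sum>i<n. crd i v *\<^sub>R z i) \<le> K * N v"
    using basis_projection_bounded by blast
  show ?thesis
  proof (rule dual_spaceI[where C = "2 / N (z i) * K"])
    show "\<bar>if v \<in> V then crd i v else 0\<bar> \<le> 2 / N (z i) * K * N v" if v: "v \<in> V" for v
      using coord_le_projection[OF K(2)[OF v], of i] v by simp
  qed (auto simp: coord_add coord_scale add_in scale_in)
qed

end

subsection \<open>Frames with an associated space\<close>

lemma norm_blinfun_approx:
  fixes w :: "'a::real_normed_vector \<Rightarrow>\<^sub>L real"
  assumes "c < norm w"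
  obtains u where "norm u \<le> 1" "c \<le> blinfun_apply w u"
proof (cases "c \<le> 0")
  case True
  then show thesis using that[of 0] by (simp add: blinfun.zero_right)
next
  case False
  have "\<exists>u. \<not> norm (blinfun_apply w u) \<le> c * norm u"
    using norm_blinfun_bound[of c w] False assms by fastforce
  then obtain u where "\<not> norm (blinfun_apply w u) \<le> c * norm u" by blast
  then have u: "\<bar>blinfun_apply w u\<bar> > c * norm u" by simp
  then have u0: "u \<noteq> 0" by auto
  define d where "d = sgn (blinfun_apply w u) / norm u"
  have "blinfun_apply w (d *\<^sub>R u) = \<bar>blinfun_apply w u\<bar> / norm u"
    by (simp add: blinfun.scaleR_right d_def abs_sgn mult.commute)
  then have "c \<le> blinfun_apply w (d *\<^sub>R u)" using u u0 by (simp add: pos_le_divide_eq)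
  moreover have "norm (d *\<^sub>R u) \<le> 1" using u0 by (simp add: d_def abs_sgn_eq)
  ultimately show thesis using that by blast
qed

lemma frame_tail_eq:
  assumes "Schauder_frame x f"
  shows "frame_tail x f n u = u - (\<Sum>i<n. blinfun_apply (f i) u *\<^sub>R x i)"
proof -
  have u: "(\<lambda>i. blinfun_apply (f i) u *\<^sub>R x i) sums u" using assms by (simp add: Schauder_frame_def)
  show ?thesis
    unfolding frame_tail_def
    using suminf_minus_initial_segment[OF sums_summable[OF u], of n] sums_unique[OF u] by simp
qed

lemma functional_frame_tail:
  fixes g :: "'a::banach \<Rightarrow>\<^sub>L real"
  assumes "Schauder_frame x f"
  shows "blinfun_apply g (frame_tail x f n u) = blinfun_apply (g - (\<Sum>i<n. blinfun_apply g (x i) *\<^sub>R f i)) u"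
  by (simp add: frame_tail_eq[OF assms] blinfun.diff_right blinfun.diff_left blinfun.sum_right blinfun.sum_left
      blinfun.scaleR_right blinfun.scaleR_left mult.commute)

text \<open>The composition of \<open>g\<close> with a frame tail is \<open>g\<close> minus a
  partial sum of the dual series. Thus shrinking means that the system with the roles of
  \<open>x i\<close> and \<open>f i\<close> exchanged reconstructs the dual space.\<close>

lemma shrinking_frame_iff:
  fixes x :: "nat \<Rightarrow> 'a::banach"
  assumes "Schauder_frame x f"
  shows "shrinking_frame x f \<longleftrightarrow> (\<forall>g :: 'a \<Rightarrow>\<^sub>L real. (\<lambda>i. blinfun_apply g (x i) *\<^sub>R f i) sums g)"
proof -
  have *: "onorm (blinfun_apply g \<circ> frame_tail x f n) = norm ((\<Sum>i<n. blinfun_apply g (x i) *\<^sub>R f i) - g)" for g :: "'a \<Rightarrow>\<^sub>L real" and n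
  proof -
    have "blinfun_apply g \<circ> frame_tail x f n = blinfun_apply (g - (\<Sum>i<n. blinfun_apply g (x i) *\<^sub>R f i))"
      by (simp add: fun_eq_iff functional_frame_tail[OF assms])
    then show ?thesis by (simp add: norm_blinfun.rep_eq[symmetric] norm_minus_commute)
  qed
  show ?thesis
    unfolding shrinking_frame_def * sums_def
    by (simp add: tendsto_norm_zero_iff LIM_zero_iff)
qed

locale associated_space = banach_basis V N z for V :: "'v::real_vector set" and N z +
  fixes x :: "nat \<Rightarrow> 'a::banach" and f :: "nat \<Rightarrow> 'a \<Rightarrow>\<^sub>L real" and T :: "'a \<Rightarrow> 'v" and S :: "'v \<Rightarrow> 'a"
    and C D :: real
  assumes frame: "Schauder_frame x f"
    and T_expansion: "expansion V N z (\<lambda>i. blinfun_apply (f i) u) (T u)"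
    and T_bounded: "N (T u) \<le> C * norm u"
    and S_sums: "v \<in> V \<Longrightarrow> (\<lambda>i. coord V N z i v *\<^sub>R x i) sums S v"
    and S_bounded: "v \<in> V \<Longrightarrow> norm (S v) \<le> D * N v"
begin

lemma T_in: "T u \<in> V"
  using T_expansion expansion_in by blast

lemma coord_T: "crd i (T u) = blinfun_apply (f i) u"
  using T_expansion by (rule coord_eqI)

lemma expansion_unique: "expansion V N z a u \<Longrightarrow> expansion V N z a v \<Longrightarrow> u = v"
  unfolding expansion_def by (rule norm_conv_unique) (auto intro: partial_sum_in)

lemma T_add: "T (u + v) = T u + T v"
  using T_expansion[of "u + v"] expansion_add[OF T_expansion T_expansion, of u v]
  by (intro expansion_unique) (auto simp: blinfun.add_right)

lemma T_scale: "T (c *\<^sub>R u) = c *\<^sub>R T u"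
  using T_expansion[of "c *\<^sub>R u"] expansion_scale[OF T_expansion, of c u]
  by (intro expansion_unique) (auto simp: blinfun.scaleR_right)

lemma S_add: "u \<in> V \<Longrightarrow> v \<in> V \<Longrightarrow> S (u + v) = S u + S v"
  using sums_add[OF S_sums S_sums, of u v] S_sums[of "u + v"]
  by (intro sums_unique2[of _ "S (u + v)"]) (auto simp: coord_add scaleR_add_left add_in)

lemma S_scale: "v \<in> V \<Longrightarrow> S (c *\<^sub>R v) = c *\<^sub>R S v"
  using sums_scaleR_right[OF S_sums, of v c] S_sums[of "c *\<^sub>R v"]
  by (intro sums_unique2[of _ "S (c *\<^sub>R v)"]) (auto simp: coord_scale scale_in)

text \<open>The tail of the expansion of \<open>T u\<close> in \<open>V\<close>. It differs in
  general from \<open>T\<close> applied to the frame tail, because \<open>T (x i)\<close> need not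
  be \<open>z i\<close>; only after applying \<open>S\<close> do the tails agree.\<close>

definition T_tail :: "nat \<Rightarrow> 'a \<Rightarrow> 'v" where
  "T_tail n u = T u - (\<Sum>i<n. blinfun_apply (f i) u *\<^sub>R z i)"

lemma T_tail_in: "T_tail n u \<in> V"
  unfolding T_tail_def by (intro diff_in T_in partial_sum_in)

lemma coord_T_tail: "crd i (T_tail n u) = (if i < n then 0 else blinfun_apply (f i) u)"
  by (simp add: T_tail_def coord_diff T_in partial_sum_in coord_T coord_partial_sum)

lemma S_T_tail: "S (T_tail n u) = frame_tail x f n u"
proof -
  have "(\<lambda>i. crd i (T_tail n u) *\<^sub>R x i) = (\<lambda>i. (if i < n then 0 else blinfun_apply (f i) u) *\<^sub>R x i)"
    by (simp add: coord_T_tail)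
  then have 1: "(\<lambda>i. (if i < n then 0 else blinfun_apply (f i) u) *\<^sub>R x i) sums S (T_tail n u)"
    using S_sums[OF T_tail_in, of n u] by simp
  have "(\<lambda>i. if i < n then blinfun_apply (f i) u *\<^sub>R x i else 0) sums (\<Sum>i<n. blinfun_apply (f i) u *\<^sub>R x i)"
    using sums_If_finite[of "\<lambda>i. i < n"] by (simp add: lessThan_def)
  note sums_add[OF this 1]
  moreover have "(\<lambda>i. (if i < n then blinfun_apply (f i) u *\<^sub>R x i else 0) +
      (if i < n then 0 else blinfun_apply (f i) u) *\<^sub>R x i) = (\<lambda>i. blinfun_apply (f i) u *\<^sub>R x i)"
    by auto
  ultimately have "(\<lambda>i. blinfun_apply (f i) u *\<^sub>R x i) sums ((\<Sum>i<n. blinfun_apply (f i) u *\<^sub>R x i) + S (T_tail n u))"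
    by simp
  then have "(\<Sum>i<n. blinfun_apply (f i) u *\<^sub>R x i) + S (T_tail n u) = u"
    using frame by (intro sums_unique2) (auto simp: Schauder_frame_def)
  then show ?thesis
    by (simp add: frame_tail_eq[OF frame] algebra_simps)
qed

text \<open>For each \<open>u\<close> the tails tend to 0, so uniform boundedness over the given
  space yields one constant.\<close>

lemma T_tail_bounded:
  obtains K where "K \<ge> 0" "\<And>n u. N (T_tail n u) \<le> K * norm u"
proof (rule uniform_boundedness[of "\<lambda>n u. N (T_tail n u)"])
  show "N (T_tail n (c *\<^sub>R u)) = \<bar>c\<bar> * N (T_tail n u)" for n c u
  proof -
    have "T_tail n (c *\<^sub>R u) = c *\<^sub>R T_tail n u"
      by (simp add: T_tail_def T_scale blinfun.scaleR_right scaleR_diff_right scaleR_sum_right)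
    then show ?thesis by (simp add: scale T_tail_in)
  qed
  show "N (T_tail n (u + v)) \<le> N (T_tail n u) + N (T_tail n v)" for n u v
  proof -
    have "T_tail n (u + v) = T_tail n u + T_tail n v"
      by (simp add: T_tail_def T_add blinfun.add_right scaleR_add_left sum.distrib)
    then show ?thesis using triangle[OF T_tail_in T_tail_in] by metis
  qed
  show "N (T_tail n u) \<le> (C + (\<Sum>i<n. norm (f i) * N (z i))) * norm u" for n u
  proof -
    have "N (T_tail n u) \<le> N (T u) + N (\<Sum>i<n. blinfun_apply (f i) u *\<^sub>R z i)"
      using triangle[OF T_in scale_in[OF partial_sum_in], of u "-1" "\<lambda>i. blinfun_apply (f i) u" "{..<n}"]
        N_minus[OF partial_sum_in, of "\<lambda>i. blinfun_apply (f i) u" "{..<n}"]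
      by (simp add: T_tail_def)
    also have "N (\<Sum>i<n. blinfun_apply (f i) u *\<^sub>R z i) \<le> (\<Sum>i<n. N (blinfun_apply (f i) u *\<^sub>R z i))"
      by (intro N_sum scale_in z_in)
    also have "\<dots> \<le> (\<Sum>i<n. norm (f i) * norm u * N (z i))"
    proof (rule sum_mono)
      fix i
      have "\<bar>blinfun_apply (f i) u\<bar> \<le> norm (f i) * norm u" using norm_blinfun[of "f i" u] by simp
      then show "N (blinfun_apply (f i) u *\<^sub>R z i) \<le> norm (f i) * norm u * N (z i)"
        by (simp add: scale z_in mult_right_mono nonneg)
    qed
    finally show ?thesis
      using T_bounded[of u] by (simp add: distrib_right sum_distrib_right mult.assoc mult.commute[of "norm u"])
  qed
  show "bdd_above (range (\<lambda>n. N (T_tail n u)))" for u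
  proof -
    have "N (T_tail n u) = N ((\<Sum>i<n. blinfun_apply (f i) u *\<^sub>R z i) - T u)" for n
      unfolding T_tail_def by (intro N_diff_commute T_in partial_sum_in)
    then have "(\<lambda>n. N (T_tail n u)) \<longlonglongrightarrow> 0"
      using T_expansion[of u] by (simp add: expansion_def norm_conv_def)
    then have "Bseq (\<lambda>n. N (T_tail n u))" by (intro convergent_imp_Bseq) (auto simp: convergent_def)
    then obtain B where B: "\<forall>n. norm (N (T_tail n u)) \<le> B" unfolding Bseq_def by blast
    have "N (T_tail n u) \<le> B" for n using spec[OF B, of n] by simp
    then show ?thesis by (rule bdd_aboveI2)
  qed
qed (rule that)

section \<open>From the associated space back to the frame\<close>

definition pull :: "('a \<Rightarrow>\<^sub>L real) \<Rightarrow> 'v \<Rightarrow> real" where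
  "pull g v = (if v \<in> V then blinfun_apply g (S v) else 0)"

lemma pull_in: "pull g \<in> dual_space V N"
proof (rule dual_spaceI[where C = "norm g * D"])
  show "\<bar>pull g v\<bar> \<le> norm g * D * N v" if "v \<in> V" for v
    using norm_blinfun[of g "S v"] mult_left_mono[OF S_bounded[OF that], of "norm g"] that by (simp add: pull_def)
qed (simp_all add: pull_def S_add S_scale add_in scale_in blinfun.add_right blinfun.scaleR_right)

text \<open>The value of \<open>g\<close> at the frame tail of \<open>u\<close> is the value of
  \<open>pull g\<close> at \<open>T_tail n u\<close>. This vector lies in the closed span of the
  basis from \<open>n\<close> on and has norm at most \<open>K * norm u\<close>, so the norm in
  question is at most \<open>K\<close> times one that tends to 0 by assumption.\<close>

lemma shrinking_basis_imp_shrinking_frame: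
  assumes shr: "shrinking_basis V N z"
  shows "shrinking_frame x f"
  unfolding shrinking_frame_iff[OF frame]
proof
  fix g :: "'a \<Rightarrow>\<^sub>L real"
  obtain K where K: "K \<ge> 0" "\<And>n u. N (T_tail n u) \<le> K * norm u" using T_tail_bounded by blast
  define W where "W n = closed_span V N (z ` {n..})" for n
  have WV: "W n \<subseteq> V" for n by (auto simp: W_def closed_span_def)
  have tail_W: "T_tail n u \<in> W n" for n u
    unfolding W_def closed_span_def
  proof (intro CollectI conjI allI impI T_tail_in)
    fix e :: real assume "e > 0"
    then have "\<forall>\<^sub>F m in sequentially. N ((\<Sum>i<m. blinfun_apply (f i) u *\<^sub>R z i) - T u) < e"
      using T_expansion[of u] by (intro order_tendstoD(2)[of _ 0]) (auto simp: expansion_def norm_conv_def)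
    then obtain m where m: "m \<ge> n" "N ((\<Sum>i<m. blinfun_apply (f i) u *\<^sub>R z i) - T u) < e"
      by (metis (no_types, lifting) eventually_sequentially nle_le)
    let ?w = "\<Sum>i=n..<m. blinfun_apply (f i) u *\<^sub>R z i"
    have "?w \<in> span (z ` {n..})" by (intro span_sum span_scale span_base) auto
    moreover have "T_tail n u - ?w = T u - (\<Sum>i<m. blinfun_apply (f i) u *\<^sub>R z i)"
      using sum.atLeastLessThan_concat[of 0 n m "\<lambda>i. blinfun_apply (f i) u *\<^sub>R z i"] m(1)
      by (simp add: T_tail_def atLeast0LessThan algebra_simps)
    then have "N (T_tail n u - ?w) < e"
      using m(2) N_diff_commute[OF T_in partial_sum_in] by simp
    ultimately show "\<exists>w\<in>span (z ` {n..}). N (T_tail n u - w) < e" by blast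
  qed
  have T_tail_scale: "c *\<^sub>R T_tail n u = T_tail n (c *\<^sub>R u)" for c n u
    by (simp add: T_tail_def T_scale blinfun.scaleR_right scaleR_diff_right scaleR_sum_right)
  have le: "norm ((\<Sum>i<n. blinfun_apply g (x i) *\<^sub>R f i) - g) \<le> dual_norm (W n) N (pull g) * K" for n
  proof -
    have dn: "dual_norm (W n) N (pull g) \<ge> 0"
      using tail_W[of n 0] T_tail_scale[of 0 n 0] by (intro dual_norm_nonneg pull_in WV) simp
    have "norm (g - (\<Sum>i<n. blinfun_apply g (x i) *\<^sub>R f i)) \<le> dual_norm (W n) N (pull g) * K"
    proof (rule norm_blinfun_bound)
      fix u
      have "\<bar>pull g (T_tail n u)\<bar> \<le> dual_norm (W n) N (pull g) * N (T_tail n u)"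
        by (intro dual_norm_apply pull_in WV) (simp add: T_tail_scale tail_W)
      also have "\<dots> \<le> dual_norm (W n) N (pull g) * (K * norm u)" by (intro mult_left_mono K dn)
      finally show "norm (blinfun_apply (g - (\<Sum>i<n. blinfun_apply g (x i) *\<^sub>R f i)) u) \<le> dual_norm (W n) N (pull g) * K * norm u"
        unfolding functional_frame_tail[OF frame, symmetric] by (simp add: pull_def T_tail_in S_T_tail)
    qed (use dn K in simp)
    then show ?thesis by (simp add: norm_minus_commute)
  qed
  have lim: "(\<lambda>n. dual_norm (W n) N (pull g) * K) \<longlonglongrightarrow> 0"
    using shr pull_in by (intro tendsto_mult_left_zero) (auto simp: shrinking_basis_def W_def)
  have "(\<lambda>n. (\<Sum>i<n. blinfun_apply g (x i) *\<^sub>R f i) - g) \<longlonglongrightarrow> 0"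
    by (rule Lim_null_comparison[OF always_eventually lim]) (rule allI, rule le)
  then show "(\<lambda>i. blinfun_apply g (x i) *\<^sub>R f i) sums g"
    unfolding sums_def by (rule LIM_zero_cancel)
qed

lemma reflexive_representation:
  assumes refl: "reflexive_space V N" and \<Phi>: "\<Phi> \<in> bidual_space V N"
  obtains w where "w \<in> V" "\<And>h. h \<in> dual_space V N \<Longrightarrow> \<Phi> h = h w"
proof -
  obtain w where "w \<in> V" "\<Phi> = canonical_embedding V N w"
    using assms by (auto simp: reflexive_space_def)
  then show thesis using that by (simp add: canonical_embedding_def)
qed

text \<open>The second adjoint of \<open>T\<close> sends \<open>\<phi>\<close> to an element of the
  bidual of \<open>V\<close>. The vector \<open>w\<close> representing it has coordinates
  \<open>\<phi> (f i)\<close>, and the series in question is the one for \<open>S w\<close>.\<close>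

lemma reflexive_imp_boundedly_complete:
  assumes refl: "reflexive_space V N"
  shows "boundedly_complete_frame x f"
  unfolding boundedly_complete_frame_def
proof
  fix \<phi> :: "('a \<Rightarrow>\<^sub>L real) \<Rightarrow>\<^sub>L real"
  have bl: "bounded_linear (\<lambda>u. h (T u))" and bd: "norm (h (T u)) \<le> dual_norm V N h * \<bar>C\<bar> * norm u"
    if h: "h \<in> dual_space V N" for h and u :: 'a
  proof -
    show *: "norm (h (T u)) \<le> dual_norm V N h * \<bar>C\<bar> * norm u" for u
    proof -
      have "\<bar>h (T u)\<bar> \<le> dual_norm V N h * N (T u)" by (rule dual_norm_bound[OF h T_in])
      also have "\<dots> \<le> dual_norm V N h * (\<bar>C\<bar> * norm u)"
        using order_trans[OF T_bounded[of u] mult_right_mono[of C "\<bar>C\<bar>" "norm u"]] zero_in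
        by (intro mult_left_mono dual_norm_nonneg h) auto
      finally show ?thesis by (simp add: mult.assoc)
    qed
    show "bounded_linear (\<lambda>u. h (T u))"
      using h T_in * by (intro bounded_linear_intro[where K = "dual_norm V N h * \<bar>C\<bar>"])
        (auto simp: T_add T_scale dual_space_def mult.commute)
  qed
  \<comment> \<open>\<open>Blinfun (\<lambda>u. h (T u))\<close> is the adjoint of \<open>T\<close>
    at \<open>h\<close>; the value 0 elsewhere follows the convention of
    \<open>dual_space\<close>.\<close>
  define \<Phi> where "\<Phi> h = (if h \<in> dual_space V N then blinfun_apply \<phi> (Blinfun (\<lambda>u. h (T u))) else 0)" for h
  have "\<Phi> \<in> bidual_space V N"
    unfolding bidual_space_def
  proof (rule dual_spaceI[where C = "norm \<phi> * \<bar>C\<bar>"])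
    fix h k assume hk: "h \<in> dual_space V N" "k \<in> dual_space V N"
    have "Blinfun (\<lambda>u. (h + k) (T u)) = Blinfun (\<lambda>u. h (T u)) + Blinfun (\<lambda>u. k (T u))"
      using bl[OF hk(1)] bl[OF hk(2)] bl[OF dual_space_add[OF hk]]
      by (intro blinfun_eqI) (simp add: bounded_linear_Blinfun_apply blinfun.add_left plus_fun_def)
    then show "\<Phi> (h + k) = \<Phi> h + \<Phi> k"
      using hk dual_space_add by (simp add: \<Phi>_def blinfun.add_right)
  next
    fix c h assume h: "h \<in> dual_space V N"
    have "Blinfun (\<lambda>u. (c *\<^sub>R h) (T u)) = c *\<^sub>R Blinfun (\<lambda>u. h (T u))"
      using bl[OF h] bl[OF dual_space_scale[OF h]]
      by (intro blinfun_eqI) (simp add: bounded_linear_Blinfun_apply blinfun.scaleR_left scaleR_fun_def)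
    then show "\<Phi> (c *\<^sub>R h) = c * \<Phi> h"
      using h dual_space_scale by (simp add: \<Phi>_def blinfun.scaleR_right)
  next
    fix h assume h: "h \<in> dual_space V N"
    have "norm (Blinfun (\<lambda>u. h (T u))) \<le> dual_norm V N h * \<bar>C\<bar>"
      using bd[OF h] dual_norm_nonneg[OF h subset_refl zero_in]
      by (intro norm_blinfun_bound) (auto simp: bounded_linear_Blinfun_apply[OF bl[OF h]])
    then have "norm \<phi> * norm (Blinfun (\<lambda>u. h (T u))) \<le> norm \<phi> * (dual_norm V N h * \<bar>C\<bar>)"
      by (intro mult_left_mono) auto
    then show "\<bar>\<Phi> h\<bar> \<le> norm \<phi> * \<bar>C\<bar> * dual_norm V N h"
      using norm_blinfun[of \<phi> "Blinfun (\<lambda>u. h (T u))"] h by (simp add: \<Phi>_def mult.commute mult.left_commute)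
  qed (simp add: \<Phi>_def)
  then obtain w where w: "w \<in> V" "\<And>h. h \<in> dual_space V N \<Longrightarrow> \<Phi> h = h w"
    using reflexive_representation[OF refl] by blast
  have "crd i w = blinfun_apply \<phi> (f i)" for i
  proof -
    let ?h = "\<lambda>v. if v \<in> V then crd i v else 0"
    have "crd i w = \<Phi> ?h" using w coord_in_dual_space by simp
    also have "(\<lambda>u. ?h (T u)) = blinfun_apply (f i)" by (simp add: T_in coord_T)
    then have "\<Phi> ?h = blinfun_apply \<phi> (f i)"
      by (simp add: \<Phi>_def coord_in_dual_space blinfun_apply_inverse)
    finally show ?thesis .
  qed
  then show "summable (\<lambda>i. blinfun_apply \<phi> (f i) *\<^sub>R x i)"
    using sums_summable[OF S_sums[OF w(1)]] by simp
qed

text \<open>If the dual series of some \<open>g\<close> failed to converge to \<open>g\<close>,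
  there would be bounded vectors with later and later support on which \<open>pull g\<close> is at
  least \<open>e/2\<close>. At the vector that represents their generalised limit \<open>S\<close>,
  and hence \<open>pull g\<close>, vanishes, although the generalised limit of the values of
  \<open>pull g\<close> is at least \<open>e/2\<close>.\<close>

lemma reflexive_imp_shrinking_frame:
  assumes refl: "reflexive_space V N"
  shows "shrinking_frame x f"
  unfolding shrinking_frame_iff[OF frame]
proof (rule allI, rule ccontr)
  fix g :: "'a \<Rightarrow>\<^sub>L real"
  define G where "G n = g - (\<Sum>i<n. blinfun_apply g (x i) *\<^sub>R f i)" for n
  assume "\<not> (\<lambda>i. blinfun_apply g (x i) *\<^sub>R f i) sums g"
  then obtain e where e: "e > 0" and "\<And>M. \<exists>n\<ge>M. \<not> norm ((\<Sum>i<n. blinfun_apply g (x i) *\<^sub>R f i) - g) < e"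
    unfolding sums_def LIMSEQ_iff by blast
  then have big: "\<exists>n\<ge>M. e \<le> norm (G n)" for M
    by (metis G_def norm_minus_commute not_less)
  have "\<exists>n u. n \<ge> M \<and> norm u \<le> 1 \<and> e/2 \<le> blinfun_apply (G n) u" for M
  proof -
    obtain n where n: "n \<ge> M" "e \<le> norm (G n)" using big by blast
    then have "e/2 < norm (G n)" using e by simp
    then show ?thesis using n(1) norm_blinfun_approx by metis
  qed
  then obtain n u where n: "\<And>M. n M \<ge> M" and u: "\<And>M. norm (u M) \<le> 1" and Gu: "\<And>M. e/2 \<le> blinfun_apply (G (n M)) (u M)"
    by metis
  obtain K where K: "K \<ge> 0" "\<And>n u. N (T_tail n u) \<le> K * norm u" using T_tail_bounded by blast
  define y where "y j = T_tail (n j) (u j)" for j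
  have y_in: "y j \<in> V" for j by (simp add: y_def T_tail_in)
  have Ny: "N (y j) \<le> K" for j
    using K(2)[of "n j" "u j"] mult_left_mono[OF u[of j] K(1)] by (simp add: y_def)
  obtain L :: "(nat \<Rightarrow> real) \<Rightarrow> real" where L: "linear L"
    "\<And>s c. (\<And>k. s k \<le> c) \<Longrightarrow> bdd_below (range s) \<Longrightarrow> L s \<le> c"
    "\<And>s c K. (\<And>k. k \<ge> K \<Longrightarrow> s k = c) \<Longrightarrow> L s = c" using generalised_limit by blast
  have hy: "\<bar>h (y j)\<bar> \<le> dual_norm V N h * K" if h: "h \<in> dual_space V N" for h j
    using dual_norm_bound[OF h y_in] mult_left_mono[OF Ny dual_norm_nonneg[OF h subset_refl zero_in]] order_trans by blast
  have Lb: "L s \<le> B" if "\<And>j. \<bar>s j\<bar> \<le> B" for s B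
    using that by (intro L(2) bdd_belowI2[where m = "-B"]) (auto simp: abs_le_iff minus_le_iff)
  define \<Phi> where "\<Phi> h = (if h \<in> dual_space V N then L (\<lambda>j. h (y j)) else 0)" for h
  have "\<Phi> \<in> bidual_space V N"
    unfolding bidual_space_def
  proof (rule dual_spaceI[where C = K])
    fix h k assume hk: "h \<in> dual_space V N" "k \<in> dual_space V N"
    show "\<Phi> (h + k) = \<Phi> h + \<Phi> k"
      using linear_add[OF L(1), of "\<lambda>j. h (y j)" "\<lambda>j. k (y j)"] hk dual_space_add
      by (simp add: \<Phi>_def plus_fun_def)
  next
    fix c h assume h: "h \<in> dual_space V N"
    show "\<Phi> (c *\<^sub>R h) = c * \<Phi> h"
      using linear_scale[OF L(1), of c "\<lambda>j. h (y j)"] h dual_space_scale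
      by (simp add: \<Phi>_def scaleR_fun_def)
  next
    fix h assume h: "h \<in> dual_space V N"
    have "L (\<lambda>j. h (y j)) \<le> dual_norm V N h * K" by (rule Lb[OF hy[OF h]])
    moreover have "L (- (\<lambda>j. h (y j))) \<le> dual_norm V N h * K"
      using hy[OF h] by (intro Lb) (simp add: fun_Compl_def)
    ultimately show "\<bar>\<Phi> h\<bar> \<le> K * dual_norm V N h"
      using h linear_neg[OF L(1)] by (simp add: \<Phi>_def abs_le_iff mult.commute)
  qed (simp add: \<Phi>_def)
  then obtain w where w: "w \<in> V" "\<And>h. h \<in> dual_space V N \<Longrightarrow> \<Phi> h = h w"
    using reflexive_representation[OF refl] by blast
  have "crd i w = 0" for i
  proof -
    let ?h = "\<lambda>v. if v \<in> V then crd i v else 0"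
    have "crd i w = \<Phi> ?h" using w coord_in_dual_space by simp
    also have "\<dots> = L (\<lambda>j. crd i (y j))" by (simp add: \<Phi>_def coord_in_dual_space y_in)
    \<comment> \<open>\<open>T_tail n\<close> removes the coordinates below \<open>n\<close>, and
      \<open>n j \<ge> j > i\<close> from \<open>j = Suc i\<close> on.\<close>
    also have "\<dots> = 0"
    proof (rule L(3)[of "Suc i"])
      show "crd i (y j) = 0" if "j \<ge> Suc i" for j
        using n[of j] that by (simp add: y_def coord_T_tail)
    qed
    finally show ?thesis .
  qed
  then have "S w = 0" using S_sums[OF w(1)] sums_unique2[OF _ sums_zero] by simp
  then have "pull g w = 0" by (simp add: pull_def)
  then have L0: "L (\<lambda>j. pull g (y j)) = 0" using w(2)[OF pull_in] pull_in by (simp add: \<Phi>_def)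
  have pg: "pull g (y j) \<ge> e/2" for j
    using Gu[of j] by (simp add: pull_def y_in) (simp add: y_def S_T_tail functional_frame_tail[OF frame] G_def)
  \<comment> \<open>\<open>L\<close> is controlled by upper bounds, so the lower bound
    \<open>e/2\<close> is used for the negative.\<close>
  have "L (- (\<lambda>j. pull g (y j))) \<le> - (e/2)"
    using pg hy[OF pull_in, of g]
    by (intro L(2) bdd_belowI2[where m = "- (dual_norm V N (pull g) * K)"]) (auto simp: fun_Compl_def abs_le_iff)
  then show False using L0 e linear_neg[OF L(1)] by simp
qed

end

lemma associated_basisE:
  assumes "associated_basis x f V N z" "Schauder_frame x f"
  obtains T S C D where "associated_space V N z x f T S C D"
proof -
  from assms(1) obtain T S C D where *: "banach_space_on V N" "Schauder_basis V N z"
     "\<forall>u. expansion V N z (\<lambda>i. blinfun_apply (f i) u) (T u)" "\<forall>u. N (T u) \<le> C * norm u"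
     "\<forall>v\<in>V. (\<lambda>i. coord V N z i v *\<^sub>R x i) sums S v" "\<forall>v\<in>V. norm (S v) \<le> D * N v"
    unfolding associated_basis_def by blast
  then have "associated_space V N z x f T S C D"
    using assms(2) unfolding associated_space_def banach_basis_def banach_basis_axioms_def associated_space_axioms_def
    by auto
  then show thesis by (rule that)
qed

subsection \<open>Norming functionals\<close>

lemma (in normed_space_on) norming_functional_on:
  assumes u: "u \<in> V"
  obtains h where "h \<in> dual_space V N" "\<And>v. v \<in> V \<Longrightarrow> \<bar>h v\<bar> \<le> N v" "h u = N u"
proof -
  let ?S = "range (\<lambda>c. c *\<^sub>R u)"
  have S: "Real_Vector_Spaces.subspace ?S" by (metis span_singleton subspace_span)
  \<comment> \<open>For \<open>u = 0\<close> the chosen scalar is arbitrary, but then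
    \<open>N u = 0\<close>.\<close>
  define h where "h v = (SOME c. v = c *\<^sub>R u) * N u" for v
  have h: "h (c *\<^sub>R u) = c * N u" for c
  proof -
    have "c *\<^sub>R u = (SOME d. c *\<^sub>R u = d *\<^sub>R u) *\<^sub>R u" by (rule someI[of _ c]) simp
    then have "u = 0 \<or> (SOME d. c *\<^sub>R u = d *\<^sub>R u) = c" by auto
    then show ?thesis by (auto simp: h_def N_zero)
  qed
  obtain H where H: "linear H" "\<And>v. v \<in> ?S \<Longrightarrow> H v = h v" "\<And>v. v \<in> V \<Longrightarrow> H v \<le> N v"
  proof (rule Hahn_Banach[of V ?S N h])
    show "h (v + w) = h v + h w" if "v \<in> ?S" "w \<in> ?S" for v w
      using that by (auto simp: h distrib_right simp flip: scaleR_add_left)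
    show "h (c *\<^sub>R v) = c * h v" if "v \<in> ?S" for c v
      using that by (auto simp: h)
    show "h v \<le> N v" if "v \<in> ?S" for v
      using that u by (auto simp: h scale mult_right_mono nonneg)
  qed (use u scale_in in \<open>auto simp: S subspace triangle scale\<close>)
  have abs: "\<bar>H v\<bar> \<le> N v" if "v \<in> V" for v
    using H(3)[OF that] H(3)[OF scale_in[OF that, of "-1"]] linear_neg[OF H(1), of v] N_minus[OF that] by simp
  let ?h = "\<lambda>v. if v \<in> V then H v else 0"
  show thesis
  proof
    show "?h \<in> dual_space V N"
      using abs by (intro dual_spaceI[where C = 1])
        (auto simp: linear_add[OF H(1)] linear_scale[OF H(1)] add_in scale_in)
    show "\<bar>?h v\<bar> \<le> N v" if "v \<in> V" for v using abs[OF that] that by simp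
    show "?h u = N u" using H(2)[of u] h[of 1] u rangeI[of "\<lambda>c. c *\<^sub>R u" 1] by simp
  qed
qed

lemma norming_functional:
  fixes u :: "'a::banach"
  obtains g :: "'a \<Rightarrow>\<^sub>L real" where "norm g \<le> 1" "blinfun_apply g u = norm u"
proof -
  interpret banach_space_on "UNIV :: 'a set" norm by (rule banach_space_on_UNIV)
  obtain h :: "'a \<Rightarrow> real" where h: "h \<in> dual_space UNIV norm" "\<And>v. \<bar>h v\<bar> \<le> norm v" "h u = norm u"
    using norming_functional_on[of u] by auto
  have bl: "bounded_linear h"
    using h(1,2) by (intro bounded_linear_intro[where K = 1]) (auto simp: dual_space_def)
  show thesis
  proof
    show "norm (Blinfun h) \<le> 1"
      using h(2) by (intro norm_blinfun_bound) (auto simp: bounded_linear_Blinfun_apply[OF bl])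
    show "blinfun_apply (Blinfun h) u = norm u"
      by (simp add: bounded_linear_Blinfun_apply[OF bl] h(3))
  qed
qed

subsection \<open>Completion of a monotone norm on finitely supported sequences\<close>

text \<open>Generic in the entries, since both scalar sequences and sequences of vectors in the
  given space occur.\<close>

definition fin_seqs :: "(nat \<Rightarrow> 'b::zero) set" where
  "fin_seqs = {a. \<exists>k. \<forall>i\<ge>k. a i = 0}"

definition trunc :: "nat \<Rightarrow> (nat \<Rightarrow> 'b::zero) \<Rightarrow> nat \<Rightarrow> 'b" where
  "trunc k a = (\<lambda>i. if i < k then a i else 0)"

definition unit_seq :: "nat \<Rightarrow> nat \<Rightarrow> real" where
  "unit_seq i = (\<lambda>j. if j = i then 1 else 0)"

lemma fin_seqsI: "(\<And>i. i \<ge> k \<Longrightarrow> a i = 0) \<Longrightarrow> a \<in> fin_seqs"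
  by (auto simp: fin_seqs_def)

lemma fin_seqsE:
  assumes "a \<in> fin_seqs"
  obtains k where "\<And>i. i \<ge> k \<Longrightarrow> a i = 0"
  using assms by (auto simp: fin_seqs_def)

lemma trunc_fin [simp]: "trunc k a \<in> fin_seqs"
  by (rule fin_seqsI[of k]) (simp add: trunc_def)

lemma unit_seq_fin [simp]: "unit_seq i \<in> fin_seqs"
  by (rule fin_seqsI[of "Suc i"]) (simp add: unit_seq_def)

lemma subspace_fin_seqs: "subspace (fin_seqs :: (nat \<Rightarrow> 'b::real_vector) set)"
  unfolding subspace_def
proof (intro conjI ballI allI)
  fix a b :: "nat \<Rightarrow> 'b" assume "a \<in> fin_seqs" "b \<in> fin_seqs"
  then obtain k l where "\<And>i. i \<ge> k \<Longrightarrow> a i = 0" "\<And>i. i \<ge> l \<Longrightarrow> b i = 0" by (metis fin_seqsE)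
  then show "a + b \<in> fin_seqs" by (intro fin_seqsI[of "max k l"]) simp
next
  fix a :: "nat \<Rightarrow> 'b" and c assume "a \<in> fin_seqs"
  then show "c *\<^sub>R a \<in> fin_seqs" by (auto simp: fin_seqs_def scaleR_fun_def)
qed (auto simp: fin_seqs_def)

lemmas fin_seqs_add = subspace_add[OF subspace_fin_seqs]
  and fin_seqs_diff = subspace_diff[OF subspace_fin_seqs]
  and fin_seqs_scale = subspace_scale[OF subspace_fin_seqs]
  and fin_seqs_zero = subspace_0[OF subspace_fin_seqs]

lemma trunc_add: "trunc k (a + b) = trunc k a + trunc k b"
  and trunc_diff: "trunc k (a - b) = trunc k a - trunc k b"
  and trunc_scale: "trunc k (c *\<^sub>R a) = c *\<^sub>R trunc k a"
  for a b :: "nat \<Rightarrow> 'b::real_vector"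
  by (auto simp: trunc_def fun_eq_iff scaleR_fun_def)

lemma trunc_trunc: "trunc k (trunc l a) = trunc (min k l) a"
  by (auto simp: trunc_def fun_eq_iff)

lemma trunc_eq: "(\<And>i. i \<ge> k \<Longrightarrow> a i = 0) \<Longrightarrow> trunc k a = a"
  by (auto simp: trunc_def fun_eq_iff not_less)

lemma sum_unit_seq: "(\<Sum>i<n. a i *\<^sub>R unit_seq i) = trunc n a"
proof (induction n)
  case 0 then show ?case by (simp add: trunc_def zero_fun_def)
next
  case (Suc n) then show ?case by (auto simp: trunc_def unit_seq_def scaleR_fun_def fun_eq_iff less_Suc_eq)
qed

text \<open>Contraction under truncation is what makes the coordinates continuous and the unit
  sequences a monotone basis of the completion.\<close>

locale seq_norm =
  fixes N0 :: "(nat \<Rightarrow> real) \<Rightarrow> real"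
  assumes N0_nonneg: "a \<in> fin_seqs \<Longrightarrow> 0 \<le> N0 a"
    and N0_eq_zero: "a \<in> fin_seqs \<Longrightarrow> N0 a = 0 \<Longrightarrow> a = 0"
    and N0_scale: "a \<in> fin_seqs \<Longrightarrow> N0 (c *\<^sub>R a) = \<bar>c\<bar> * N0 a"
    and N0_add: "a \<in> fin_seqs \<Longrightarrow> b \<in> fin_seqs \<Longrightarrow> N0 (a + b) \<le> N0 a + N0 b"
    and N0_trunc: "a \<in> fin_seqs \<Longrightarrow> N0 (trunc k a) \<le> N0 a"
begin

text \<open>The completion is realised inside the scalar sequences: coordinates are continuous, so
  Cauchy sequences have coordinatewise limits. Membership asks that the truncations be
  Cauchy.\<close>

definition V :: "(nat \<Rightarrow> real) set" where
  "V = {a. \<forall>e>0. \<exists>K. \<forall>k\<ge>K. \<forall>l\<ge>k. N0 (trunc l a - trunc k a) < e}"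

text \<open>On \<open>V\<close> the norms of the truncations are bounded and increase with
  \<open>k\<close>, so the supremum is their limit.\<close>

definition N :: "(nat \<Rightarrow> real) \<Rightarrow> real" where
  "N a = (SUP k. N0 (trunc k a))"

lemma N0_zero: "N0 0 = 0"
  using N0_scale[OF fin_seqs_zero, of 0] by simp

lemma N0_neg: "a \<in> fin_seqs \<Longrightarrow> N0 (- a) = N0 a"
  using N0_scale[of a "-1"] by simp

lemma N0_diff: "a \<in> fin_seqs \<Longrightarrow> b \<in> fin_seqs \<Longrightarrow> N0 (a - b) \<le> N0 a + N0 b"
  using N0_add[of a "- b"] N0_neg[of b] fin_seqs_scale[of b "-1"] by simp

lemma N0_trunc_mono: "k \<le> l \<Longrightarrow> N0 (trunc k a) \<le> N0 (trunc l a)"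
  using N0_trunc[OF trunc_fin, of k l a] by (simp add: trunc_trunc min_absorb1)

lemma V_bdd:
  assumes "a \<in> V"
  shows "bdd_above (range (\<lambda>k. N0 (trunc k a)))"
proof -
  obtain K where K: "\<And>k l. k \<ge> K \<Longrightarrow> l \<ge> k \<Longrightarrow> N0 (trunc l a - trunc k a) < 1"
    using assms zero_less_one unfolding V_def by blast
  have "N0 (trunc l a) \<le> N0 (trunc K a) + 1" for l
  proof (cases "l \<le> K")
    case True
    then show ?thesis using N0_trunc_mono[OF True, of a] by simp
  next
    case False
    then show ?thesis
      using K[of K l] N0_add[of "trunc l a - trunc K a" "trunc K a"] fin_seqs_diff[of "trunc l a" "trunc K a"] by simp
  qed
  then show ?thesis by (rule bdd_aboveI2)
qed

lemma N_upper: "a \<in> V \<Longrightarrow> N0 (trunc k a) \<le> N a"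
  unfolding N_def by (rule cSUP_upper[OF UNIV_I V_bdd])

lemma N_least: "(\<And>k. N0 (trunc k a) \<le> C) \<Longrightarrow> N a \<le> C"
  unfolding N_def by (rule cSUP_least) auto

lemma fin_in_V: "a \<in> fin_seqs \<Longrightarrow> a \<in> V"
proof -
  assume "a \<in> fin_seqs"
  then obtain K where K: "\<And>i. i \<ge> K \<Longrightarrow> a i = 0" by (rule fin_seqsE) blast
  have "N0 (trunc l a - trunc k a) = 0" if "k \<ge> K" "l \<ge> k" for k l
  proof -
    have "trunc l a - trunc k a = 0" using K that by (auto simp: trunc_def fun_eq_iff not_less)
    then show ?thesis by (simp only: N0_zero)
  qed
  then show ?thesis by (auto simp: V_def intro!: exI[of _ K])
qed

lemma N_fin: "a \<in> fin_seqs \<Longrightarrow> N a = N0 a"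
proof -
  assume a: "a \<in> fin_seqs"
  then obtain K where "\<And>i. i \<ge> K \<Longrightarrow> a i = 0" by (rule fin_seqsE) blast
  then have "trunc K a = a" by (rule trunc_eq)
  then have "N0 a \<le> N a" using N_upper[OF fin_in_V[OF a], of K] by simp
  moreover have "N a \<le> N0 a" by (rule N_least) (rule N0_trunc[OF a])
  ultimately show ?thesis by simp
qed

lemma V_add:
  assumes a: "a \<in> V" and b: "b \<in> V"
  shows "a + b \<in> V"
  unfolding V_def
proof (intro CollectI allI impI)
  fix e :: real assume "e > 0"
  then have e: "e/2 > 0" by simp
  obtain K where K: "\<And>k l. k \<ge> K \<Longrightarrow> l \<ge> k \<Longrightarrow> N0 (trunc l a - trunc k a) < e/2" using a e unfolding V_def by blast
  obtain L where L: "\<And>k l. k \<ge> L \<Longrightarrow> l \<ge> k \<Longrightarrow> N0 (trunc l b - trunc k b) < e/2" using b e unfolding V_def by blast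
  have "N0 (trunc l (a + b) - trunc k (a + b)) < e" if "k \<ge> max K L" "l \<ge> k" for k l
  proof -
    have "trunc l (a + b) - trunc k (a + b) = (trunc l a - trunc k a) + (trunc l b - trunc k b)"
      by (simp add: trunc_add)
    then have "N0 (trunc l (a + b) - trunc k (a + b)) \<le> N0 (trunc l a - trunc k a) + N0 (trunc l b - trunc k b)"
      using N0_add fin_seqs_diff trunc_fin by metis
    then show ?thesis using K[of k l] L[of k l] that by simp
  qed
  then show "\<exists>K. \<forall>k\<ge>K. \<forall>l\<ge>k. N0 (trunc l (a + b) - trunc k (a + b)) < e" by blast
qed

lemma V_scale:
  assumes a: "a \<in> V"
  shows "c *\<^sub>R a \<in> V"
  unfolding V_def
proof (intro CollectI allI impI)
  fix e :: real assume e: "e > 0"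
  then have "e / (\<bar>c\<bar> + 1) > 0" by simp
  then obtain K where K: "\<And>k l. k \<ge> K \<Longrightarrow> l \<ge> k \<Longrightarrow> N0 (trunc l a - trunc k a) < e / (\<bar>c\<bar> + 1)"
    using a unfolding V_def by blast
  have "N0 (trunc l (c *\<^sub>R a) - trunc k (c *\<^sub>R a)) < e" if "k \<ge> K" "l \<ge> k" for k l
  proof -
    have "trunc l (c *\<^sub>R a) - trunc k (c *\<^sub>R a) = c *\<^sub>R (trunc l a - trunc k a)"
      by (simp add: trunc_scale scaleR_diff_right)
    then have "N0 (trunc l (c *\<^sub>R a) - trunc k (c *\<^sub>R a)) = \<bar>c\<bar> * N0 (trunc l a - trunc k a)"
      by (simp add: N0_scale fin_seqs_diff)
    also have "\<dots> \<le> (\<bar>c\<bar> + 1) * N0 (trunc l a - trunc k a)"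
      by (intro mult_right_mono N0_nonneg fin_seqs_diff trunc_fin) simp
    also have "\<dots> < (\<bar>c\<bar> + 1) * (e / (\<bar>c\<bar> + 1))"
      by (intro mult_strict_left_mono K that) simp
    finally show ?thesis by simp
  qed
  then show "\<exists>K. \<forall>k\<ge>K. \<forall>l\<ge>k. N0 (trunc l (c *\<^sub>R a) - trunc k (c *\<^sub>R a)) < e" by blast
qed

lemma V_diff: "a \<in> V \<Longrightarrow> b \<in> V \<Longrightarrow> a - b \<in> V"
  using V_add[of a "(-1) *\<^sub>R b"] V_scale[of b "-1"] by simp

lemma coord_le: 
  assumes "a \<in> V"
  shows "\<bar>a i\<bar> * N0 (unit_seq i) \<le> 2 * N a"
proof -
  have "a i *\<^sub>R unit_seq i = trunc (Suc i) a - trunc i a"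
    by (auto simp: trunc_def unit_seq_def scaleR_fun_def fun_eq_iff less_Suc_eq)
  then have "\<bar>a i\<bar> * N0 (unit_seq i) = N0 (trunc (Suc i) a - trunc i a)"
    using N0_scale[OF unit_seq_fin, of "a i" i] by simp
  also have "\<dots> \<le> N0 (trunc (Suc i) a) + N0 (trunc i a)" by (intro N0_diff trunc_fin)
  also have "\<dots> \<le> 2 * N a" using N_upper[OF assms, of "Suc i"] N_upper[OF assms, of i] by simp
  finally show ?thesis .
qed

lemma N0_unit_pos: "N0 (unit_seq i) > 0"
proof -
  have "unit_seq i \<noteq> 0" by (auto simp: unit_seq_def fun_eq_iff)
  then show ?thesis using N0_eq_zero[OF unit_seq_fin, of i] N0_nonneg[OF unit_seq_fin, of i] by fastforce
qed

lemma coord_le': "a \<in> V \<Longrightarrow> \<bar>a i\<bar> \<le> 2 / N0 (unit_seq i) * N a"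
  using coord_le[of a i] N0_unit_pos[of i] by (simp add: field_simps)

lemma N0_trunc_le_sum: "N0 (trunc k a) \<le> (\<Sum>i<k. \<bar>a i\<bar> * N0 (unit_seq i))"
proof (induction k)
  case 0
  have "trunc 0 a = 0" by (simp add: trunc_def zero_fun_def)
  then have "N0 (trunc 0 a) = 0" by (simp only: N0_zero)
  then show ?case by simp
next
  case (Suc k)
  have "trunc (Suc k) a = trunc k a + a k *\<^sub>R unit_seq k"
    by (auto simp: trunc_def unit_seq_def scaleR_fun_def fun_eq_iff less_Suc_eq)
  then have "N0 (trunc (Suc k) a) \<le> N0 (trunc k a) + \<bar>a k\<bar> * N0 (unit_seq k)"
    using N0_add[OF trunc_fin fin_seqs_scale[OF unit_seq_fin], of k a "a k" k] by (simp add: N0_scale)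
  with Suc show ?case by simp
qed

lemma normed: "normed_space_on V N"
proof
  show sub: "Real_Vector_Spaces.subspace V"
    using V_add V_scale fin_in_V[OF fin_seqs_zero] by (auto simp: Real_Vector_Spaces.subspace_def)
  show nn: "0 \<le> N a" if "a \<in> V" for a using N_upper[OF that, of 0] N0_nonneg[OF trunc_fin, of 0 a] by simp
  fix a assume a: "a \<in> V"
  show "N a = 0 \<longleftrightarrow> a = 0"
  proof
    assume "N a = 0"
    then have "a i = 0" for i using coord_le'[OF a, of i] by simp
    then show "a = 0" by (simp add: fun_eq_iff)
  qed (simp add: N_fin fin_seqs_zero N0_zero)
  have le: "N (c *\<^sub>R a) \<le> \<bar>c\<bar> * N a" if "a \<in> V" for c a
    using N_upper[OF that] by (intro N_least) (simp add: trunc_scale N0_scale mult_left_mono)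
  show "N (c *\<^sub>R a) = \<bar>c\<bar> * N a" for c
    by (rule abs_homogeneousI[OF le sub nn a])
  fix b assume b: "b \<in> V"
  show "N (a + b) \<le> N a + N b"
  proof (rule N_least)
    show "N0 (trunc k (a + b)) \<le> N a + N b" for k
      using N0_add[OF trunc_fin trunc_fin, of k a k b] N_upper[OF a, of k] N_upper[OF b, of k]
      by (simp add: trunc_add)
  qed
qed

lemma N_tail:
  assumes "a \<in> V"
  shows "(\<lambda>k. N (trunc k a - a)) \<longlonglongrightarrow> 0"
proof (rule LIMSEQ_I)
  interpret normed_space_on V N by (rule normed)
  fix e :: real assume e: "e > 0"
  then have "e/2 > 0" by simp
  then obtain K where K: "\<And>k l. k \<ge> K \<Longrightarrow> l \<ge> k \<Longrightarrow> N0 (trunc l a - trunc k a) < e/2"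
    using assms unfolding V_def by blast
  have "norm (N (trunc k a - a) - 0) < e" if k: "k \<ge> K" for k
  proof -
    have "N (trunc k a - a) \<le> e/2"
    proof (rule N_least)
      fix l
      show "N0 (trunc l (trunc k a - a)) \<le> e/2"
      proof (cases "l \<le> k")
        case True
        then show ?thesis using e by (simp add: trunc_diff trunc_trunc min_absorb1 N0_zero)
      next
        case False
        then have "trunc l (trunc k a - a) = - (trunc l a - trunc k a)"
          by (simp add: trunc_diff trunc_trunc min_absorb2)
        then show ?thesis using K[OF k, of l] False N0_neg[OF fin_seqs_diff[OF trunc_fin trunc_fin]] by simp
      qed
    qed
    moreover have "N (trunc k a - a) \<ge> 0" by (intro nonneg V_diff fin_in_V trunc_fin assms)
    ultimately show ?thesis using e by simp
  qed
  then show "\<exists>no. \<forall>k\<ge>no. norm (N (trunc k a - a) - 0) < e" by blast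
qed

lemma complete_V: "banach_space_on V N"
proof (intro banach_space_on.intro normed, unfold_locales)
  interpret normed_space_on V N by (rule normed)
  fix s :: "nat \<Rightarrow> nat \<Rightarrow> real"
  assume sV: "range s \<subseteq> V" and cau: "\<And>e. e > 0 \<Longrightarrow> \<exists>M. \<forall>m\<ge>M. \<forall>n\<ge>M. N (s m - s n) < e"
  have s: "s n \<in> V" for n using sV by auto
  have "Cauchy (\<lambda>n. s n i)" for i
  proof (rule CauchyI)
    fix e :: real assume e: "e > 0"
    let ?c = "N0 (unit_seq i)"
    have c: "?c > 0" by (rule N0_unit_pos)
    obtain M where M: "\<And>m n. m \<ge> M \<Longrightarrow> n \<ge> M \<Longrightarrow> N (s m - s n) < e * ?c / 2" using cau[of "e * ?c / 2"] e c by auto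
    have "norm (s m i - s n i) < e" if "m \<ge> M" "n \<ge> M" for m n
    proof -
      have "\<bar>s m i - s n i\<bar> * ?c < e * ?c"
        using coord_le[OF V_diff[OF s s], of m n i] M[OF that] by simp
      then show ?thesis using c by simp
    qed
    then show "\<exists>M. \<forall>m\<ge>M. \<forall>n\<ge>M. norm (s m i - s n i) < e" by blast
  qed
  then have "\<forall>i. \<exists>l. (\<lambda>n. s n i) \<longlonglongrightarrow> l" by (simp add: Cauchy_convergent_iff convergent_def)
  from choice[OF this] obtain a where a: "\<And>i. (\<lambda>n. s n i) \<longlonglongrightarrow> a i" by blast
  \<comment> \<open>Only the first \<open>k\<close> coordinates enter, and on these coordinatewise
    convergence already implies convergence in \<open>N0\<close>.\<close>
  have close: "N0 (trunc k (s m - a)) \<le> e" if M: "\<And>m n. m \<ge> M \<Longrightarrow> n \<ge> M \<Longrightarrow> N (s m - s n) < e" and m: "m \<ge> M" for k m M e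
  proof (rule LIMSEQ_le_const)
    have "(\<lambda>n. e + (\<Sum>i<k. \<bar>s n i - a i\<bar> * N0 (unit_seq i))) \<longlonglongrightarrow> e + (\<Sum>i<k. \<bar>a i - a i\<bar> * N0 (unit_seq i))"
      by (intro tendsto_intros a)
    then show "(\<lambda>n. e + (\<Sum>i<k. \<bar>s n i - a i\<bar> * N0 (unit_seq i))) \<longlonglongrightarrow> e" by simp
    have "N0 (trunc k (s m - a)) \<le> e + (\<Sum>i<k. \<bar>s n i - a i\<bar> * N0 (unit_seq i))" if n: "n \<ge> M" for n
    proof -
      have "trunc k (s m - a) = trunc k (s m - s n) + trunc k (s n - a)" by (simp add: trunc_diff)
      then have "N0 (trunc k (s m - a)) \<le> N0 (trunc k (s m - s n)) + N0 (trunc k (s n - a))"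
        using N0_add trunc_fin by metis
      also have "N0 (trunc k (s m - s n)) \<le> N (s m - s n)" by (intro N_upper V_diff s)
      finally have "N0 (trunc k (s m - a)) \<le> N (s m - s n) + N0 (trunc k (s n - a))" by linarith
      moreover have "N0 (trunc k (s n - a)) \<le> (\<Sum>i<k. \<bar>s n i - a i\<bar> * N0 (unit_seq i))"
        using N0_trunc_le_sum[of k "s n - a"] by simp
      ultimately show ?thesis using M[OF m n] by linarith
    qed
    then show "\<exists>M. \<forall>n\<ge>M. N0 (trunc k (s m - a)) \<le> e + (\<Sum>i<k. \<bar>s n i - a i\<bar> * N0 (unit_seq i))" by blast
  qed
  have aV: "a \<in> V"
    unfolding V_def
  proof (intro CollectI allI impI)
    fix e :: real assume e: "e > 0"
    obtain M where M: "\<And>m n. m \<ge> M \<Longrightarrow> n \<ge> M \<Longrightarrow> N (s m - s n) < e/4" using cau[of "e/4"] e by auto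
    have cl: "N0 (trunc j (s M - a)) \<le> e/4" for j
      by (rule close[where M = M]) (use M in auto)
    have "e/4 > 0" using e by simp
    then obtain K where K: "\<And>k l. k \<ge> K \<Longrightarrow> l \<ge> k \<Longrightarrow> N0 (trunc l (s M) - trunc k (s M)) < e/4"
      using s[of M] unfolding V_def by blast
    have "N0 (trunc l a - trunc k a) < e" if "k \<ge> K" "l \<ge> k" for k l
    proof -
      let ?x = "trunc l (s M) - trunc k (s M)" and ?y = "trunc l (s M - a)" and ?z = "trunc k (s M - a)"
      have "trunc l a - trunc k a = (?x - ?y) + ?z" by (simp add: trunc_diff)
      then have "N0 (trunc l a - trunc k a) \<le> N0 (?x - ?y) + N0 ?z"
        using N0_add[of "?x - ?y" ?z] fin_seqs_diff trunc_fin by metis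
      also have "N0 (?x - ?y) \<le> N0 ?x + N0 ?y" by (intro N0_diff fin_seqs_diff trunc_fin)
      finally show ?thesis
        using K[OF that] cl[of l] cl[of k] e by linarith
    qed
    then show "\<exists>K. \<forall>k\<ge>K. \<forall>l\<ge>k. N0 (trunc l a - trunc k a) < e" by blast
  qed
  have "(\<lambda>n. N (s n - a)) \<longlonglongrightarrow> 0"
  proof (rule LIMSEQ_I)
    fix e :: real assume e: "e > 0"
    obtain M where M: "\<And>m n. m \<ge> M \<Longrightarrow> n \<ge> M \<Longrightarrow> N (s m - s n) < e/2" using cau[of "e/2"] e by auto
    have "norm (N (s m - a) - 0) < e" if "m \<ge> M" for m
    proof -
      have "N (s m - a) \<le> e/2" by (intro N_least close[where M = M]) (use M that in auto)
      then show ?thesis using e nonneg[OF V_diff[OF s aV], of m] by simp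
    qed
    then show "\<exists>no. \<forall>n\<ge>no. norm (N (s n - a) - 0) < e" by blast
  qed
  then show "\<exists>v. norm_conv V N s v" using aV by (auto simp: norm_conv_def)
qed

text \<open>This equivalence yields existence and uniqueness of expansions at once and identifies
  the coordinate functionals with evaluation.\<close>

lemma expansion_iff: "expansion V N unit_seq a v \<longleftrightarrow> v \<in> V \<and> a = v"
proof
  assume "expansion V N unit_seq a v"
  then have v: "v \<in> V" and lim: "(\<lambda>n. N (trunc n a - v)) \<longlonglongrightarrow> 0"
    by (auto simp: expansion_def norm_conv_def sum_unit_seq)
  have "a i = v i" for i
  proof -
    have "\<bar>a i - v i\<bar> \<le> 0"
    proof (rule LIMSEQ_le_const)
      show "(\<lambda>n. 2 / N0 (unit_seq i) * N (trunc n a - v)) \<longlonglongrightarrow> 0"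
        by (rule tendsto_mult_right_zero[OF lim])
      have "\<bar>a i - v i\<bar> \<le> 2 / N0 (unit_seq i) * N (trunc n a - v)" if "n \<ge> Suc i" for n
        using coord_le'[OF V_diff[OF fin_in_V[OF trunc_fin] v], of n a i] that by (simp add: trunc_def)
      then show "\<exists>M. \<forall>n\<ge>M. \<bar>a i - v i\<bar> \<le> 2 / N0 (unit_seq i) * N (trunc n a - v)" by blast
    qed
    then show ?thesis by simp
  qed
  with v show "v \<in> V \<and> a = v" by (simp add: fun_eq_iff)
next
  assume "v \<in> V \<and> a = v"
  then show "expansion V N unit_seq a v"
    using N_tail by (simp add: expansion_def norm_conv_def sum_unit_seq)
qed

lemma basis_unit_seq: "Schauder_basis V N unit_seq"
  unfolding Schauder_basis_def expansion_iff using fin_in_V[OF unit_seq_fin] by auto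

end

sublocale seq_norm \<subseteq> banach_basis V N unit_seq
  using complete_V basis_unit_seq by (simp add: banach_basis_def banach_basis_axioms_def)

section \<open>Shrinking and reflexivity of the completion\<close>

context seq_norm
begin

lemma coord_unit_seq: "v \<in> V \<Longrightarrow> coord V N unit_seq i v = v i"
  using coord_eqI[of v v i] by (simp add: expansion_iff)

text \<open>Tail estimates are demanded on finitely supported sequences only. A vector of the closed
  span has vanishing initial coordinates, hence so have its truncations, and these converge to
  it.\<close>

lemma shrinking_unit_seq:
  assumes tails: "\<And>h C e. (\<And>a b. a \<in> fin_seqs \<Longrightarrow> b \<in> fin_seqs \<Longrightarrow> h (a + b) = h a + h b) \<Longrightarrow>
      (\<And>c a. a \<in> fin_seqs \<Longrightarrow> h (c *\<^sub>R a) = c * h a) \<Longrightarrow>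
      (\<And>a. a \<in> fin_seqs \<Longrightarrow> \<bar>h a\<bar> \<le> C * N0 a) \<Longrightarrow> e > 0 \<Longrightarrow>
      \<exists>k. \<forall>a\<in>fin_seqs. (\<forall>i<k. a i = 0) \<longrightarrow> \<bar>h a\<bar> \<le> e * N0 a"
  shows "shrinking_basis V N unit_seq"
  unfolding shrinking_basis_def
proof (intro conjI basis_unit_seq ballI)
  fix h assume h: "h \<in> dual_space V N"
  obtain C where C: "C \<ge> 0" "\<And>v. v \<in> V \<Longrightarrow> \<bar>h v\<bar> \<le> C * N v" using dual_space_bounded[OF h] by blast
  show "(\<lambda>n. dual_norm (closed_span V N (unit_seq ` {n..})) N h) \<longlonglongrightarrow> 0"
  proof (rule LIMSEQ_I)
    fix e :: real assume e: "e > 0"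
    have "\<exists>k. \<forall>a\<in>fin_seqs. (\<forall>i<k. a i = 0) \<longrightarrow> \<bar>h a\<bar> \<le> e/2 * N0 a"
    proof (rule tails)
      show "h (a + b) = h a + h b" if "a \<in> fin_seqs" "b \<in> fin_seqs" for a b
        using h that fin_in_V by (simp add: dual_space_def)
      show "h (c *\<^sub>R a) = c * h a" if "a \<in> fin_seqs" for c a
        using h that fin_in_V by (simp add: dual_space_def)
      show "\<bar>h a\<bar> \<le> C * N0 a" if "a \<in> fin_seqs" for a using C(2)[OF fin_in_V[OF that]] N_fin[OF that] by simp
    qed (use e in simp)
    then obtain k where k: "\<And>a. a \<in> fin_seqs \<Longrightarrow> (\<forall>i<k. a i = 0) \<Longrightarrow> \<bar>h a\<bar> \<le> e/2 * N0 a" by blast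
    have "norm (dual_norm (closed_span V N (unit_seq ` {n..})) N h - 0) < e" if n: "n \<ge> k" for n
    proof -
      let ?W = "closed_span V N (unit_seq ` {n..})"
      have WV: "?W \<subseteq> V" by (auto simp: closed_span_def)
      have W0: "0 \<in> ?W" by (auto simp: closed_span_def zero_in N_zero intro!: bexI[of _ 0] span_zero)
      have span0: "w i = 0" if "w \<in> span (unit_seq ` {n..})" "i < n" for w i
        using that(1)
      proof (induction rule: span_induct)
        case base
        show ?case by (auto simp: Real_Vector_Spaces.subspace_def scaleR_fun_def)
      qed (use that(2) in \<open>auto simp: unit_seq_def\<close>)
      have spanV: "w \<in> V" if "w \<in> span (unit_seq ` {n..})" for w
        using span_minimal[of "unit_seq ` {n..}" V] subspace fin_in_V[OF unit_seq_fin] that by blast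
      have vi: "v i = 0" if v: "v \<in> ?W" and i: "i < n" for v i
      proof -
        have "\<bar>v i\<bar> \<le> 0 + e" if e: "e > 0" for e
        proof -
          have "e * N0 (unit_seq i) / 2 > 0" using e N0_unit_pos[of i] by simp
          then obtain w where w: "w \<in> span (unit_seq ` {n..})" "N (v - w) < e * N0 (unit_seq i) / 2"
            using v unfolding closed_span_def by blast
          have "\<bar>v i\<bar> * N0 (unit_seq i) \<le> 2 * N (v - w)"
            using coord_le[OF V_diff[OF _ spanV[OF w(1)]], of v i] v WV span0[OF w(1) i] by auto
          also have "\<dots> \<le> e * N0 (unit_seq i)" using w(2) by simp
          finally show ?thesis using N0_unit_pos[of i] by simp
        qed
        then have "\<bar>v i\<bar> \<le> 0" by (rule field_le_epsilon)
        then show ?thesis by simp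
      qed
      have "dual_norm ?W N h \<le> e/2"
      proof (rule dual_norm_least[OF W0])
        show "N 0 \<le> 1" by (simp add: N_zero)
        fix v assume v: "v \<in> ?W" "N v \<le> 1"
        have vV: "v \<in> V" using v(1) WV by blast
        show "\<bar>h v\<bar> \<le> e/2"
        proof (rule LIMSEQ_le_const)
          show "(\<lambda>m. e/2 + C * N (trunc m v - v)) \<longlonglongrightarrow> e/2"
            using tendsto_add[OF tendsto_const tendsto_mult_right_zero[OF N_tail[OF vV]], of "e/2" C] by simp
          have "\<bar>h v\<bar> \<le> e/2 + C * N (trunc m v - v)" for m
          proof -
            have tV: "trunc m v \<in> V" by (intro fin_in_V trunc_fin)
            have "h (trunc m v) = h ((trunc m v - v) + v)" by simp
            also have "\<dots> = h (trunc m v - v) + h v"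
              using h vV V_diff[OF tV vV] unfolding dual_space_def by blast
            finally have "\<bar>h v\<bar> \<le> \<bar>h (trunc m v)\<bar> + \<bar>h (trunc m v - v)\<bar>" by linarith
            moreover have "\<bar>h (trunc m v)\<bar> \<le> e/2 * N0 (trunc m v)"
              using vi[OF v(1)] n by (intro k trunc_fin) (simp add: trunc_def)
            moreover have "e/2 * N0 (trunc m v) \<le> e/2 * 1"
              using order_trans[OF N_upper[OF vV] v(2)] e by (intro mult_left_mono) auto
            ultimately show ?thesis using C(2)[OF V_diff[OF tV vV]] by linarith
          qed
          then show "\<exists>M. \<forall>m\<ge>M. \<bar>h v\<bar> \<le> e/2 + C * N (trunc m v - v)" by blast
        qed
      qed
      moreover have "0 \<le> dual_norm ?W N h" by (rule dual_norm_nonneg[OF h WV W0])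
      ultimately show ?thesis using e by simp
    qed
    then show "\<exists>no. \<forall>n\<ge>no. norm (dual_norm (closed_span V N (unit_seq ` {n..})) N h - 0) < e" by blast
  qed
qed

text \<open>The candidate vector has coordinates \<open>\<Phi> (\<epsilon> i)\<close>. Its
  truncations are bounded because composing with a truncation does not increase the dual norm, so
  \<open>bc\<close> puts it into \<open>V\<close>. Shrinking gives convergence of
  \<open>P h k\<close> to \<open>h\<close> in the dual norm; hence \<open>\<Phi> h\<close> is the
  limit of \<open>h (trunc k a)\<close>, that is \<open>h a\<close>.\<close>

lemma reflexive_unit_seq:
  assumes shr: "shrinking_basis V N unit_seq"
    and bc: "\<And>a B. (\<And>k. N0 (trunc k a) \<le> B) \<Longrightarrow> a \<in> V"
  shows "reflexive_space V N"
  unfolding reflexive_space_def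
proof
  show "canonical_embedding V N ` V \<subseteq> bidual_space V N"
  proof (rule image_subsetI)
    fix v assume v: "v \<in> V"
    show "canonical_embedding V N v \<in> bidual_space V N"
      unfolding bidual_space_def canonical_embedding_def
    proof (rule dual_spaceI[where C = "N v"])
      show "\<bar>if h \<in> dual_space V N then h v else 0\<bar> \<le> N v * dual_norm V N h" if "h \<in> dual_space V N" for h
        using dual_norm_bound[OF that v] that by (simp add: mult.commute)
      show "(if c *\<^sub>R h \<in> dual_space V N then (c *\<^sub>R h) v else 0) = c * (if h \<in> dual_space V N then h v else 0)"
        if "h \<in> dual_space V N" for c h
        using that dual_space_scale[OF that, of c] by (simp add: scaleR_fun_def)
    qed (auto simp: dual_space_add)
  qed
next
  show "bidual_space V N \<subseteq> canonical_embedding V N ` V"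
  proof
    fix \<Phi> assume \<Phi>: "\<Phi> \<in> bidual_space V N"
    have \<Phi>_add: "\<Phi> (g + h) = \<Phi> g + \<Phi> h" if "g \<in> dual_space V N" "h \<in> dual_space V N" for g h
      using \<Phi> that unfolding bidual_space_def dual_space_def[of "dual_space V N"] by blast
    have \<Phi>_scale: "\<Phi> (c *\<^sub>R h) = c * \<Phi> h" if "h \<in> dual_space V N" for c h
      using \<Phi> that unfolding bidual_space_def dual_space_def[of "dual_space V N"] by blast
    have \<Phi>_out: "\<Phi> h = 0" if "h \<notin> dual_space V N" for h
      using \<Phi> that unfolding bidual_space_def dual_space_def[of "dual_space V N"] by blast
    obtain B0 where B0: "\<And>h. h \<in> dual_space V N \<Longrightarrow> \<bar>\<Phi> h\<bar> \<le> B0 * dual_norm V N h"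
      using \<Phi> unfolding bidual_space_def dual_space_def[of "dual_space V N"] by blast
    define B where "B = \<bar>B0\<bar>"
    have B: "\<bar>\<Phi> h\<bar> \<le> B * dual_norm V N h" if "h \<in> dual_space V N" for h
      using B0[OF that] mult_right_mono[OF abs_ge_self dual_norm_nonneg[OF that subset_refl zero_in], of B0]
      unfolding B_def by linarith
    define \<epsilon> where "\<epsilon> i = (\<lambda>v. if v \<in> V then v i else 0)" for i
    have \<epsilon>: "\<epsilon> i \<in> dual_space V N" for i
    proof -
      have "\<epsilon> i = (\<lambda>v. if v \<in> V then crd i v else 0)" by (auto simp: \<epsilon>_def coord_unit_seq fun_eq_iff)
      then show ?thesis using coord_in_dual_space by simp
    qed
    define a where "a i = \<Phi> (\<epsilon> i)" for i
    \<comment> \<open>\<open>P h k\<close> is \<open>h\<close> after truncation at \<open>k\<close>,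
      written as a combination of coordinate functionals so that \<open>\<Phi>\<close> can be
      computed on it.\<close>
    define P where "P h k = (\<Sum>i<k. h (unit_seq i) *\<^sub>R \<epsilon> i)" for h :: "(nat \<Rightarrow> real) \<Rightarrow> real" and k
    have P_in: "P h k \<in> dual_space V N" for h k
      unfolding P_def by (intro subspace_sum subspace_dual_space dual_space_scale \<epsilon>)
    have h_sum: "h (\<Sum>i<k. c i *\<^sub>R unit_seq i) = (\<Sum>i<k. c i * h (unit_seq i))" if "h \<in> dual_space V N" for h c and k :: nat
    proof (induction k)
      case 0
      have "h (0 *\<^sub>R 0) = 0 * h 0" using that zero_in unfolding dual_space_def by blast
      then show ?case by (simp add: zero_fun_def)
    next
      case (Suc k)
      have "h ((\<Sum>i<k. c i *\<^sub>R unit_seq i) + c k *\<^sub>R unit_seq k) = h (\<Sum>i<k. c i *\<^sub>R unit_seq i) + h (c k *\<^sub>R unit_seq k)"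
        using that partial_sum_in scale_in[OF z_in] unfolding dual_space_def by blast
      moreover have "h (c k *\<^sub>R unit_seq k) = c k * h (unit_seq k)"
        using that z_in unfolding dual_space_def by blast
      ultimately show ?case using Suc by (simp only: sum.lessThan_Suc)
    qed
    have P_apply: "P h k v = h (trunc k v)" if "v \<in> V" "h \<in> dual_space V N" for h k v
    proof -
      have "P h k v = (\<Sum>i<k. v i * h (unit_seq i))"
        unfolding P_def using that(1) by (induction k) (auto simp: \<epsilon>_def scaleR_fun_def mult.commute)
      also have "\<dots> = h (trunc k v)" using h_sum[OF that(2), of v k] by (simp add: sum_unit_seq)
      finally show ?thesis .
    qed
    have \<Phi>_P: "\<Phi> (P h k) = h (trunc k a)" if h: "h \<in> dual_space V N" for h k
    proof -
      have "\<Phi> (P h k) = (\<Sum>i<k. h (unit_seq i) * a i)"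
      proof (induction k)
        case 0
        have "\<Phi> (0 *\<^sub>R 0) = 0 * \<Phi> 0" by (rule \<Phi>_scale[OF zero_in_dual_space])
        then show ?case by (simp add: P_def zero_fun_def)
      next
        case (Suc k)
        have "P h (Suc k) = P h k + h (unit_seq k) *\<^sub>R \<epsilon> k" by (simp add: P_def)
        then show ?case using Suc \<Phi>_add[OF P_in dual_space_scale[OF \<epsilon>], of h k "h (unit_seq k)" k] \<Phi>_scale[OF \<epsilon>]
          by (simp only: a_def sum.lessThan_Suc)
      qed
      also have "\<dots> = h (trunc k a)" using h_sum[OF h, of a k] by (simp add: sum_unit_seq mult.commute)
      finally show ?thesis .
    qed
    have tV: "trunc k v \<in> V" for k v by (intro fin_in_V trunc_fin)
    have aV: "a \<in> V"
    proof (rule bc)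
      fix k
      \<comment> \<open>A functional norming the truncation turns the bound on \<open>\<Phi>\<close>
        into a bound on the norm of the truncation.\<close>
      obtain h where h: "h \<in> dual_space V N" "\<And>v. v \<in> V \<Longrightarrow> \<bar>h v\<bar> \<le> N v" "h (trunc k a) = N (trunc k a)"
        using norming_functional_on[OF tV[of k a]] by blast
      have "dual_norm V N (P h k) \<le> 1"
      proof (rule dual_norm_least[OF zero_in])
        fix v assume v: "v \<in> V" "N v \<le> 1"
        have "\<bar>P h k v\<bar> \<le> N (trunc k v)" using h(2)[OF tV] P_apply[OF v(1) h(1)] by simp
        also have "\<dots> \<le> N v" using N_upper[OF v(1)] by (simp add: N_fin)
        finally show "\<bar>P h k v\<bar> \<le> 1" using v(2) by simp
      qed (simp add: N_zero)
      then have "B * dual_norm V N (P h k) \<le> B * 1" by (intro mult_left_mono) (auto simp: B_def)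
      then have "\<bar>\<Phi> (P h k)\<bar> \<le> B" using B[OF P_in, of h k] by simp
      then show "N0 (trunc k a) \<le> B" using \<Phi>_P[OF h(1), of k] h(3) by (simp add: N_fin)
    qed
    have "\<Phi> h = h a" if h: "h \<in> dual_space V N" for h
    proof -
      define \<delta> where "\<delta> k = dual_norm (closed_span V N (unit_seq ` {k..})) N h" for k
      have \<delta>: "\<delta> \<longlonglongrightarrow> 0" using shr h by (simp add: shrinking_basis_def \<delta>_def[abs_def])
      obtain C where C: "C \<ge> 0" "\<And>v. v \<in> V \<Longrightarrow> \<bar>h v\<bar> \<le> C * N v" using dual_space_bounded[OF h] by blast
      have diff: "h (u - v) = h u - h v" if "u \<in> V" "v \<in> V" for u v
      proof -
        have "h ((u - v) + v) = h (u - v) + h v" using h V_diff[OF that] that(2) unfolding dual_space_def by blast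
        then show ?thesis by simp
      qed
      have tail_in: "v - trunc k v \<in> closed_span V N (unit_seq ` {k..})" if v: "v \<in> V" for v k
        unfolding closed_span_def
      proof (intro CollectI conjI allI impI V_diff v tV)
        fix e :: real assume "e > 0"
        then have "\<forall>\<^sub>F m in sequentially. N (trunc m v - v) < e" using N_tail[OF v] by (intro order_tendstoD(2)) auto
        then obtain m where m: "m \<ge> k" "N (trunc m v - v) < e"
          by (metis (no_types, lifting) eventually_sequentially nle_le)
        have "trunc m v - trunc k v = (\<Sum>i=k..<m. v i *\<^sub>R unit_seq i)"
          using sum.atLeastLessThan_concat[of 0 k m "\<lambda>i. v i *\<^sub>R unit_seq i"] m(1)
          by (simp add: sum_unit_seq[symmetric] atLeast0LessThan algebra_simps)
        also have "\<dots> \<in> span (unit_seq ` {k..})" by (intro span_sum span_scale span_base) auto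
        finally have "trunc m v - trunc k v \<in> span (unit_seq ` {k..})" .
        moreover have "N (v - trunc k v - (trunc m v - trunc k v)) < e"
          using m(2) N_diff_commute[OF v tV] by simp
        ultimately show "\<exists>w\<in>span (unit_seq ` {k..}). N (v - trunc k v - w) < e" by blast
      qed
      \<comment> \<open>The factor 2 bounds the norm of \<open>v - trunc k v\<close> for
        \<open>v\<close> in the unit ball.\<close>
      have "dual_norm V N (h - P h k) \<le> 2 * \<delta> k" and hP: "h - P h k \<in> dual_space V N" for k
      proof -
        let ?W = "closed_span V N (unit_seq ` {k..})"
        have WV: "?W \<subseteq> V" by (auto simp: closed_span_def)
        have \<delta>0: "\<delta> k \<ge> 0"
          unfolding \<delta>_def using tail_in[OF zero_in, of k] by (intro dual_norm_nonneg h WV) (simp add: trunc_def zero_fun_def)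
        show "h - P h k \<in> dual_space V N"
          using subspace_diff[OF subspace_dual_space h P_in] .
        show "dual_norm V N (h - P h k) \<le> 2 * \<delta> k"
        proof (rule dual_norm_least[OF zero_in])
          fix v assume v: "v \<in> V" "N v \<le> 1"
          have "(h - P h k) v = h (v - trunc k v)" by (simp add: P_apply v h diff tV)
          also have "\<bar>\<dots>\<bar> \<le> \<delta> k * N (v - trunc k v)"
            unfolding \<delta>_def
          proof (rule dual_norm_apply[OF h WV])
            show "c *\<^sub>R (v - trunc k v) \<in> ?W" for c
              using tail_in[OF V_scale[OF v(1)], of c k] by (simp add: trunc_scale scaleR_diff_right)
          qed
          also have "\<dots> \<le> \<delta> k * 2"
          proof (intro mult_left_mono \<delta>0)
            have "N (v - trunc k v) \<le> N v + N (trunc k v)"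
              using triangle[OF v(1) scale_in[OF tV], of "-1" k v] N_minus[OF tV] by simp
            then show "N (v - trunc k v) \<le> 2" using v N_upper[OF v(1), of k] by (simp add: N_fin)
          qed
          finally show "\<bar>(h - P h k) v\<bar> \<le> 2 * \<delta> k" by simp
        qed (simp add: N_zero)
      qed note le = this
      have "(\<lambda>k. \<Phi> (P h k)) \<longlonglongrightarrow> \<Phi> h"
      proof (rule LIM_zero_cancel, rule Lim_null_comparison[OF always_eventually])
        show "\<forall>k. norm (\<Phi> (P h k) - \<Phi> h) \<le> B * (2 * \<delta> k)"
        proof
          fix k
          have "\<Phi> h = \<Phi> ((h - P h k) + P h k)" by simp
          also have "\<dots> = \<Phi> (h - P h k) + \<Phi> (P h k)" by (intro \<Phi>_add P_in hP)
          finally have "norm (\<Phi> (P h k) - \<Phi> h) = \<bar>\<Phi> (h - P h k)\<bar>" by simp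
          also have "\<dots> \<le> B * dual_norm V N (h - P h k)" by (intro B hP)
          also have "\<dots> \<le> B * (2 * \<delta> k)" by (intro mult_left_mono le) (simp add: B_def)
          finally show "norm (\<Phi> (P h k) - \<Phi> h) \<le> B * (2 * \<delta> k)" .
        qed
        show "(\<lambda>k. B * (2 * \<delta> k)) \<longlonglongrightarrow> 0" by (intro tendsto_mult_right_zero \<delta>)
      qed
      moreover have "(\<lambda>k. \<Phi> (P h k)) \<longlonglongrightarrow> h a"
      proof (rule LIM_zero_cancel, rule Lim_null_comparison[OF always_eventually])
        show "\<forall>k. norm (\<Phi> (P h k) - h a) \<le> C * N (trunc k a - a)"
          using C(2)[OF V_diff[OF tV aV]] by (simp add: \<Phi>_P[OF h] diff tV aV)
        show "(\<lambda>k. C * N (trunc k a - a)) \<longlonglongrightarrow> 0" by (intro tendsto_mult_right_zero N_tail aV)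
      qed
      ultimately show ?thesis by (rule LIMSEQ_unique)
    qed
    then have "\<Phi> = canonical_embedding V N a"
      by (auto simp: canonical_embedding_def fun_eq_iff \<Phi>_out)
    then show "\<Phi> \<in> canonical_embedding V N ` V" using aV by blast
  qed
qed

end

subsection \<open>The interpolation norm\<close>

lemma L2_set_mono2:
  assumes "finite B" "A \<subseteq> B"
  shows "L2_set f A \<le> L2_set f B"
  unfolding L2_set_def using assms by (intro real_sqrt_le_mono sum_mono2) auto

lemma sum_geometric_tail: "(\<Sum>n=m..<m'. c / 2 ^ n) \<le> 2 * c / 2 ^ m" if "c \<ge> 0" for c :: real and m m' :: nat
proof (cases "m \<le> m'")
  case True
  then have "(\<Sum>n=m..<m'. c / 2 ^ n) = 2 * c / 2 ^ m - 2 * c / 2 ^ m'"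
    by (induction m' rule: dec_induct) simp_all
  then show ?thesis using that by simp
qed (use that in simp)

text \<open>For a finitely supported sequence the final jump to 0 is counted, so the variation
  dominates the norm of every entry.\<close>

definition variation :: "(nat \<Rightarrow> 'a::real_normed_vector) \<Rightarrow> real" where
  "variation v = (\<Sum>i. norm (v i - v (Suc i)))"

lemma variation_eq_sum:
  assumes "\<And>i. i \<ge> L \<Longrightarrow> v i = 0"
  shows "variation v = (\<Sum>i<L. norm (v i - v (Suc i)))"
  unfolding variation_def using assms by (intro suminf_finite) auto

lemma norm_le_sum_variation:
  fixes v :: "nat \<Rightarrow> 'a::real_normed_vector"
  assumes "k \<le> L"
  shows "norm (v k) \<le> (\<Sum>i=k..<L. norm (v i - v (Suc i))) + norm (v L)"
  using assms
proof (induction L rule: dec_induct)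
  case (step n)
  then show ?case using norm_triangle_ineq[of "v n - v (Suc n)" "v (Suc n)"] by simp
qed simp

lemma variation_ge:
  assumes "v \<in> fin_seqs"
  shows "(\<Sum>i<k. norm (v i - v (Suc i))) + norm (v k) \<le> variation v"
proof -
  obtain L0 where "\<And>i. i \<ge> L0 \<Longrightarrow> v i = 0" using assms by (rule fin_seqsE) blast
  then have L: "\<And>i. i \<ge> max k L0 \<Longrightarrow> v i = 0" by simp
  have "variation v = (\<Sum>i<max k L0. norm (v i - v (Suc i)))" by (rule variation_eq_sum[OF L])
  also have "\<dots> = (\<Sum>i<k. norm (v i - v (Suc i))) + (\<Sum>i=k..<max k L0. norm (v i - v (Suc i)))"
    using sum.atLeastLessThan_concat[of 0 k "max k L0" "\<lambda>i. norm (v i - v (Suc i))"] by (simp add: atLeast0LessThan)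
  finally show ?thesis using norm_le_sum_variation[of k "max k L0" v] L[of "max k L0"] by simp
qed

lemma variation_nonneg: "v \<in> fin_seqs \<Longrightarrow> 0 \<le> variation v"
  using variation_ge[of v 0] norm_ge_zero[of "v 0"] by (simp del: norm_ge_zero)

lemma variation_add:
  assumes u: "u \<in> fin_seqs" and v: "v \<in> fin_seqs"
  shows "variation (u + v) \<le> variation u + variation v"
proof -
  obtain k where k: "\<And>i. i \<ge> k \<Longrightarrow> u i = 0" using u by (rule fin_seqsE) blast
  obtain l where l: "\<And>i. i \<ge> l \<Longrightarrow> v i = 0" using v by (rule fin_seqsE) blast
  define L where "L = max k l"
  have "norm ((u + v) i - (u + v) (Suc i)) \<le> norm (u i - u (Suc i)) + norm (v i - v (Suc i))" for i
    using norm_triangle_ineq[of "u i - u (Suc i)" "v i - v (Suc i)"] by (simp add: algebra_simps)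
  then have "(\<Sum>i<L. norm ((u + v) i - (u + v) (Suc i))) \<le> (\<Sum>i<L. norm (u i - u (Suc i)) + norm (v i - v (Suc i)))"
    by (intro sum_mono)
  then show ?thesis
    using variation_eq_sum[of L "u + v"] variation_eq_sum[of L u] variation_eq_sum[of L v] k l
    by (simp add: L_def sum.distrib)
qed

lemma variation_scale:
  assumes "v \<in> fin_seqs"
  shows "variation (c *\<^sub>R v) = \<bar>c\<bar> * variation v"
proof -
  obtain k where k: "\<And>i. i \<ge> k \<Longrightarrow> v i = 0" using assms by (rule fin_seqsE) blast
  have "norm ((c *\<^sub>R v) i - (c *\<^sub>R v) (Suc i)) = \<bar>c\<bar> * norm (v i - v (Suc i))" for i
    by (simp add: scaleR_fun_def scaleR_diff_right[symmetric])
  then show ?thesis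
    using variation_eq_sum[of k v] variation_eq_sum[of k "c *\<^sub>R v"] k
    by (simp add: sum_distrib_left) (simp add: scaleR_fun_def)
qed

text \<open>Truncation creates a jump of size \<open>norm (v j)\<close> at its end, which the
  discarded part pays for because it has to descend to 0.\<close>

lemma variation_trunc:
  assumes "v \<in> fin_seqs"
  shows "variation (trunc k v) \<le> variation v"
proof (cases k)
  case 0
  then have "variation (trunc k v) = 0" using variation_eq_sum[of 0 "trunc k v"] by (simp add: trunc_def)
  then show ?thesis using variation_nonneg[OF assms] by simp
next
  case (Suc j)
  have "variation (trunc k v) = (\<Sum>i<Suc j. norm (trunc k v i - trunc k v (Suc i)))"
    by (rule variation_eq_sum) (simp add: trunc_def Suc)
  also have "\<dots> = (\<Sum>i<j. norm (v i - v (Suc i))) + norm (v j)" by (simp add: trunc_def Suc)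
  finally show ?thesis using variation_ge[OF assms, of j] by simp
qed

text \<open>A truncated constant sequence has at most one jump. This is why truncated coefficient
  sequences of \<open>u\<close> lie in \<open>norm u\<close> times \<open>W\<close>.\<close>

lemma variation_trunc_const: "variation (trunc k (\<lambda>_. u)) \<le> norm u"
proof (cases k)
  case 0
  then show ?thesis using variation_eq_sum[of 0 "trunc k (\<lambda>_. u)"] by (simp add: trunc_def)
next
  case (Suc j)
  have "variation (trunc k (\<lambda>_. u)) = (\<Sum>i<Suc j. norm (trunc k (\<lambda>_. u) i - trunc k (\<lambda>_. u) (Suc i)))"
    by (rule variation_eq_sum) (simp add: trunc_def Suc)
  then show ?thesis by (simp add: trunc_def Suc)
qed

locale interpolation =
  fixes y :: "nat \<Rightarrow> 'a::banach" and F :: "nat \<Rightarrow> 'a \<Rightarrow>\<^sub>L real"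
  assumes y_nonzero: "y i \<noteq> 0" and F_nonzero: "F i \<noteq> 0"
    and frame_summable: "summable (\<lambda>i. blinfun_apply (F i) u *\<^sub>R y i)"
begin

definition M :: "(nat \<Rightarrow> real) \<Rightarrow> real" where
  "M a = (SUP k. norm (\<Sum>i<k. a i *\<^sub>R y i))"

definition coeffs :: "(nat \<Rightarrow> 'a) \<Rightarrow> nat \<Rightarrow> real" where
  "coeffs v = (\<lambda>i. blinfun_apply (F i) (v i))"

text \<open>\<open>p n\<close> is a gauge of \<open>2\<^sup>n W + 2\<^sup>-\<^sup>n B\<close>, where \<open>B\<close> is the unit ball of the minimal associated norm
  \<open>M\<close> and \<open>W\<close> consists of the coefficient sequences of sequences in the given space of variation at most 1.\<close>

definition p :: "nat \<Rightarrow> (nat \<Rightarrow> real) \<Rightarrow> real" where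
  "p n a = (INF v\<in>fin_seqs. variation v / 2 ^ n + 2 ^ n * M (a - coeffs v))"

text \<open>The supremum over initial segments reduces every estimate to finite sets; it is finite
  because \<open>p n a\<close> decays geometrically for fixed finitely supported
  \<open>a\<close>.\<close>

definition N0 :: "(nat \<Rightarrow> real) \<Rightarrow> real" where
  "N0 a = (SUP m. L2_set (\<lambda>n. p n a) {..<m})"

section \<open>The minimal norm, its gauges and their Euclidean sum\<close>

lemma M_upper:
  assumes "a \<in> fin_seqs"
  shows "norm (\<Sum>i<k. a i *\<^sub>R y i) \<le> M a"
  unfolding M_def
proof (rule cSUP_upper)
  obtain L where L: "\<And>i. i \<ge> L \<Longrightarrow> a i = 0" using assms by (rule fin_seqsE) blast
  have "norm (\<Sum>i<k. a i *\<^sub>R y i) \<le> (\<Sum>i<L. norm (a i *\<^sub>R y i))" for k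
  proof -
    have "norm (\<Sum>i<k. a i *\<^sub>R y i) \<le> (\<Sum>i<k. norm (a i *\<^sub>R y i))" by (rule norm_sum)
    also have "\<dots> \<le> (\<Sum>i<max k L. norm (a i *\<^sub>R y i))" by (intro sum_mono2) auto
    also have "\<dots> = (\<Sum>i<L. norm (a i *\<^sub>R y i))" using L by (intro sum.mono_neutral_right) auto
    finally show ?thesis .
  qed
  then show "bdd_above (range (\<lambda>k. norm (\<Sum>i<k. a i *\<^sub>R y i)))" by (rule bdd_aboveI2)
qed simp

lemma M_least: "(\<And>k. norm (\<Sum>i<k. a i *\<^sub>R y i) \<le> C) \<Longrightarrow> M a \<le> C"
  unfolding M_def by (rule cSUP_least) auto

lemma M_nonneg: "a \<in> fin_seqs \<Longrightarrow> 0 \<le> M a"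
  using M_upper[of a 0] by simp

lemma M_add: "a \<in> fin_seqs \<Longrightarrow> b \<in> fin_seqs \<Longrightarrow> M (a + b) \<le> M a + M b"
proof (rule M_least)
  fix k assume a: "a \<in> fin_seqs" and b: "b \<in> fin_seqs"
  have "(\<Sum>i<k. (a + b) i *\<^sub>R y i) = (\<Sum>i<k. a i *\<^sub>R y i) + (\<Sum>i<k. b i *\<^sub>R y i)"
    by (simp add: scaleR_add_left sum.distrib)
  then show "norm (\<Sum>i<k. (a + b) i *\<^sub>R y i) \<le> M a + M b"
    using norm_triangle_ineq[of "\<Sum>i<k. a i *\<^sub>R y i" "\<Sum>i<k. b i *\<^sub>R y i"] M_upper[OF a, of k] M_upper[OF b, of k] by simp
qed

lemma M_scale: "a \<in> fin_seqs \<Longrightarrow> M (c *\<^sub>R a) = \<bar>c\<bar> * M a"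
proof (rule abs_homogeneousI[OF _ subspace_fin_seqs])
  show "M (c *\<^sub>R a) \<le> \<bar>c\<bar> * M a" if "a \<in> fin_seqs" for c a
  proof (rule M_least)
    have "(\<Sum>i<k. (c *\<^sub>R a) i *\<^sub>R y i) = c *\<^sub>R (\<Sum>i<k. a i *\<^sub>R y i)" for k
      by (simp add: scaleR_fun_def scaleR_sum_right)
    then show "norm (\<Sum>i<k. (c *\<^sub>R a) i *\<^sub>R y i) \<le> \<bar>c\<bar> * M a" for k
      using M_upper[OF that, of k] by (simp add: mult_left_mono)
  qed
qed (auto intro: M_nonneg)

lemma sum_trunc: "(\<Sum>i<l. trunc k a i *\<^sub>R y i) = (\<Sum>i<min k l. a i *\<^sub>R y i)"
  unfolding trunc_def by (rule sum.mono_neutral_cong_right) auto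

lemma M_trunc: "a \<in> fin_seqs \<Longrightarrow> M (trunc k a) \<le> M a"
  by (rule M_least) (simp add: sum_trunc M_upper)

lemma M_diff: "a \<in> fin_seqs \<Longrightarrow> b \<in> fin_seqs \<Longrightarrow> M (a - b) \<le> M a + M b"
  using M_add[OF _ fin_seqs_scale[of b "-1"], of a] M_scale[of b "-1"] by simp

lemma M_zero: "M 0 = 0"
  using M_scale[OF fin_seqs_zero, of 0] by simp

lemma coeffs_add: "coeffs (u + v) = coeffs u + coeffs v"
  and coeffs_scale: "coeffs (c *\<^sub>R v) = c *\<^sub>R coeffs v"
  and coeffs_trunc: "coeffs (trunc k v) = trunc k (coeffs v)"
  by (auto simp: coeffs_def fun_eq_iff blinfun.add_right blinfun.scaleR_right scaleR_fun_def trunc_def)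

lemma coeffs_fin: "v \<in> fin_seqs \<Longrightarrow> coeffs v \<in> fin_seqs"
  unfolding fin_seqs_def coeffs_def by (elim CollectE exE) (auto intro!: exI)

lemma partial_sum_bounded:
  obtains K where "K \<ge> 0" "\<And>n u. norm (\<Sum>i<n. blinfun_apply (F i) u *\<^sub>R y i) \<le> K * norm u"
  using partial_sums_bounded[of "\<lambda>i u. blinfun_apply (F i) u *\<^sub>R y i"] frame_summable
  by (metis bounded_linear_scaleR_const blinfun.bounded_linear_right)

text \<open>The set \<open>W\<close> is bounded for \<open>M\<close>, by Abel summation and uniform
  boundedness of the partial sum operators. Hence \<open>p 0\<close> dominates \<open>M\<close>,
  which later makes the synthesis operator bounded.\<close>

lemma M_coeffs:
  obtains K where "K \<ge> 0" "\<And>v. v \<in> fin_seqs \<Longrightarrow> M (coeffs v) \<le> K * variation v"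
proof -
  obtain K where K: "K \<ge> 0" "\<And>n u. norm (\<Sum>i<n. blinfun_apply (F i) u *\<^sub>R y i) \<le> K * norm u"
    using partial_sum_bounded by blast
  have bl: "bounded_linear (\<lambda>u. blinfun_apply (F i) u *\<^sub>R y i)" for i
    by (intro bounded_linear_scaleR_const blinfun.bounded_linear_right)
  have "M (coeffs v) \<le> K * variation v" if v: "v \<in> fin_seqs" for v
  proof (rule M_least)
    fix k
    let ?A = "\<lambda>j. \<Sum>i=0..j. blinfun_apply (F i) (v j - v (Suc j)) *\<^sub>R y i"
    have "(\<Sum>i<k. coeffs v i *\<^sub>R y i) = (\<Sum>j<k. ?A j) + (\<Sum>i<k. blinfun_apply (F i) (v k) *\<^sub>R y i)"
      using sum_by_parts[of "\<lambda>i u. blinfun_apply (F i) u *\<^sub>R y i" 0 k v, OF bl] by (simp add: coeffs_def atLeast0LessThan)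
    also have "norm \<dots> \<le> norm (\<Sum>j<k. ?A j) + norm (\<Sum>i<k. blinfun_apply (F i) (v k) *\<^sub>R y i)"
      by (rule norm_triangle_ineq)
    also have "norm (\<Sum>j<k. ?A j) \<le> (\<Sum>j<k. K * norm (v j - v (Suc j)))"
      using K(2)[where n = "Suc _"] by (intro sum_norm_le) (simp add: atLeast0AtMost lessThan_Suc_atMost)
    also have "\<dots> = K * (\<Sum>j<k. norm (v j - v (Suc j)))" by (simp add: sum_distrib_left)
    finally have "norm (\<Sum>i<k. coeffs v i *\<^sub>R y i) \<le> K * ((\<Sum>j<k. norm (v j - v (Suc j))) + norm (v k))"
      using K(2)[of "v k" k] by (simp add: distrib_left)
    also have "\<dots> \<le> K * variation v" by (intro mult_left_mono variation_ge v K)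
    finally show "norm (\<Sum>i<k. coeffs v i *\<^sub>R y i) \<le> K * variation v" .
  qed
  with K(1) show thesis by (rule that)
qed

lemma p_term_nonneg:
  "a \<in> fin_seqs \<Longrightarrow> v \<in> fin_seqs \<Longrightarrow> 0 \<le> variation v / 2 ^ n + 2 ^ n * M (a - coeffs v)"
  by (intro add_nonneg_nonneg divide_nonneg_nonneg mult_nonneg_nonneg variation_nonneg M_nonneg fin_seqs_diff coeffs_fin) auto

lemma p_le:
  assumes "a \<in> fin_seqs" "v \<in> fin_seqs"
  shows "p n a \<le> variation v / 2 ^ n + 2 ^ n * M (a - coeffs v)"
  unfolding p_def using assms p_term_nonneg[OF assms(1)] by (intro cINF_lower bdd_belowI2[where m = 0]) auto

lemma p_nonneg: "a \<in> fin_seqs \<Longrightarrow> 0 \<le> p n a"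
  unfolding p_def using fin_seqs_zero p_term_nonneg by (intro cINF_greatest) auto

lemma p_approx:
  assumes a: "a \<in> fin_seqs" and lt: "p n a < c"
  obtains v where "v \<in> fin_seqs" "variation v / 2 ^ n + 2 ^ n * M (a - coeffs v) < c"
proof -
  have "\<exists>v\<in>fin_seqs. variation v / 2 ^ n + 2 ^ n * M (a - coeffs v) < c"
  proof (rule ccontr)
    assume "\<not> ?thesis"
    then have "c \<le> p n a" unfolding p_def using fin_seqs_zero by (intro cINF_greatest) (auto simp: not_less)
    then show False using lt by simp
  qed
  then show thesis using that by blast
qed

lemma p_add:
  assumes a: "a \<in> fin_seqs" and b: "b \<in> fin_seqs"
  shows "p n (a + b) \<le> p n a + p n b"
proof (rule field_le_epsilon)
  fix e :: real assume e: "e > 0"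
  obtain u where u: "u \<in> fin_seqs" "variation u / 2 ^ n + 2 ^ n * M (a - coeffs u) < p n a + e/2"
    using p_approx[OF a, of n "p n a + e/2"] e by auto
  obtain v where v: "v \<in> fin_seqs" "variation v / 2 ^ n + 2 ^ n * M (b - coeffs v) < p n b + e/2"
    using p_approx[OF b, of n "p n b + e/2"] e by auto
  have "p n (a + b) \<le> variation (u + v) / 2 ^ n + 2 ^ n * M ((a + b) - coeffs (u + v))"
    by (intro p_le fin_seqs_add a b u v)
  moreover have eq: "(a + b) - coeffs (u + v) = (a - coeffs u) + (b - coeffs v)" by (simp add: coeffs_add)
  moreover have "2 ^ n * M ((a + b) - coeffs (u + v)) \<le> 2 ^ n * (M (a - coeffs u) + M (b - coeffs v))"
    unfolding eq by (intro mult_left_mono M_add fin_seqs_diff a b coeffs_fin u v) simp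
  moreover have "variation (u + v) / 2 ^ n \<le> (variation u + variation v) / 2 ^ n"
    by (intro divide_right_mono variation_add u v) simp
  ultimately show "p n (a + b) \<le> p n a + p n b + e"
    using u(2) v(2) unfolding add_divide_distrib distrib_left by linarith
qed

lemma p_scale: "a \<in> fin_seqs \<Longrightarrow> p n (c *\<^sub>R a) = \<bar>c\<bar> * p n a"
proof (rule abs_homogeneousI[OF _ subspace_fin_seqs])
  show "p n (c *\<^sub>R a) \<le> \<bar>c\<bar> * p n a" if a: "a \<in> fin_seqs" for c a
  proof (rule field_le_epsilon)
    fix e :: real assume e: "e > 0"
    define d where "d = e / (\<bar>c\<bar> + 1)"
    have d: "d > 0" "\<bar>c\<bar> * d \<le> e" using e by (auto simp: d_def field_simps)
    obtain u where u: "u \<in> fin_seqs" "variation u / 2 ^ n + 2 ^ n * M (a - coeffs u) < p n a + d"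
      using p_approx[OF a, of n "p n a + d"] d by auto
    have "p n (c *\<^sub>R a) \<le> variation (c *\<^sub>R u) / 2 ^ n + 2 ^ n * M (c *\<^sub>R a - coeffs (c *\<^sub>R u))"
      by (intro p_le fin_seqs_scale a u)
    also have "c *\<^sub>R a - coeffs (c *\<^sub>R u) = c *\<^sub>R (a - coeffs u)" by (simp add: coeffs_scale scaleR_diff_right)
    also have "M (c *\<^sub>R (a - coeffs u)) = \<bar>c\<bar> * M (a - coeffs u)"
      by (intro M_scale fin_seqs_diff a coeffs_fin u)
    also have "variation (c *\<^sub>R u) / 2 ^ n + 2 ^ n * (\<bar>c\<bar> * M (a - coeffs u)) =
        \<bar>c\<bar> * (variation u / 2 ^ n + 2 ^ n * M (a - coeffs u))"
      using u by (simp add: variation_scale distrib_left)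
    also have "\<dots> \<le> \<bar>c\<bar> * (p n a + d)" using u(2) by (intro mult_left_mono) auto
    finally show "p n (c *\<^sub>R a) \<le> \<bar>c\<bar> * p n a + e" using d by (simp add: distrib_left)
  qed
qed (auto intro: p_nonneg)

lemma p_trunc:
  assumes a: "a \<in> fin_seqs"
  shows "p n (trunc k a) \<le> p n a"
proof (rule field_le_epsilon)
  fix e :: real assume e: "e > 0"
  obtain u where u: "u \<in> fin_seqs" "variation u / 2 ^ n + 2 ^ n * M (a - coeffs u) < p n a + e"
    using p_approx[OF a, of n "p n a + e"] e by auto
  have "p n (trunc k a) \<le> variation (trunc k u) / 2 ^ n + 2 ^ n * M (trunc k a - coeffs (trunc k u))"
    by (intro p_le trunc_fin)
  moreover have eq: "trunc k a - coeffs (trunc k u) = trunc k (a - coeffs u)" by (simp add: coeffs_trunc trunc_diff)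
  moreover have "2 ^ n * M (trunc k a - coeffs (trunc k u)) \<le> 2 ^ n * M (a - coeffs u)"
    unfolding eq by (intro mult_left_mono M_trunc fin_seqs_diff a coeffs_fin u) simp
  moreover have "variation (trunc k u) / 2 ^ n \<le> variation u / 2 ^ n"
    by (intro divide_right_mono variation_trunc u) simp
  ultimately show "p n (trunc k a) \<le> p n a + e" using u(2) by linarith
qed

lemma p_diff: "a \<in> fin_seqs \<Longrightarrow> b \<in> fin_seqs \<Longrightarrow> p n (a - b) \<le> p n a + p n b"
  using p_add[OF _ fin_seqs_scale[of b "-1"], of a n] p_scale[of b n "-1"] by simp

lemma p_zero: "p n 0 = 0"
  using p_scale[OF fin_seqs_zero, of n 0] by simp

lemma p_le_M: "a \<in> fin_seqs \<Longrightarrow> p n a \<le> 2 ^ n * M a"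
proof -
  assume a: "a \<in> fin_seqs"
  have "coeffs 0 = 0" "variation (0 :: nat \<Rightarrow> 'a) = 0"
    by (auto simp: coeffs_def variation_def fun_eq_iff)
  then show ?thesis using p_le[OF a fin_seqs_zero, of n] by simp
qed

lemma p_coeffs: "v \<in> fin_seqs \<Longrightarrow> p n (coeffs v) \<le> variation v / 2 ^ n"
  using p_le[OF coeffs_fin, of v v n] by (simp add: M_zero)

lemma M_le_p:
  obtains K where "K \<ge> 0" "\<And>a. a \<in> fin_seqs \<Longrightarrow> M a \<le> K * p 0 a"
proof -
  obtain K where K: "K \<ge> 0" "\<And>v. v \<in> fin_seqs \<Longrightarrow> M (coeffs v) \<le> K * variation v" using M_coeffs by blast
  \<comment> \<open>\<open>K\<close> accounts for the part in a multiple of \<open>W\<close>, and 1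
    for the remainder.\<close>
  have "M a \<le> (K + 1) * p 0 a" if a: "a \<in> fin_seqs" for a
  proof (rule field_le_epsilon)
    fix e :: real assume e: "e > 0"
    obtain v where v: "v \<in> fin_seqs" "variation v / 2 ^ 0 + 2 ^ 0 * M (a - coeffs v) < p 0 a + e / (K + 1)"
      using p_approx[OF a, of 0 "p 0 a + e / (K + 1)"] e K(1) by auto
    have "M a \<le> M (coeffs v) + M (a - coeffs v)"
      using M_add[OF coeffs_fin[OF v(1)] fin_seqs_diff[OF a coeffs_fin[OF v(1)]]] by simp
    also have "\<dots> \<le> K * variation v + M (a - coeffs v)" using K(2)[OF v(1)] by simp
    also have "\<dots> \<le> (K + 1) * (variation v + M (a - coeffs v))"
      using K(1) variation_nonneg[OF v(1)] M_nonneg[OF fin_seqs_diff[OF a coeffs_fin[OF v(1)]]] by (simp add: algebra_simps)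
    also have "\<dots> \<le> (K + 1) * (p 0 a + e / (K + 1))" using v(2) K(1) by (intro mult_left_mono) auto
    also have "\<dots> = (K + 1) * p 0 a + e" using K(1) by (simp add: distrib_left)
    finally show "M a \<le> (K + 1) * p 0 a + e" .
  qed
  then show thesis using K(1) by (intro that[of "K + 1"]) auto
qed

text \<open>Since no \<open>F i\<close> vanishes, \<open>a\<close> is the coefficient sequence of a
  finitely supported sequence of vectors. That decomposition has no remainder in \<open>M\<close>,
  and only its variation with the weight \<open>1 / 2 ^ n\<close> is left.\<close>

lemma p_decay:
  assumes "a \<in> fin_seqs"
  obtains c where "c \<ge> 0" "\<And>n. p n a \<le> c / 2 ^ n"
proof -
  have "\<exists>w. blinfun_apply (F i) w = 1" for i
  proof -
    obtain u where "blinfun_apply (F i) u \<noteq> 0" using F_nonzero[of i] by (metis blinfun_eqI blinfun.zero_left)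
    then have "blinfun_apply (F i) ((1 / blinfun_apply (F i) u) *\<^sub>R u) = 1" by (simp add: blinfun.scaleR_right)
    then show ?thesis by blast
  qed
  then obtain w where w: "\<And>i. blinfun_apply (F i) (w i) = 1" by metis
  define v where "v i = a i *\<^sub>R w i" for i
  have v: "v \<in> fin_seqs" using assms unfolding fin_seqs_def by (auto simp: v_def)
  have "coeffs v = a" by (simp add: coeffs_def v_def blinfun.scaleR_right w)
  then show thesis using p_coeffs[OF v] variation_nonneg[OF v] that by simp
qed

lemma L2_p_le_sum: "a \<in> fin_seqs \<Longrightarrow> L2_set (\<lambda>n. p n a) A \<le> (\<Sum>n\<in>A. p n a)"
  by (intro L2_set_le_sum p_nonneg)

lemma N0_upper:
  assumes a: "a \<in> fin_seqs"
  shows "L2_set (\<lambda>n. p n a) {..<m} \<le> N0 a"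
  unfolding N0_def
proof (rule cSUP_upper)
  obtain c where c: "c \<ge> 0" "\<And>n. p n a \<le> c / 2 ^ n" using p_decay[OF a] by blast
  have "L2_set (\<lambda>n. p n a) {..<m} \<le> 2 * c" for m
  proof -
    have "L2_set (\<lambda>n. p n a) {..<m} \<le> (\<Sum>n=0..<m. c / 2 ^ n)"
      using L2_p_le_sum[OF a, of "{..<m}"] sum_mono[of "{..<m}" "\<lambda>n. p n a" "\<lambda>n. c / 2 ^ n"] c(2) by (simp add: atLeast0LessThan)
    then show ?thesis using sum_geometric_tail[OF c(1), of 0 m] by simp
  qed
  then show "bdd_above (range (\<lambda>m. L2_set (\<lambda>n. p n a) {..<m}))" by (rule bdd_aboveI2)
qed simp

lemma N0_least: "(\<And>m. L2_set (\<lambda>n. p n a) {..<m} \<le> C) \<Longrightarrow> N0 a \<le> C"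
  unfolding N0_def by (rule cSUP_least) auto

lemma p_le_N0: "a \<in> fin_seqs \<Longrightarrow> p n a \<le> N0 a"
  using member_le_L2_set[of "{..<Suc n}" n "\<lambda>n. p n a"] N0_upper[of a "Suc n"] by simp

lemma seq_norm_N0: "seq_norm N0"
proof
  fix a :: "nat \<Rightarrow> real" assume a: "a \<in> fin_seqs"
  show nn: "0 \<le> N0 a" using p_nonneg[OF a, of 0] p_le_N0[OF a, of 0] by simp
  show "a = 0" if "N0 a = 0"
  proof -
    have "p 0 a = 0" using p_nonneg[OF a, of 0] p_le_N0[OF a, of 0] that by simp
    moreover obtain K where "M a \<le> K * p 0 a" using M_le_p a by blast
    ultimately have "M a = 0" using M_nonneg[OF a] by simp
    then have s: "(\<Sum>i<k. a i *\<^sub>R y i) = 0" for k using M_upper[OF a, of k] by simp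
    have "a i *\<^sub>R y i = 0" for i using s[of "Suc i"] s[of i] by simp
    then show "a = 0" using y_nonzero by (simp add: fun_eq_iff)
  qed
  show "N0 (trunc k a) \<le> N0 a" for k
    by (rule N0_least) (rule order_trans[OF L2_set_mono N0_upper[OF a]], auto intro: p_trunc a p_nonneg)
  show "N0 (c *\<^sub>R a) = \<bar>c\<bar> * N0 a" for c
  proof (rule abs_homogeneousI[OF _ subspace_fin_seqs _ a])
    show "N0 (c *\<^sub>R a) \<le> \<bar>c\<bar> * N0 a" if a: "a \<in> fin_seqs" for c a
    proof (rule N0_least)
      show "L2_set (\<lambda>n. p n (c *\<^sub>R a)) {..<m} \<le> \<bar>c\<bar> * N0 a" for m
        using N0_upper[OF a, of m] by (simp add: p_scale[OF a] L2_set_right_distrib[symmetric] mult_left_mono)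
    qed
    show "0 \<le> N0 a" if "a \<in> fin_seqs" for a
      using p_nonneg[OF that, of 0] p_le_N0[OF that, of 0] by simp
  qed
  fix b :: "nat \<Rightarrow> real" assume b: "b \<in> fin_seqs"
  show "N0 (a + b) \<le> N0 a + N0 b"
  proof (rule N0_least)
    fix m
    have "L2_set (\<lambda>n. p n (a + b)) {..<m} \<le> L2_set (\<lambda>n. p n a + p n b) {..<m}"
      by (intro L2_set_mono p_add a b p_nonneg fin_seqs_add)
    also have "\<dots> \<le> L2_set (\<lambda>n. p n a) {..<m} + L2_set (\<lambda>n. p n b) {..<m}" by (rule L2_set_triangle_ineq)
    also have "\<dots> \<le> N0 a + N0 b" by (intro add_mono N0_upper a b)
    finally show "L2_set (\<lambda>n. p n (a + b)) {..<m} \<le> N0 a + N0 b" .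
  qed
qed

end

sublocale interpolation \<subseteq> Z: seq_norm N0
  by (rule seq_norm_N0)

context interpolation
begin

lemma sum_block: "k \<le> l \<Longrightarrow> (\<Sum>i<r. (trunc l a - trunc k a) i *\<^sub>R y i) = (\<Sum>i=k..<min l r. a i *\<^sub>R y i)"
proof -
  assume kl: "k \<le> l"
  have "(\<Sum>i<r. (trunc l a - trunc k a) i *\<^sub>R y i) = (\<Sum>i<min l r. a i *\<^sub>R y i) - (\<Sum>i<min k r. a i *\<^sub>R y i)"
    by (simp add: scaleR_diff_left sum_subtractf sum_trunc)
  also have "\<dots> = (\<Sum>i=k..<min l r. a i *\<^sub>R y i)"
    using sum.atLeastLessThan_concat[of 0 k "min l r" "\<lambda>i. a i *\<^sub>R y i"] kl
    by (cases "k \<le> r") (auto simp: atLeast0LessThan algebra_simps min_def)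
  finally show ?thesis .
qed

text \<open>Each of finitely many gauges is at most a multiple of \<open>M\<close>, which is small
  on far blocks by convergence of the series. The remaining gauges have to be controlled uniformly
  over all blocks, and \<open>tails\<close> does this.\<close>

lemma V_criterion:
  assumes sm: "summable (\<lambda>i. a i *\<^sub>R y i)"
    and tails: "\<And>e. e > 0 \<Longrightarrow> \<exists>m. \<forall>k l m'. L2_set (\<lambda>n. p n (trunc l a - trunc k a)) {m..<m'} \<le> e"
  shows "a \<in> Z.V"
  unfolding Z.V_def
proof (intro CollectI allI impI)
  fix e :: real assume e: "e > 0"
  obtain m where m: "\<And>k l m'. L2_set (\<lambda>n. p n (trunc l a - trunc k a)) {m..<m'} \<le> e/4" using tails[of "e/4"] e by auto
  \<comment> \<open>Since \<open>p n \<le> 2 ^ n * M\<close> and the powers of 2 below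
    \<open>2 ^ m\<close> sum to less than \<open>2 ^ m\<close>, the bound \<open>M \<le> d\<close>
    costs at most \<open>e/4\<close> in total.\<close>
  define d where "d = e / (4 * 2 ^ m)"
  have d: "d > 0" using e by (simp add: d_def)
  obtain K where K: "\<And>k l. k \<ge> K \<Longrightarrow> norm (\<Sum>i=k..<l. a i *\<^sub>R y i) < d" using sm d unfolding summable_Cauchy by blast
  have "N0 (trunc l a - trunc k a) < e" if k: "k \<ge> K" "l \<ge> k" for k l
  proof -
    let ?b = "trunc l a - trunc k a"
    have b: "?b \<in> fin_seqs" by (intro fin_seqs_diff trunc_fin)
    have Mb: "M ?b \<le> d"
    proof (rule M_least)
      show "norm (\<Sum>i<r. ?b i *\<^sub>R y i) \<le> d" for r
        unfolding sum_block[OF k(2)] using K[OF k(1), of "min l r"] by simp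
    qed
    have "N0 ?b \<le> e/2"
    proof (rule N0_least)
      fix m'
      have "L2_set (\<lambda>n. p n ?b) {..<m'} \<le> L2_set (\<lambda>n. p n ?b) ({..<m} \<union> {m..<m'})"
        by (intro L2_set_mono2) auto
      also have "\<dots> \<le> L2_set (\<lambda>n. p n ?b) {..<m} + L2_set (\<lambda>n. p n ?b) {m..<m'}"
        unfolding L2_set_def by (subst sum.union_disjoint) (auto intro!: sqrt_add_le_add_sqrt sum_nonneg)
      also have "L2_set (\<lambda>n. p n ?b) {..<m} \<le> (\<Sum>n<m. p n ?b)" by (rule L2_p_le_sum[OF b])
      also have "\<dots> \<le> (\<Sum>n<m. 2 ^ n * d)"
      proof (rule sum_mono)
        show "p n ?b \<le> 2 ^ n * d" for n
          using order_trans[OF p_le_M[OF b] mult_left_mono[OF Mb]] by simp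
      qed
      also have "\<dots> \<le> 2 ^ m * d"
      proof -
        have "(\<Sum>n<m. 2 ^ n :: real) \<le> 2 ^ m" by (induction m) simp_all
        then show ?thesis using d by (simp add: sum_distrib_right[symmetric])
      qed
      also have "\<dots> = e/4" by (simp add: d_def)
      finally show "L2_set (\<lambda>n. p n ?b) {..<m'} \<le> e/2" using m[of l k m'] by linarith
    qed
    then show ?thesis using e by simp
  qed
  then show "\<exists>K. \<forall>k\<ge>K. \<forall>l\<ge>k. N0 (trunc l a - trunc k a) < e" by blast
qed

lemma p_trunc_const: "p n (trunc k (\<lambda>i. blinfun_apply (F i) u)) \<le> norm u / 2 ^ n"
proof -
  have "trunc k (\<lambda>i. blinfun_apply (F i) u) = coeffs (trunc k (\<lambda>_. u))" by (simp add: coeffs_trunc) (simp add: coeffs_def)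
  then have "p n (trunc k (\<lambda>i. blinfun_apply (F i) u)) \<le> variation (trunc k (\<lambda>_. u)) / 2 ^ n"
    using p_coeffs[OF trunc_fin] by simp
  also have "\<dots> \<le> norm u / 2 ^ n" by (intro divide_right_mono variation_trunc_const) simp
  finally show ?thesis .
qed

lemma coefficient_seq_in_V: "(\<lambda>i. blinfun_apply (F i) u) \<in> Z.V"
proof (rule V_criterion[OF frame_summable])
  fix e :: real assume e: "e > 0"
  \<comment> \<open>The factor 4 is 2 for the two truncations times 2 for the geometric
    series.\<close>
  have "(\<lambda>m. 4 * norm u * (1/2) ^ m) \<longlonglongrightarrow> 0" by (intro tendsto_mult_right_zero LIMSEQ_power_zero) simp
  then have "\<forall>\<^sub>F m in sequentially. 4 * norm u * (1/2) ^ m < e" using e by (rule order_tendstoD(2))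
  then obtain m where m: "4 * norm u * (1/2) ^ m < e" by (auto simp: eventually_sequentially)
  let ?a = "\<lambda>i. blinfun_apply (F i) u"
  have "L2_set (\<lambda>n. p n (trunc l ?a - trunc k ?a)) {m..<m'} \<le> e" for k l m'
  proof -
    have "L2_set (\<lambda>n. p n (trunc l ?a - trunc k ?a)) {m..<m'} \<le> (\<Sum>n=m..<m'. p n (trunc l ?a - trunc k ?a))"
      by (intro L2_p_le_sum fin_seqs_diff trunc_fin)
    also have "\<dots> \<le> (\<Sum>n=m..<m'. (2 * norm u) / 2 ^ n)"
    proof (rule sum_mono)
      show "p n (trunc l ?a - trunc k ?a) \<le> (2 * norm u) / 2 ^ n" for n
        using p_diff[OF trunc_fin[of l ?a] trunc_fin[of k ?a], of n] p_trunc_const[of n l u] p_trunc_const[of n k u] by simp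
    qed
    also have "\<dots> \<le> 2 * (2 * norm u) / 2 ^ m" by (rule sum_geometric_tail) simp
    also have "\<dots> \<le> e" using m by (simp add: power_one_over)
    finally show ?thesis .
  qed
  then show "\<exists>m. \<forall>k l m'. L2_set (\<lambda>n. p n (trunc l ?a - trunc k ?a)) {m..<m'} \<le> e" by blast
qed

lemma N_coefficient_seq: "Z.N (\<lambda>i. blinfun_apply (F i) u) \<le> 2 * norm u"
proof (intro Z.N_least N0_least)
  fix k m
  let ?a = "trunc k (\<lambda>i. blinfun_apply (F i) u)"
  have "L2_set (\<lambda>n. p n ?a) {..<m} \<le> (\<Sum>n<m. p n ?a)" by (intro L2_p_le_sum trunc_fin)
  also have "\<dots> \<le> (\<Sum>n=0..<m. norm u / 2 ^ n)" unfolding atLeast0LessThan by (intro sum_mono p_trunc_const)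
  also have "\<dots> \<le> 2 * norm u" using sum_geometric_tail[of "norm u" 0 m] by simp
  finally show "L2_set (\<lambda>n. p n ?a) {..<m} \<le> 2 * norm u" .
qed

text \<open>The gauge \<open>p 0\<close> alone already dominates \<open>M\<close>, hence the norms
  of all partial sums.\<close>

lemma synthesis:
  obtains D where "\<And>a. a \<in> Z.V \<Longrightarrow> summable (\<lambda>i. a i *\<^sub>R y i)"
    "\<And>a. a \<in> Z.V \<Longrightarrow> norm (\<Sum>i. a i *\<^sub>R y i) \<le> D * Z.N a"
proof -
  obtain K where K: "K \<ge> 0" "\<And>a. a \<in> fin_seqs \<Longrightarrow> M a \<le> K * p 0 a" using M_le_p by blast
  have MN: "M a \<le> K * N0 a" if "a \<in> fin_seqs" for a
    using order_trans[OF K(2)[OF that] mult_left_mono[OF p_le_N0[OF that] K(1)]] .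
  have sm: "summable (\<lambda>i. a i *\<^sub>R y i)" if a: "a \<in> Z.V" for a
    unfolding summable_Cauchy
  proof (intro allI impI)
    fix e :: real assume e: "e > 0"
    then have "e / (K + 1) > 0" using K(1) by simp
    then obtain k0 where k0: "\<And>k l. k \<ge> k0 \<Longrightarrow> l \<ge> k \<Longrightarrow> N0 (trunc l a - trunc k a) < e / (K + 1)"
      using a unfolding Z.V_def by blast
    have "norm (\<Sum>i=k..<l. a i *\<^sub>R y i) < e" if k: "k \<ge> k0" for k l
    proof (cases "k \<le> l")
      case True
      let ?b = "trunc l a - trunc k a"
      have b: "?b \<in> fin_seqs" by (intro fin_seqs_diff trunc_fin)
      have "norm (\<Sum>i=k..<l. a i *\<^sub>R y i) \<le> M ?b"
        using M_upper[OF b, of l] unfolding sum_block[OF True] by simp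
      also have "\<dots> \<le> K * N0 ?b" by (rule MN[OF b])
      also have "\<dots> \<le> (K + 1) * N0 ?b" using Z.N0_nonneg[OF b] by (simp add: algebra_simps)
      also have "\<dots> < (K + 1) * (e / (K + 1))" using K(1) by (intro mult_strict_left_mono k0 k True) simp
      finally show ?thesis using K(1) by simp
    qed (use e in simp)
    then show "\<exists>N. \<forall>m\<ge>N. \<forall>n. norm (\<Sum>i=m..<n. a i *\<^sub>R y i) < e" by blast
  qed
  have "norm (\<Sum>i. a i *\<^sub>R y i) \<le> K * Z.N a" if a: "a \<in> Z.V" for a
  proof (rule LIMSEQ_le_const2[OF tendsto_norm[OF summable_LIMSEQ[OF sm[OF a]]]])
    have "norm (\<Sum>i<k. a i *\<^sub>R y i) \<le> K * Z.N a" for k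
    proof -
      have "norm (\<Sum>i<k. a i *\<^sub>R y i) \<le> M (trunc k a)" using M_upper[OF trunc_fin[of k a], of k] by (simp add: sum_trunc)
      also have "\<dots> \<le> K * N0 (trunc k a)" by (rule MN[OF trunc_fin])
      also have "\<dots> \<le> K * Z.N a" by (intro mult_left_mono Z.N_upper a K)
      finally show ?thesis .
    qed
    then show "\<exists>N. \<forall>n\<ge>N. norm (\<Sum>i<n. a i *\<^sub>R y i) \<le> K * Z.N a" by blast
  qed
  with sm show thesis by (rule that)
qed

end

subsection \<open>Bounded completeness\<close>

text \<open>Almost norming vectors are chosen separately for each \<open>i\<close>, with total error
  \<open>e\<close>. A bound on a sum of norms thus reduces to linear expressions, through which a
  generalised limit or an extended functional can be pulled.\<close>

lemma sum_norm_blinfun_le: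
  fixes w :: "nat \<Rightarrow> 'a::real_normed_vector \<Rightarrow>\<^sub>L real"
  assumes "\<And>g. (\<And>i. norm (g i) \<le> 1) \<Longrightarrow> (\<Sum>i<j. blinfun_apply (w i) (g i)) \<le> D"
  shows "(\<Sum>i<j. norm (w i)) \<le> D"
proof (rule field_le_epsilon)
  fix e :: real assume e: "e > 0"
  define d where "d = e / (real j + 1)"
  have d: "d > 0" "real j * d \<le> e" using e by (auto simp: d_def field_simps)
  have "\<exists>u. norm u \<le> 1 \<and> norm (w i) - d \<le> blinfun_apply (w i) u" for i
    using norm_blinfun_approx[of "norm (w i) - d" "w i"] d(1) by auto
  then obtain g where g: "\<And>i. norm (g i) \<le> 1" "\<And>i. norm (w i) - d \<le> blinfun_apply (w i) (g i)" by metis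
  have "(\<Sum>i<j. norm (w i) - d) \<le> (\<Sum>i<j. blinfun_apply (w i) (g i))" by (intro sum_mono g)
  also have "\<dots> \<le> D" by (intro assms g)
  finally show "(\<Sum>i<j. norm (w i)) \<le> D + e" using d(2) by (simp add: sum_subtractf)
qed

lemma summable_norm_blinfun_diff:
  fixes \<psi> :: "nat \<Rightarrow> 'a::real_normed_vector \<Rightarrow>\<^sub>L real"
  assumes "\<And>g j. (\<And>i. norm (g i) \<le> 1) \<Longrightarrow> (\<Sum>i<j. blinfun_apply (\<psi> i) (g i) - blinfun_apply (\<psi> (Suc i)) (g i)) \<le> D"
  shows "summable (\<lambda>i. norm (\<psi> i - \<psi> (Suc i)))"
proof (rule bounded_imp_summable)
  show "(\<Sum>i\<le>j. norm (\<psi> i - \<psi> (Suc i))) \<le> D" for j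
    unfolding lessThan_Suc_atMost[symmetric]
    by (rule sum_norm_blinfun_le) (simp only: blinfun.diff_left assms)
qed simp

context interpolation
begin

text \<open>A generalised limit of the sequences \<open>v k\<close> exists only in the bidual; this is where bounded
  completeness of the frame enters.\<close>

lemma approximate_decomposition:
  assumes bc: "\<And>\<phi> :: ('a \<Rightarrow>\<^sub>L real) \<Rightarrow>\<^sub>L real. summable (\<lambda>i. blinfun_apply \<phi> (F i) *\<^sub>R y i)"
    and v: "\<And>k. v k \<in> fin_seqs" "\<And>k. variation (v k) \<le> D"
    and close: "\<And>k. M (trunc k a - coeffs (v k)) \<le> e"
  shows "\<exists>b. summable (\<lambda>i. b i *\<^sub>R y i) \<and> (\<forall>j. norm (\<Sum>i<j. (a i - b i) *\<^sub>R y i) \<le> e)"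
proof -
  obtain L :: "(nat \<Rightarrow> real) \<Rightarrow> real" where L: "linear L"
    "\<And>s c. (\<And>k. s k \<le> c) \<Longrightarrow> bdd_below (range s) \<Longrightarrow> L s \<le> c"
    "\<And>s c K. (\<And>k. k \<ge> K \<Longrightarrow> s k = c) \<Longrightarrow> L s = c" using generalised_limit by blast
  have L_add: "L (\<lambda>k. s k + t k) = L s + L t" for s t using linear_add[OF L(1), of s t] by (simp add: plus_fun_def)
  have L_scale: "L (\<lambda>k. c * s k) = c * L s" for c s using linear_scale[OF L(1), of c s] by (simp add: scaleR_fun_def)
  have L_neg: "L (\<lambda>k. - s k) = - L s" for s using L_scale[of "-1" s] by simp
  have L_diff: "L (\<lambda>k. s k - t k) = L s - L t" for s t using L_add[of s "\<lambda>k. - t k"] by (simp add: L_neg)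
  have L_sum: "L (\<lambda>k. \<Sum>i<j. s i k) = (\<Sum>i<j. L (s i))" for s and j :: nat
  proof (induction j)
    case 0 show ?case using L_scale[of 0 "\<lambda>_. 0"] by simp
  next
    case (Suc j) then show ?case by (simp add: L_add)
  qed
  have Lb: "L s \<le> B" if "\<And>k. \<bar>s k\<bar> \<le> B" for s B
    using that by (intro L(2) bdd_belowI2[where m = "-B"]) (auto simp: abs_le_iff minus_le_iff)
  have Lb_abs: "\<bar>L s\<bar> \<le> B" if "\<And>k. \<bar>s k\<bar> \<le> B" for s B
    using Lb[of s B] Lb[of "\<lambda>k. - s k" B] that by (simp add: L_neg abs_le_iff)
  have vk: "norm (v k i) \<le> D" for k i
    using variation_ge[OF v(1), of k i] v(2)[of k] sum_nonneg[of "{..<i}" "\<lambda>j. norm (v k j - v k (Suc j))"] by simp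
  have gv: "\<bar>blinfun_apply g (v k i)\<bar> \<le> norm g * D" for g :: "'a \<Rightarrow>\<^sub>L real" and k i
    using norm_blinfun[of g "v k i"] mult_left_mono[OF vk[of k i] norm_ge_zero[of g]] by simp
  have bl: "bounded_linear (\<lambda>g :: 'a \<Rightarrow>\<^sub>L real. L (\<lambda>k. blinfun_apply g (v k i)))" for i
  proof (rule bounded_linear_intro[where K = D])
    show "norm (L (\<lambda>k. blinfun_apply g (v k i))) \<le> norm g * D" for g :: "'a \<Rightarrow>\<^sub>L real"
      using Lb_abs[OF gv] by simp
  qed (simp_all add: blinfun.add_left blinfun.scaleR_left L_add L_scale)
  \<comment> \<open>The weak-star generalised limit of the entries \<open>v k i\<close>, an element
    of the bidual.\<close>
  define \<psi> where "\<psi> i = Blinfun (\<lambda>g :: 'a \<Rightarrow>\<^sub>L real. L (\<lambda>k. blinfun_apply g (v k i)))" for i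
  have \<psi>: "blinfun_apply (\<psi> i) g = L (\<lambda>k. blinfun_apply g (v k i))" for i g
    by (simp add: \<psi>_def bounded_linear_Blinfun_apply[OF bl])
  \<comment> \<open>Bounded variation survives the limit: after testing with functionals in the unit
    ball, \<open>L\<close> is applied to sums that are bounded by the variation of
    \<open>v k\<close>.\<close>
  have "summable (\<lambda>i. norm (\<psi> i - \<psi> (Suc i)))"
  proof (rule summable_norm_blinfun_diff)
    fix g :: "nat \<Rightarrow> 'a \<Rightarrow>\<^sub>L real" and j
    assume g: "\<And>i. norm (g i) \<le> 1"
    have "(\<Sum>i<j. blinfun_apply (\<psi> i) (g i) - blinfun_apply (\<psi> (Suc i)) (g i)) =
        L (\<lambda>k. \<Sum>i<j. blinfun_apply (g i) (v k i - v k (Suc i)))"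
      by (simp add: L_sum \<psi> L_diff blinfun.diff_right)
    also have "\<dots> \<le> D"
    proof (rule Lb)
      fix k
      have "\<bar>\<Sum>i<j. blinfun_apply (g i) (v k i - v k (Suc i))\<bar> \<le> (\<Sum>i<j. norm (v k i - v k (Suc i)))"
      proof (rule order_trans[OF sum_abs sum_mono])
        fix i
        show "\<bar>blinfun_apply (g i) (v k i - v k (Suc i))\<bar> \<le> norm (v k i - v k (Suc i))"
          using norm_blinfun[of "g i" "v k i - v k (Suc i)"] mult_right_mono[OF g, of "norm (v k i - v k (Suc i))" i] by simp
      qed
      also have "\<dots> \<le> D" using variation_ge[OF v(1), of k j] v(2)[of k] norm_ge_zero[of "v k j"] by linarith
      finally show "\<bar>\<Sum>i<j. blinfun_apply (g i) (v k i - v k (Suc i))\<bar> \<le> D" .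
    qed
    finally show "(\<Sum>i<j. blinfun_apply (\<psi> i) (g i) - blinfun_apply (\<psi> (Suc i)) (g i)) \<le> D" .
  qed
  then have sm: "summable (\<lambda>i. blinfun_apply (\<psi> i) (F i) *\<^sub>R y i)"
    by (rule summable_bounded_variation[where B = "\<lambda>i \<phi>. blinfun_apply \<phi> (F i) *\<^sub>R y i" and v = \<psi>, rotated 2])
      (intro bounded_linear_scaleR_const blinfun.bounded_linear_left bc)+
  have "norm (\<Sum>i<j. (a i - blinfun_apply (\<psi> i) (F i)) *\<^sub>R y i) \<le> e" for j
  proof -
    let ?u = "\<Sum>i<j. (a i - blinfun_apply (\<psi> i) (F i)) *\<^sub>R y i"
    obtain g :: "'a \<Rightarrow>\<^sub>L real" where g: "norm g \<le> 1" "blinfun_apply g ?u = norm ?u" by (rule norming_functional)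
    \<comment> \<open>Entry \<open>i\<close> of \<open>trunc k a\<close> is constant for
      \<open>k > i\<close>, so \<open>L\<close> recovers \<open>a\<close> itself and the comparison
      can take place before the limit.\<close>
    have a: "a i = L (\<lambda>k. trunc k a i)" for i
      using L(3)[of "Suc i" "\<lambda>k. trunc k a i" "a i"] by (simp add: trunc_def)
    have "norm ?u = (\<Sum>i<j. (L (\<lambda>k. trunc k a i) - L (\<lambda>k. blinfun_apply (F i) (v k i))) * blinfun_apply g (y i))"
      unfolding g(2)[symmetric] by (simp add: blinfun.sum_right blinfun.scaleR_right \<psi> a[symmetric])
    also have "\<dots> = L (\<lambda>k. \<Sum>i<j. blinfun_apply g (y i) * (trunc k a i - blinfun_apply (F i) (v k i)))"
      unfolding L_sum L_scale L_diff by (simp add: mult.commute)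
    also have "\<dots> \<le> e"
    proof (rule Lb)
      fix k
      let ?w = "\<Sum>i<j. (trunc k a - coeffs (v k)) i *\<^sub>R y i"
      have "(\<Sum>i<j. blinfun_apply g (y i) * (trunc k a i - blinfun_apply (F i) (v k i))) = blinfun_apply g ?w"
        by (simp add: blinfun.sum_right blinfun.scaleR_right coeffs_def mult.commute)
      moreover have "\<bar>blinfun_apply g ?w\<bar> \<le> norm ?w"
        using norm_blinfun[of g ?w] mult_right_mono[OF g(1) norm_ge_zero[of ?w]] by simp
      moreover have "norm ?w \<le> e"
        using order_trans[OF M_upper[OF fin_seqs_diff[OF trunc_fin coeffs_fin[OF v(1)]]] close] .
      ultimately show "\<bar>\<Sum>i<j. blinfun_apply g (y i) * (trunc k a i - blinfun_apply (F i) (v k i))\<bar> \<le> e" by simp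
    qed
    finally show ?thesis .
  qed
  with sm show ?thesis by (intro exI[of _ "\<lambda>i. blinfun_apply (\<psi> i) (F i)"]) simp
qed

text \<open>The two conditions of \<open>V_criterion\<close> hold for different reasons. A single
  gauge of large index places all truncations in a fixed multiple of \<open>W\<close> up to a small
  error in \<open>M\<close>, and a limit of these decompositions gives a convergent series by
  bounded completeness. The gauges of high index are uniformly small because their suprema over all
  truncations are square summable.\<close>

lemma boundedly_complete_V:
  assumes bc: "\<And>\<phi> :: ('a \<Rightarrow>\<^sub>L real) \<Rightarrow>\<^sub>L real. summable (\<lambda>i. blinfun_apply \<phi> (F i) *\<^sub>R y i)"
    and bdd: "\<And>k. N0 (trunc k a) \<le> B"
  shows "a \<in> Z.V"
proof (rule V_criterion)
  have pB: "p n (trunc k a) \<le> B" for n k using order_trans[OF p_le_N0[OF trunc_fin] bdd] .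
  have B0: "B \<ge> 0" using order_trans[OF p_nonneg[OF trunc_fin] pB] .
  show "summable (\<lambda>i. a i *\<^sub>R y i)"
    unfolding summable_Cauchy
  proof (intro allI impI)
    fix e :: real assume e: "e > 0"
    have "(\<lambda>n. (B + 1) * (1/2) ^ n) \<longlonglongrightarrow> 0" by (intro tendsto_mult_right_zero LIMSEQ_power_zero) simp
    then have "\<forall>\<^sub>F n in sequentially. (B + 1) * (1/2) ^ n < e/4" using e by (intro order_tendstoD(2)) auto
    \<comment> \<open>A bound \<open>B + 1\<close> on the gauge \<open>p n\<close> permits variation
      up to \<open>2 ^ n * (B + 1)\<close>, which may be large, but leaves an error in
      \<open>M\<close> of at most \<open>(B + 1) / 2 ^ n\<close>.\<close>
    then obtain n where n: "(B + 1) * (1/2) ^ n < e/4" by (auto simp: eventually_sequentially)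
    have "\<exists>v. v \<in> fin_seqs \<and> variation v \<le> 2 ^ n * (B + 1) \<and> M (trunc k a - coeffs v) \<le> e/4" for k
    proof -
      have "p n (trunc k a) < B + 1" using pB[of n k] by simp
      then obtain v where v: "v \<in> fin_seqs" "variation v / 2 ^ n + 2 ^ n * M (trunc k a - coeffs v) < B + 1"
        using p_approx[OF trunc_fin] by blast
      have "variation v / 2 ^ n \<ge> 0" "2 ^ n * M (trunc k a - coeffs v) \<ge> 0"
        using variation_nonneg[OF v(1)] M_nonneg[OF fin_seqs_diff[OF trunc_fin coeffs_fin[OF v(1)]]] by auto
      then have 1: "variation v / 2 ^ n \<le> B + 1" and 2: "2 ^ n * M (trunc k a - coeffs v) \<le> B + 1" using v(2) by linarith+
      from 1 have "variation v \<le> 2 ^ n * (B + 1)" by (simp add: field_simps)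
      moreover from 2 have "M (trunc k a - coeffs v) \<le> (B + 1) * (1/2) ^ n" by (simp add: field_simps)
      then have "M (trunc k a - coeffs v) \<le> e/4" using n by linarith
      ultimately show ?thesis using v(1) by blast
    qed
    then obtain v where "\<And>k. v k \<in> fin_seqs" "\<And>k. variation (v k) \<le> 2 ^ n * (B + 1)" "\<And>k. M (trunc k a - coeffs (v k)) \<le> e/4"
      by metis
    \<comment> \<open>The series of \<open>b\<close> converges and initial sums of the two series
      differ by at most \<open>e/4\<close>, so a far block of the series of \<open>a\<close> stays
      below \<open>3 e / 4\<close>.\<close>
    from approximate_decomposition[OF bc this] obtain b where sm: "summable (\<lambda>i. b i *\<^sub>R y i)"
      and b: "\<And>j. norm (\<Sum>i<j. (a i - b i) *\<^sub>R y i) \<le> e/4" by blast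
    have "e/4 > 0" using e by simp
    then obtain k0 where k0: "\<And>k l. k \<ge> k0 \<Longrightarrow> norm (\<Sum>i=k..<l. b i *\<^sub>R y i) < e/4"
      using sm unfolding summable_Cauchy by blast
    have "norm (\<Sum>i=k..<l. a i *\<^sub>R y i) < e" if k: "k \<ge> k0" for k l
    proof (cases "k \<le> l")
      case True
      let ?d = "\<lambda>j. \<Sum>i<j. (a i - b i) *\<^sub>R y i"
      have "(\<Sum>i=k..<l. a i *\<^sub>R y i) = (\<Sum>i=k..<l. b i *\<^sub>R y i) + (\<Sum>i=k..<l. (a i - b i) *\<^sub>R y i)"
        by (simp add: sum.distrib[symmetric] scaleR_diff_left)
      also have "(\<Sum>i=k..<l. (a i - b i) *\<^sub>R y i) = ?d l - ?d k"
        using sum.atLeastLessThan_concat[of 0 k l "\<lambda>i. (a i - b i) *\<^sub>R y i"] True by (simp add: atLeast0LessThan algebra_simps)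
      finally have eq: "(\<Sum>i=k..<l. a i *\<^sub>R y i) = (\<Sum>i=k..<l. b i *\<^sub>R y i) + (?d l - ?d k)" .
      have "norm (\<Sum>i=k..<l. a i *\<^sub>R y i) \<le> norm (\<Sum>i=k..<l. b i *\<^sub>R y i) + (norm (?d l) + norm (?d k))"
        unfolding eq
        using norm_triangle_ineq[of "\<Sum>i=k..<l. b i *\<^sub>R y i" "?d l - ?d k"] norm_triangle_ineq4[of "?d l" "?d k"] by linarith
      then show ?thesis using k0[OF k, of l] b[of l] b[of k] e by linarith
    qed (use e in simp)
    then show "\<exists>N. \<forall>m\<ge>N. \<forall>n. norm (\<Sum>i=m..<n. a i *\<^sub>R y i) < e" by blast
  qed
  fix e :: real assume e: "e > 0"
  \<comment> \<open>By monotonicity under truncation the supremum is a limit, so that bounds on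
    finite sums of squares pass to it.\<close>
  define c where "c n = (SUP k. p n (trunc k a))" for n
  have bddc: "bdd_above (range (\<lambda>k. p n (trunc k a)))" for n using pB by (intro bdd_aboveI2) auto
  have c_upper: "p n (trunc k a) \<le> c n" for n k unfolding c_def by (intro cSUP_upper bddc) simp
  have c0: "c n \<ge> 0" for n using order_trans[OF p_nonneg[OF trunc_fin] c_upper] .
  have lim: "(\<lambda>k. p n (trunc k a)) \<longlonglongrightarrow> c n" for n
    unfolding c_def
  proof (rule LIMSEQ_incseq_SUP[OF bddc])
    show "incseq (\<lambda>k. p n (trunc k a))"
    proof (rule incseq_SucI)
      show "p n (trunc k a) \<le> p n (trunc (Suc k) a)" for k
        using p_trunc[OF trunc_fin, of n k "Suc k" a] by (simp add: trunc_trunc)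
    qed
  qed
  have sqB: "(\<Sum>n\<le>m. (c n)\<^sup>2) \<le> B\<^sup>2" for m
  proof (rule LIMSEQ_le_const2)
    show "(\<lambda>k. \<Sum>n\<le>m. (p n (trunc k a))\<^sup>2) \<longlonglongrightarrow> (\<Sum>n\<le>m. (c n)\<^sup>2)" by (intro tendsto_intros lim)
    have "(\<Sum>n\<le>m. (p n (trunc k a))\<^sup>2) \<le> B\<^sup>2" for k
    proof -
      have "L2_set (\<lambda>n. p n (trunc k a)) {..<Suc m} \<le> B" using order_trans[OF N0_upper[OF trunc_fin] bdd] .
      then have "sqrt (\<Sum>n\<le>m. (p n (trunc k a))\<^sup>2) \<le> B" by (simp only: L2_set_def lessThan_Suc_atMost)
      then show ?thesis using B0 real_sqrt_le_iff[of _ "B\<^sup>2"] by simp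
    qed
    then show "\<exists>N. \<forall>k\<ge>N. (\<Sum>n\<le>m. (p n (trunc k a))\<^sup>2) \<le> B\<^sup>2" by blast
  qed
  have "summable (\<lambda>n. (c n)\<^sup>2)" by (rule bounded_imp_summable[OF _ sqB]) simp
  moreover have "(e/2)\<^sup>2 > 0" using e by simp
  ultimately obtain m where m: "\<And>m'. norm (\<Sum>n=m..<m'. (c n)\<^sup>2) < (e/2)\<^sup>2"
    unfolding summable_Cauchy by blast
  have "L2_set (\<lambda>n. p n (trunc l a - trunc k a)) {m..<m'} \<le> e" for k l m'
  proof -
    have "L2_set (\<lambda>n. p n (trunc l a - trunc k a)) {m..<m'} \<le> L2_set (\<lambda>n. 2 * c n) {m..<m'}"
    proof (intro L2_set_mono p_nonneg fin_seqs_diff trunc_fin)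
      show "p n (trunc l a - trunc k a) \<le> 2 * c n" for n
        using p_diff[OF trunc_fin trunc_fin, of n l a k a] c_upper[of n l] c_upper[of n k] by linarith
    qed
    also have "\<dots> = 2 * L2_set c {m..<m'}" by (simp add: L2_set_right_distrib)
    also have "L2_set c {m..<m'} \<le> sqrt ((e/2)\<^sup>2)"
      unfolding L2_set_def using m[of m'] by (intro real_sqrt_le_mono) simp
    finally show ?thesis using e by simp
  qed
  then show "\<exists>m. \<forall>k l m'. L2_set (\<lambda>n. p n (trunc l a - trunc k a)) {m..<m'} \<le> e" by blast
qed

end

subsection \<open>Shrinking\<close>

context interpolation
begin

text \<open>\<open>J\<close> sends \<open>a\<close> to its sequence of partial sums and is isometric
  from \<open>M\<close> to the supremum norm, so \<open>h\<close> extends to bounded sequences of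
  vectors. There the differences of the functionals \<open>Gi i\<close> are tested by sequences with
  disjoint supports, which bounds their variation.\<close>

lemma M_bounded_functional_summable:
  assumes shr: "\<And>g :: 'a \<Rightarrow>\<^sub>L real. summable (\<lambda>i. blinfun_apply g (y i) *\<^sub>R F i)"
    and h_add: "\<And>a b. a \<in> fin_seqs \<Longrightarrow> b \<in> fin_seqs \<Longrightarrow> h (a + b) = h a + h b"
    and h_scale: "\<And>c a. a \<in> fin_seqs \<Longrightarrow> h (c *\<^sub>R a) = c * h a"
    and h_le: "\<And>a. a \<in> fin_seqs \<Longrightarrow> \<bar>h a\<bar> \<le> C * M a" and C: "C \<ge> 0"
  shows "summable (\<lambda>i. h (unit_seq i) *\<^sub>R F i)"
proof -
  define Bd where "Bd = {s :: nat \<Rightarrow> 'a. bounded (range s)}"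
  define q where "q s = (SUP k. norm (s k))" for s :: "nat \<Rightarrow> 'a"
  have q_upper: "norm (s k) \<le> q s" if "s \<in> Bd" for s k
  proof -
    obtain K where "\<And>k. norm (s k) \<le> K" using \<open>s \<in> Bd\<close> by (auto simp: Bd_def bounded_iff)
    then show ?thesis unfolding q_def by (intro cSUP_upper bdd_aboveI2[where M = K]) auto
  qed
  have q_least: "q s \<le> c" if "\<And>k. norm (s k) \<le> c" for s c
    unfolding q_def using that by (intro cSUP_least) auto
  have Bd_I: "s \<in> Bd" if "\<And>k. norm (s k) \<le> c" for s c
    using that by (auto simp: Bd_def bounded_iff)
  have Bd_sub: "subspace Bd"
    unfolding subspace_def
  proof (intro conjI ballI allI)
    show "0 \<in> Bd" by (rule Bd_I[of _ 0]) simp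
    show "s + t \<in> Bd" if "s \<in> Bd" "t \<in> Bd" for s t
      using q_upper[OF that(1)] q_upper[OF that(2)] by (intro Bd_I[of _ "q s + q t"]) (simp add: norm_triangle_mono)
    show "c *\<^sub>R s \<in> Bd" if "s \<in> Bd" for c s
      using q_upper[OF that] by (intro Bd_I[of _ "\<bar>c\<bar> * q s"]) (simp add: scaleR_fun_def mult_left_mono)
  qed
  have q_add: "q (s + t) \<le> q s + q t" if "s \<in> Bd" "t \<in> Bd" for s t
    using q_upper[OF that(1)] q_upper[OF that(2)] by (intro q_least) (simp add: norm_triangle_mono)
  have q_scale: "q (c *\<^sub>R s) = \<bar>c\<bar> * q s" if "s \<in> Bd" for c s
  proof (rule abs_homogeneousI[OF _ Bd_sub _ that])
    show "q (c *\<^sub>R s) \<le> \<bar>c\<bar> * q s" if "s \<in> Bd" for c s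
      using q_upper[OF that] by (intro q_least) (simp add: scaleR_fun_def mult_left_mono)
    show "0 \<le> q s" if "s \<in> Bd" for s using order_trans[OF norm_ge_zero q_upper[OF that]] .
  qed
  define J where "J a = (\<lambda>k. \<Sum>i<k. a i *\<^sub>R y i)" for a :: "nat \<Rightarrow> real"
  have J_add: "J (a + b) = J a + J b" for a b
    by (simp add: J_def fun_eq_iff scaleR_add_left sum.distrib)
  have J_scale: "J (c *\<^sub>R a) = c *\<^sub>R J a" for c a
    by (simp add: J_def fun_eq_iff scaleR_fun_def scaleR_sum_right)
  have J_inj: "inj_on J fin_seqs"
  proof (rule inj_onI)
    fix a b :: "nat \<Rightarrow> real" assume "J a = J b"
    then have s: "(\<Sum>i<k. a i *\<^sub>R y i) = (\<Sum>i<k. b i *\<^sub>R y i)" for k by (simp add: J_def fun_eq_iff)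
    have "a i *\<^sub>R y i = b i *\<^sub>R y i" for i using s[of "Suc i"] s[of i] by simp
    then show "a = b" using y_nonzero by (simp add: fun_eq_iff)
  qed
  have J_Bd: "J a \<in> Bd" and qJ: "q (J a) = M a" if "a \<in> fin_seqs" for a
  proof -
    show "J a \<in> Bd" using M_upper[OF that] by (intro Bd_I[of _ "M a"]) (simp add: J_def)
    show "q (J a) = M a" by (simp add: q_def M_def J_def)
  qed
  \<comment> \<open>\<open>h\<close> transported along \<open>J\<close>, which is injective because
    no \<open>y i\<close> vanishes.\<close>
  define h0 where "h0 s = h (the_inv_into fin_seqs J s)" for s
  have h0: "h0 (J a) = h a" if "a \<in> fin_seqs" for a
    using that by (simp add: h0_def the_inv_into_f_f[OF J_inj])
  obtain G where G: "linear G" "\<And>s. s \<in> J ` fin_seqs \<Longrightarrow> G s = h0 s" "\<And>s. s \<in> Bd \<Longrightarrow> G s \<le> C * q s"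
  proof (rule Hahn_Banach[of Bd "J ` fin_seqs" "\<lambda>s. C * q s" h0])
    show "J ` fin_seqs \<subseteq> Bd" using J_Bd by blast
    show "subspace (J ` fin_seqs)"
      using J_add J_scale by (intro linear_subspace_image subspace_fin_seqs linearI) auto
    show "C * q (s + t) \<le> C * q s + C * q t" if "s \<in> Bd" "t \<in> Bd" for s t
      using mult_left_mono[OF q_add[OF that] C] by (simp add: distrib_left)
    show "C * q (c *\<^sub>R s) = c * (C * q s)" if "s \<in> Bd" "0 \<le> c" for c s
      using that by (simp add: q_scale)
    show "h0 (s + t) = h0 s + h0 t" if st: "s \<in> J ` fin_seqs" "t \<in> J ` fin_seqs" for s t
    proof -
      obtain a b where "a \<in> fin_seqs" "b \<in> fin_seqs" "s = J a" "t = J b" using st by blast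
      then show ?thesis using h0[OF fin_seqs_add] h_add by (simp add: J_add[symmetric] h0)
    qed
    show "h0 (c *\<^sub>R s) = c * h0 s" if s: "s \<in> J ` fin_seqs" for c s
    proof -
      obtain a where "a \<in> fin_seqs" "s = J a" using s by blast
      then show ?thesis using h0[OF fin_seqs_scale] h_scale by (simp add: J_scale[symmetric] h0)
    qed
    show "h0 s \<le> C * q s" if "s \<in> J ` fin_seqs" for s
      using that h_le by (auto simp: h0 qJ intro: order_trans[OF abs_ge_self])
  qed (use Bd_sub in auto)
  have G_abs: "\<bar>G s\<bar> \<le> C * c" if "\<And>k. norm (s k) \<le> c" for s c
  proof -
    have s: "s \<in> Bd" using that by (rule Bd_I)
    have "C * q s \<le> C * c" by (intro mult_left_mono q_least that C)
    moreover have "G s \<le> C * q s" by (rule G(3)[OF s])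
    moreover have "G ((-1) *\<^sub>R s) \<le> C * q ((-1) *\<^sub>R s)" by (intro G(3) subspace_scale[OF Bd_sub] s)
    then have "- G s \<le> C * q s" using q_scale[OF s, of "-1"] linear_scale[OF G(1), of "-1" s] by (simp only:) simp
    ultimately show ?thesis by linarith
  qed
  text \<open>\<open>Gi i\<close> is \<open>G\<close> on the sequences that are 0 up to \<open>i\<close> and constant afterwards, so that
    \<open>h (unit_seq i) = Gi i (y i)\<close>.\<close>
  have bl: "bounded_linear (\<lambda>u. G (\<lambda>k. if k > i then u else 0))" for i
  proof (rule bounded_linear_intro[where K = C])
    fix u v :: 'a and c :: real
    have "(\<lambda>k. if k > i then u + v else 0) = (\<lambda>k. if k > i then u else 0) + (\<lambda>k. if k > i then v else 0)"
      by (auto simp: fun_eq_iff)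
    then show "G (\<lambda>k. if k > i then u + v else 0) = G (\<lambda>k. if k > i then u else 0) + G (\<lambda>k. if k > i then v else 0)"
      using linear_add[OF G(1)] by metis
    have "(\<lambda>k. if k > i then c *\<^sub>R u else 0) = c *\<^sub>R (\<lambda>k. if k > i then u else 0)"
      by (auto simp: fun_eq_iff scaleR_fun_def)
    then show "G (\<lambda>k. if k > i then c *\<^sub>R u else 0) = c *\<^sub>R G (\<lambda>k. if k > i then u else 0)"
      using linear_scale[OF G(1)] by metis
    show "norm (G (\<lambda>k. if k > i then u else 0)) \<le> norm u * C"
      using G_abs[of "\<lambda>k. if k > i then u else 0" "norm u"] by (simp add: mult.commute)
  qed
  define Gi where "Gi i = Blinfun (\<lambda>u. G (\<lambda>k. if k > i then u else 0))" for i
  have Gi: "blinfun_apply (Gi i) u = G (\<lambda>k. if k > i then u else 0)" for i u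
    by (simp add: Gi_def bounded_linear_Blinfun_apply[OF bl])
  have "summable (\<lambda>i. norm (Gi i - Gi (Suc i)))"
  proof (rule summable_norm_blinfun_diff)
    fix g :: "nat \<Rightarrow> 'a" and j
    assume g: "\<And>i. norm (g i) \<le> 1"
    \<comment> \<open>Two consecutive step functions differ at position \<open>Suc i\<close>
      only.\<close>
    have one: "blinfun_apply (Gi i) (g i) - blinfun_apply (Gi (Suc i)) (g i) = G (\<lambda>k. if k = Suc i then g i else 0)" for i
    proof -
      have "(\<lambda>k. if k = Suc i then g i else 0) = (\<lambda>k. if k > i then g i else 0) - (\<lambda>k. if k > Suc i then g i else 0)"
        by (auto simp: fun_eq_iff)
      then show ?thesis unfolding Gi using linear_diff[OF G(1)] by metis
    qed
    have "(\<Sum>i<j. blinfun_apply (Gi i) (g i) - blinfun_apply (Gi (Suc i)) (g i)) = G (\<Sum>i<j. (\<lambda>k. if k = Suc i then g i else 0))"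
      unfolding one by (rule linear_sum[OF G(1), symmetric])
    also have "(\<Sum>i<j. (\<lambda>k. if k = Suc i then g i else 0)) = (\<lambda>k. if k \<in> {1..j} then g (k - 1) else 0)"
      by (induction j) (auto simp: fun_eq_iff)
    \<comment> \<open>The entries sit at distinct positions, so their sum has supremum norm at most
      1 whatever \<open>j\<close> is.\<close>
    also have "G \<dots> \<le> C * 1" by (rule order_trans[OF abs_ge_self G_abs]) (use g in simp)
    finally show "(\<Sum>i<j. blinfun_apply (Gi i) (g i) - blinfun_apply (Gi (Suc i)) (g i)) \<le> C" by simp
  qed
  then have sm: "summable (\<lambda>i. blinfun_apply (Gi i) (y i) *\<^sub>R F i)"
    by (rule summable_bounded_variation[where B = "\<lambda>i g. blinfun_apply g (y i) *\<^sub>R F i" and v = Gi, rotated 2])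
      (intro bounded_linear_scaleR_const blinfun.bounded_linear_left shr)+
  have "h (unit_seq i) = blinfun_apply (Gi i) (y i)" for i
  proof -
    have "J (unit_seq i) k = (if k > i then y i else 0)" for k
      unfolding J_def by (induction k) (auto simp: unit_seq_def less_Suc_eq)
    then have "J (unit_seq i) = (\<lambda>k. if k > i then y i else 0)" by (simp add: fun_eq_iff)
    then show ?thesis using G(2)[OF imageI[OF unit_seq_fin, of J i]] h0[OF unit_seq_fin, of i] unfolding Gi by simp
  qed
  then show ?thesis using sm by simp
qed

text \<open>The dual of an \<open>\<ell>\<^sub>2\<close>-sum in disguise: at an almost norming vector \<open>a0\<close> all of the norm of \<open>h\<close> is used by
  finitely many of the gauges, and strict convexity of the Euclidean norm makes the remaining part of \<open>h\<close> small.\<close>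

lemma split_functional:
  assumes h_add: "\<And>a b. a \<in> fin_seqs \<Longrightarrow> b \<in> fin_seqs \<Longrightarrow> h (a + b) = h a + h b"
    and h_scale: "\<And>c a. a \<in> fin_seqs \<Longrightarrow> h (c *\<^sub>R a) = c * h a"
    and h_le: "\<And>a. a \<in> fin_seqs \<Longrightarrow> \<bar>h a\<bar> \<le> C1 * N0 a" and e: "e > 0"
  obtains h' D where "linear h'" "D \<ge> 0" "\<And>a. a \<in> fin_seqs \<Longrightarrow> \<bar>h' a\<bar> \<le> D * M a"
    "\<And>a. a \<in> fin_seqs \<Longrightarrow> \<bar>h a - h' a\<bar> \<le> e * N0 a"
proof -
  interpret fin: normed_space_on "fin_seqs :: (nat \<Rightarrow> real) set" N0
    using subspace_fin_seqs Z.N0_nonneg Z.N0_eq_zero Z.N0_zero Z.N0_scale Z.N0_add by unfold_locales auto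
  define h1 where "h1 a = (if a \<in> fin_seqs then h a else 0)" for a
  have h1: "h1 \<in> dual_space fin_seqs N0"
    by (rule dual_spaceI[where C = C1]) (auto simp: h1_def h_add h_scale h_le fin_seqs_add fin_seqs_scale)
  define C where "C = dual_norm fin_seqs N0 h1"
  have C0: "C \<ge> 0" unfolding C_def by (rule fin.dual_norm_nonneg[OF h1 subset_refl fin.zero_in])
  have hC: "\<bar>h a\<bar> \<le> C * N0 a" if "a \<in> fin_seqs" for a
    using fin.dual_norm_bound[OF h1 that] that by (simp add: h1_def C_def)
  \<comment> \<open>\<open>t\<close> is the size of a perturbation of \<open>a0\<close> and
    \<open>\<eta>\<close> the allowed defect in norming. They are matched so that division by
    \<open>t\<close> leaves \<open>C * t / 2 \<le> e/2\<close> from convexity and exactly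
    \<open>e/2\<close> from the defect.\<close>
  define t where "t = e / (C + 1)"
  have t: "t > 0" "C * t \<le> e" using e C0 by (auto simp: t_def field_simps)
  define \<eta> where "\<eta> = e * t / (2 * (C + 1))"
  have \<eta>: "\<eta> > 0" "(1 + C) * \<eta> = e * t / 2" using e t C0 by (auto simp: \<eta>_def field_simps)
  have "\<exists>a. a \<in> fin_seqs \<and> N0 a \<le> 1 \<and> C - \<eta> \<le> h a"
  proof -
    have "\<exists>a. a \<in> fin_seqs \<and> N0 a \<le> 1 \<and> C - \<eta> < \<bar>h a\<bar>"
    proof (rule ccontr)
      assume "\<not> ?thesis"
      then have "C \<le> C - \<eta>"
        unfolding C_def by (intro dual_norm_least[OF fin.zero_in]) (auto simp: h1_def fin.N_zero not_less C_def)
      then show False using \<eta> by simp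
    qed
    then obtain a where a: "a \<in> fin_seqs" "N0 a \<le> 1" "C - \<eta> < \<bar>h a\<bar>" by blast
    show ?thesis
    proof (cases "h a \<ge> 0")
      case False
      have "(-1) *\<^sub>R a \<in> fin_seqs \<and> N0 ((-1) *\<^sub>R a) \<le> 1 \<and> C - \<eta> \<le> h ((-1) *\<^sub>R a)"
        using a False Z.N0_scale[OF a(1), of "-1"] h_scale[OF a(1), of "-1"] fin_seqs_scale[OF a(1), of "-1"] by simp
      then show ?thesis by blast
    qed (use a in force)
  qed
  then obtain a0 where a0: "a0 \<in> fin_seqs" "N0 a0 \<le> 1" "C - \<eta> \<le> h a0" by blast
  obtain c where c: "c \<ge> 0" "\<And>n. p n a0 \<le> c / 2 ^ n" using p_decay[OF a0(1)] by blast
  have "(\<lambda>m. 2 * c * (1/2) ^ m) \<longlonglongrightarrow> 0" by (intro tendsto_mult_right_zero LIMSEQ_power_zero) simp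
  then have "\<forall>\<^sub>F m in sequentially. 2 * c * (1/2) ^ m < \<eta>" using \<eta>(1) by (rule order_tendstoD(2))
  then obtain m where m: "2 * c * (1/2) ^ m < \<eta>" by (auto simp: eventually_sequentially)
  \<comment> \<open>On pairs, the gauges below \<open>m\<close> look at the first component and the
    others at the second. On the diagonal \<open>N2\<close> is \<open>N0\<close>, so
    \<open>h\<close> extends from the diagonal to all pairs, and the two axes separate the low
    gauges from the high ones.\<close>
  define mix where "mix a b n = (if n < m then p n a else p n b)" for a b n
  define N2 where "N2 a b = (SUP m'. L2_set (mix a b) {..<m'})" for a b
  have mix0: "mix a b n \<ge> 0" if "a \<in> fin_seqs" "b \<in> fin_seqs" for a b n
    using that by (simp add: mix_def p_nonneg)
  have N2_upper: "L2_set (mix a b) {..<m'} \<le> N2 a b" if ab: "a \<in> fin_seqs" "b \<in> fin_seqs" for a b m'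
    unfolding N2_def
  proof (rule cSUP_upper)
    have "L2_set (mix a b) {..<m'} \<le> N0 a + N0 b" for m'
    proof -
      have "L2_set (mix a b) {..<m'} \<le> L2_set (\<lambda>n. p n a + p n b) {..<m'}"
        using ab by (intro L2_set_mono mix0) (simp add: mix_def p_nonneg)
      also have "\<dots> \<le> L2_set (\<lambda>n. p n a) {..<m'} + L2_set (\<lambda>n. p n b) {..<m'}" by (rule L2_set_triangle_ineq)
      also have "\<dots> \<le> N0 a + N0 b" by (intro add_mono N0_upper ab)
      finally show ?thesis .
    qed
    then show "bdd_above (range (\<lambda>m'. L2_set (mix a b) {..<m'}))" by (rule bdd_aboveI2)
  qed simp
  have N2_least: "N2 a b \<le> K" if "\<And>m'. L2_set (mix a b) {..<m'} \<le> K" for a b K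
    unfolding N2_def using that by (intro cSUP_least) auto
  have N2_diag: "N2 a a = N0 a" for a
  proof -
    have "mix a a = (\<lambda>n. p n a)" by (simp add: mix_def fun_eq_iff)
    then show ?thesis by (simp add: N2_def N0_def)
  qed
  have N2_nonneg: "N2 a b \<ge> 0" if "a \<in> fin_seqs" "b \<in> fin_seqs" for a b
    using N2_upper[OF that, of 0] by (simp add: L2_set_def)
  let ?V = "fin_seqs \<times> fin_seqs :: ((nat \<Rightarrow> real) \<times> (nat \<Rightarrow> real)) set"
  have subV: "subspace ?V" by (intro subspace_Times subspace_fin_seqs)
  obtain H where H: "linear H" "\<And>v. v \<in> (\<lambda>a. (a, a)) ` fin_seqs \<Longrightarrow> H v = h (fst v)"
    "\<And>v. v \<in> ?V \<Longrightarrow> H v \<le> C * N2 (fst v) (snd v)"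
  proof (rule Hahn_Banach[of ?V "(\<lambda>a. (a, a)) ` fin_seqs" "\<lambda>v. C * N2 (fst v) (snd v)" "\<lambda>v. h (fst v)"])
    show "subspace ((\<lambda>a. (a, a)) ` fin_seqs :: ((nat \<Rightarrow> real) \<times> (nat \<Rightarrow> real)) set)"
      by (intro linear_subspace_image subspace_fin_seqs linearI) auto
    show "C * N2 (fst (u + v)) (snd (u + v)) \<le> C * N2 (fst u) (snd u) + C * N2 (fst v) (snd v)"
      if "u \<in> ?V" "v \<in> ?V" for u v
    proof -
      have uv: "fst u \<in> fin_seqs" "snd u \<in> fin_seqs" "fst v \<in> fin_seqs" "snd v \<in> fin_seqs" using that by auto
      have "N2 (fst u + fst v) (snd u + snd v) \<le> N2 (fst u) (snd u) + N2 (fst v) (snd v)"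
      proof (rule N2_least)
        fix m'
        have "L2_set (mix (fst u + fst v) (snd u + snd v)) {..<m'} \<le>
            L2_set (\<lambda>n. mix (fst u) (snd u) n + mix (fst v) (snd v) n) {..<m'}"
          using uv by (intro L2_set_mono mix0 fin_seqs_add) (auto simp: mix_def p_add)
        also have "\<dots> \<le> L2_set (mix (fst u) (snd u)) {..<m'} + L2_set (mix (fst v) (snd v)) {..<m'}"
          by (rule L2_set_triangle_ineq)
        also have "\<dots> \<le> N2 (fst u) (snd u) + N2 (fst v) (snd v)" using uv by (intro add_mono N2_upper)
        finally show "L2_set (mix (fst u + fst v) (snd u + snd v)) {..<m'} \<le> N2 (fst u) (snd u) + N2 (fst v) (snd v)" .
      qed
      from mult_left_mono[OF this C0] show ?thesis by (simp add: distrib_left)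
    qed
    show "C * N2 (fst (r *\<^sub>R v)) (snd (r *\<^sub>R v)) = r * (C * N2 (fst v) (snd v))" if v: "v \<in> ?V" and r: "0 \<le> r" for r v
    proof -
      have le: "N2 (fst (r *\<^sub>R v)) (snd (r *\<^sub>R v)) \<le> \<bar>r\<bar> * N2 (fst v) (snd v)" if v: "v \<in> ?V" for r v
      proof (rule N2_least)
        fix m'
        have fs: "fst v \<in> fin_seqs" "snd v \<in> fin_seqs" using v by auto
        have "mix (fst (r *\<^sub>R v)) (snd (r *\<^sub>R v)) = (\<lambda>n. \<bar>r\<bar> * mix (fst v) (snd v) n)"
          using fs by (auto simp: mix_def fun_eq_iff p_scale)
        then have "L2_set (mix (fst (r *\<^sub>R v)) (snd (r *\<^sub>R v))) {..<m'} = \<bar>r\<bar> * L2_set (mix (fst v) (snd v)) {..<m'}"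
          by (simp add: L2_set_right_distrib)
        also have "\<dots> \<le> \<bar>r\<bar> * N2 (fst v) (snd v)" using fs by (intro mult_left_mono N2_upper) auto
        finally show "L2_set (mix (fst (r *\<^sub>R v)) (snd (r *\<^sub>R v))) {..<m'} \<le> \<bar>r\<bar> * N2 (fst v) (snd v)" .
      qed
      have "N2 (fst (r *\<^sub>R v)) (snd (r *\<^sub>R v)) = \<bar>r\<bar> * N2 (fst v) (snd v)"
        by (rule abs_homogeneousI[where q = "\<lambda>v. N2 (fst v) (snd v)", OF le subV _ v]) (auto intro: N2_nonneg)
      then show ?thesis using r by simp
    qed
    show "h (fst (u + v)) = h (fst u) + h (fst v)" if "u \<in> (\<lambda>a. (a, a)) ` fin_seqs" "v \<in> (\<lambda>a. (a, a)) ` fin_seqs" for u v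
      using that by (auto simp: h_add)
    show "h (fst (r *\<^sub>R v)) = r * h (fst v)" if "v \<in> (\<lambda>a. (a, a)) ` fin_seqs" for r v
      using that by (auto simp: h_scale)
    show "h (fst v) \<le> C * N2 (fst v) (snd v)" if "v \<in> (\<lambda>a. (a, a)) ` fin_seqs" for v
      using that hC by (auto simp: N2_diag intro: order_trans[OF abs_ge_self])
  qed (use subV in auto)
  define h' where "h' a = H (a, 0)" for a
  define r where "r b = H (0, b)" for b
  have lin_h': "linear h'"
    unfolding h'_def using linear_compose[OF _ H(1), of "\<lambda>a. (a, 0)"]
    by (simp add: o_def linearI)
  have lin_r: "linear r"
    unfolding r_def using linear_compose[OF _ H(1), of "\<lambda>b. (0, b)"]
    by (simp add: o_def linearI)
  have h_split: "h a = h' a + r a" if "a \<in> fin_seqs" for a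
    using H(2)[of "(a, a)"] linear_add[OF H(1), of "(a, 0)" "(0, a)"] that by (simp add: h'_def r_def)
  have zero: "(0 :: nat \<Rightarrow> real) \<in> fin_seqs" by (rule fin_seqs_zero)
  \<comment> \<open>Only the gauges below \<open>m\<close> see the pair \<open>(a, 0)\<close>, and
    each is at most a multiple of \<open>M\<close>.\<close>
  have h'_le: "h' a \<le> (C * 2 ^ m) * M a" if a: "a \<in> fin_seqs" for a
  proof -
    have "N2 a 0 \<le> 2 ^ m * M a"
    proof (rule N2_least)
      fix m'
      have "L2_set (mix a 0) {..<m'} \<le> (\<Sum>n<m'. mix a 0 n)" by (intro L2_set_le_sum mix0 a zero)
      also have "\<dots> = (\<Sum>n<min m m'. p n a)"
        by (rule sum.mono_neutral_cong_right) (auto simp: mix_def p_zero)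
      also have "\<dots> \<le> (\<Sum>n<m. p n a)" by (intro sum_mono2 p_nonneg a) auto
      also have "\<dots> \<le> (\<Sum>n<m. 2 ^ n * M a)" by (intro sum_mono p_le_M a)
      also have "\<dots> \<le> 2 ^ m * M a"
      proof -
        have "(\<Sum>n<m. 2 ^ n :: real) \<le> 2 ^ m" by (induction m) simp_all
        then show ?thesis using M_nonneg[OF a] by (simp add: sum_distrib_right[symmetric] mult_right_mono)
      qed
      finally show "L2_set (mix a 0) {..<m'} \<le> 2 ^ m * M a" .
    qed
    from mult_left_mono[OF this C0] show ?thesis using H(3)[of "(a, 0)"] a zero by (simp add: h'_def)
  qed
  have h'_abs: "\<bar>h' a\<bar> \<le> (C * 2 ^ m) * M a" if a: "a \<in> fin_seqs" for a
    using h'_le[OF a] h'_le[OF fin_seqs_scale[OF a], of "-1"] M_scale[OF a, of "-1"] linear_neg[OF lin_h', of a] by simp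
  \<comment> \<open>From \<open>m\<close> on the gauges of \<open>a0\<close> sum to less than
    \<open>\<eta>\<close> by the choice of \<open>m\<close>.\<close>
  have r_a0: "r a0 \<le> C * \<eta>"
  proof -
    have "N2 0 a0 \<le> \<eta>"
    proof (rule N2_least)
      fix m'
      have "L2_set (mix 0 a0) {..<m'} \<le> (\<Sum>n<m'. mix 0 a0 n)" by (intro L2_set_le_sum mix0 a0 zero)
      also have "\<dots> = (\<Sum>n=m..<m'. p n a0)"
        by (rule sum.mono_neutral_cong_right) (auto simp: mix_def p_zero)
      also have "\<dots> \<le> (\<Sum>n=m..<m'. c / 2 ^ n)" by (intro sum_mono c)
      also have "\<dots> \<le> 2 * c / 2 ^ m" by (rule sum_geometric_tail[OF c(1)])
      also have "\<dots> \<le> \<eta>" using m by (simp add: power_one_over)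
      finally show "L2_set (mix 0 a0) {..<m'} \<le> \<eta>" .
    qed
    from mult_left_mono[OF this C0] show ?thesis using H(3)[of "(0, a0)"] a0 zero by (simp add: r_def)
  qed
  \<comment> \<open>Adding \<open>t b\<close> in the second component raises the bound on
    \<open>N2\<close> only to second order in \<open>t\<close>, while \<open>H\<close> changes by
    \<open>t * r b\<close>. Since \<open>h' a0\<close> is at least
    \<open>C - (1 + C) * \<eta>\<close>, little room is left for \<open>r b\<close>.\<close>
  have r_le: "r b \<le> e" if b: "b \<in> fin_seqs" "N0 b \<le> 1" for b
  proof -
    have "N2 a0 (t *\<^sub>R b) \<le> 1 + t\<^sup>2 / 2"
    proof (rule N2_least)
      fix m'
      have sq: "(\<Sum>n<m'. (p n a)\<^sup>2) \<le> 1" if "a \<in> fin_seqs" "N0 a \<le> 1" for a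
        using order_trans[OF N0_upper[OF that(1), of m'] that(2)] by (simp add: L2_set_def)
      have "(\<Sum>n<m'. (mix a0 (t *\<^sub>R b) n)\<^sup>2) \<le> (\<Sum>n<m'. (p n a0)\<^sup>2 + t\<^sup>2 * (p n b)\<^sup>2)"
        using b t by (intro sum_mono) (auto simp: mix_def p_scale power_mult_distrib)
      also have "\<dots> = (\<Sum>n<m'. (p n a0)\<^sup>2) + t\<^sup>2 * (\<Sum>n<m'. (p n b)\<^sup>2)" by (simp add: sum.distrib sum_distrib_left)
      also have "\<dots> \<le> 1 + t\<^sup>2 * 1" by (intro add_mono mult_left_mono sq a0 b) simp
      also have "\<dots> \<le> (1 + t\<^sup>2 / 2)\<^sup>2" by (simp add: power2_sum)
      finally show "L2_set (mix a0 (t *\<^sub>R b)) {..<m'} \<le> 1 + t\<^sup>2 / 2"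
        unfolding L2_set_def by (intro real_le_lsqrt) auto
    qed
    from mult_left_mono[OF this C0] have "H (a0, t *\<^sub>R b) \<le> C * (1 + t\<^sup>2 / 2)"
      using H(3)[of "(a0, t *\<^sub>R b)"] a0(1) fin_seqs_scale[OF b(1), of t] by simp
    moreover have "H (a0, t *\<^sub>R b) = h' a0 + t * r b"
      using linear_add[OF H(1), of "(a0, 0)" "(0, t *\<^sub>R b)"] linear_scale[OF lin_r, of t b] by (simp add: h'_def r_def)
    moreover have "h' a0 \<ge> C - \<eta> - C * \<eta>" using h_split[OF a0(1)] r_a0 a0(3) by linarith
    ultimately have "t * r b \<le> C * t\<^sup>2 / 2 + (1 + C) * \<eta>" by (simp add: algebra_simps)
    also have "\<dots> = t * (C * t / 2 + e / 2)" unfolding \<eta>(2) by (simp add: power2_eq_square algebra_simps)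
    finally have "r b \<le> C * t / 2 + e / 2" using t(1) by simp
    then show ?thesis using t(2) by linarith
  qed
  have r_abs: "\<bar>r b\<bar> \<le> e * N0 b" if b: "b \<in> fin_seqs" for b
  proof (cases "N0 b = 0")
    case True
    then have "b = 0" using Z.N0_eq_zero[OF b] by simp
    then show ?thesis using linear_0[OF lin_r] True by simp
  next
    case False
    then have pos: "N0 b > 0" using Z.N0_nonneg[OF b] by simp
    have le: "(s / N0 b) * r b \<le> e" if "\<bar>s\<bar> = 1" for s
    proof -
      have "r ((s / N0 b) *\<^sub>R b) \<le> e"
        using that pos by (intro r_le fin_seqs_scale b) (simp add: Z.N0_scale[OF b])
      then show ?thesis using linear_scale[OF lin_r, of _ b] by simp
    qed
    from le[of 1] le[of "-1"] show ?thesis using pos by (simp add: abs_le_iff field_simps)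
  qed
  show thesis
  proof (rule that[of h' "C * 2 ^ m"])
    show "\<bar>h a - h' a\<bar> \<le> e * N0 a" if "a \<in> fin_seqs" for a using r_abs[OF that] h_split[OF that] by simp
  qed (use lin_h' C0 h'_abs in auto)
qed

text \<open>Up to \<open>e/2\<close> the functional may be taken bounded for \<open>M\<close>, and
  \<open>a\<close> splits into a coefficient sequence of controlled variation and a remainder small
  in \<open>M\<close>. On the former, Abel summation pairs the differences of \<open>v\<close> with
  blocks of a convergent series in the dual. Since \<open>a\<close> vanishes below \<open>k\<close>,
  both parts may be cut off there.\<close>

lemma functional_tails:
  assumes shr: "\<And>g :: 'a \<Rightarrow>\<^sub>L real. summable (\<lambda>i. blinfun_apply g (y i) *\<^sub>R F i)"
    and h_add: "\<And>a b. a \<in> fin_seqs \<Longrightarrow> b \<in> fin_seqs \<Longrightarrow> h (a + b) = h a + h b"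
    and h_scale: "\<And>c a. a \<in> fin_seqs \<Longrightarrow> h (c *\<^sub>R a) = c * h a"
    and h_le: "\<And>a. a \<in> fin_seqs \<Longrightarrow> \<bar>h a\<bar> \<le> C * N0 a" and e: "e > 0"
  shows "\<exists>k. \<forall>a\<in>fin_seqs. (\<forall>i<k. a i = 0) \<longrightarrow> \<bar>h a\<bar> \<le> e * N0 a"
proof -
  obtain h' D where h': "linear h'" "D \<ge> 0" "\<And>a. a \<in> fin_seqs \<Longrightarrow> \<bar>h' a\<bar> \<le> D * M a"
    "\<And>a. a \<in> fin_seqs \<Longrightarrow> \<bar>h a - h' a\<bar> \<le> e/2 * N0 a"
    using split_functional[of h C "e/2", OF h_add h_scale h_le] e by auto
  have sm: "summable (\<lambda>i. h' (unit_seq i) *\<^sub>R F i)"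
    by (rule M_bounded_functional_summable[OF shr _ _ h'(3,2)])
      (simp_all add: linear_add[OF h'(1)] linear_scale[OF h'(1)])
  \<comment> \<open>The remainder is at most \<open>2 s / 2 ^ q\<close> in \<open>M\<close>, where
    \<open>s\<close> is the norm of \<open>a\<close>; removing its first \<open>k\<close> entries
    doubles this, whence the 4.\<close>
  have "(\<lambda>q. 4 * D * (1/2) ^ q) \<longlonglongrightarrow> 0" by (intro tendsto_mult_right_zero LIMSEQ_power_zero) simp
  then have "\<forall>\<^sub>F q in sequentially. 4 * D * (1/2) ^ q < e/4" using e by (intro order_tendstoD(2)) auto
  then obtain q where q: "4 * D * (1/2) ^ q < e/4" by (auto simp: eventually_sequentially)
  \<comment> \<open>Variation up to \<open>2 ^ q * (2 * s)\<close>, multiplied by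
    \<open>\<eta>\<close>, has to give \<open>s * (e/4)\<close>.\<close>
  define \<eta> where "\<eta> = e / (8 * 2 ^ q)"
  have \<eta>: "\<eta> > 0" using e by (simp add: \<eta>_def)
  obtain k where k: "\<And>l. norm (\<Sum>i=k..<l. h' (unit_seq i) *\<^sub>R F i) < \<eta>"
    using sm \<eta> unfolding summable_Cauchy by blast
  have "\<bar>h a\<bar> \<le> e * N0 a" if a: "a \<in> fin_seqs" and supp: "\<forall>i<k. a i = 0" for a
  proof (cases "N0 a = 0")
    case True
    then show ?thesis using h_le[OF a] by simp
  next
    case False
    define s where "s = N0 a"
    have s: "s > 0" using False Z.N0_nonneg[OF a] by (simp add: s_def)
    \<comment> \<open>The slack between \<open>s\<close> and \<open>2 * s\<close> provides the
      strict inequality with which a near-optimal decomposition is picked.\<close>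
    have "p q a < 2 * s" using p_le_N0[OF a, of q] s by (simp add: s_def)
    then obtain v where v: "v \<in> fin_seqs" "variation v / 2 ^ q + 2 ^ q * M (a - coeffs v) < 2 * s"
      by (rule p_approx[OF a])
    define b where "b = a - coeffs v"
    have b: "b \<in> fin_seqs" unfolding b_def by (intro fin_seqs_diff a coeffs_fin v)
    have "variation v / 2 ^ q \<ge> 0" "2 ^ q * M b \<ge> 0"
      using variation_nonneg[OF v(1)] M_nonneg[OF b] by auto
    then have 1: "variation v / 2 ^ q \<le> 2 * s" and 2: "2 ^ q * M b \<le> 2 * s"
      using v(2) unfolding b_def by linarith+
    from 1 have var: "variation v \<le> 2 ^ q * (2 * s)" by (simp add: field_simps)
    from 2 have Mb: "M b \<le> 2 * s * (1/2) ^ q" by (simp add: field_simps)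
    obtain L0 where L0: "\<And>i. i \<ge> L0 \<Longrightarrow> v i = 0" using v(1) by (rule fin_seqsE) blast
    define L where "L = max k L0"
    have L: "k \<le> L" "v L = 0" "trunc L v = v" using L0 by (auto simp: L_def intro: trunc_eq)
    have split: "a = (coeffs v - trunc k (coeffs v)) + (b - trunc k b)"
    proof -
      have "trunc k a = 0" using supp by (auto simp: trunc_def fun_eq_iff)
      then show ?thesis by (simp add: b_def trunc_diff)
    qed
    have "\<bar>h' (b - trunc k b)\<bar> \<le> D * M (b - trunc k b)" by (intro h' fin_seqs_diff b trunc_fin)
    also have "\<dots> \<le> D * (2 * M b)"
      using order_trans[OF M_diff[OF b trunc_fin]] M_trunc[OF b, of k] by (intro mult_left_mono h') simp
    also have "\<dots> \<le> D * (2 * (2 * s * (1/2) ^ q))" by (intro mult_left_mono h' Mb) simp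
    also have "\<dots> = s * (4 * D * (1/2) ^ q)" by simp
    also have "\<dots> \<le> s * (e/4)" using q s by (intro mult_left_mono) auto
    finally have part_b: "\<bar>h' (b - trunc k b)\<bar> \<le> s * (e/4)" .
    have "trunc L (coeffs v) - trunc k (coeffs v) = (\<Sum>i=k..<L. coeffs v i *\<^sub>R unit_seq i)"
      using sum.atLeastLessThan_concat[of 0 k L "\<lambda>i. coeffs v i *\<^sub>R unit_seq i"] L(1)
      by (simp add: sum_unit_seq[symmetric] atLeast0LessThan algebra_simps)
    moreover have "trunc L (coeffs v) = coeffs v" using L(3) coeffs_trunc[of L v] by simp
    ultimately have "coeffs v - trunc k (coeffs v) = (\<Sum>i=k..<L. coeffs v i *\<^sub>R unit_seq i)" by simp
    then have "h' (coeffs v - trunc k (coeffs v)) = (\<Sum>i=k..<L. coeffs v i * h' (unit_seq i))"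
      by (simp add: linear_sum[OF h'(1)] linear_scale[OF h'(1)])
    also have "\<dots> = (\<Sum>i=k..<L. blinfun_apply (h' (unit_seq i) *\<^sub>R F i) (v i))"
      by (simp add: coeffs_def blinfun.scaleR_left mult.commute)
    \<comment> \<open>The boundary term disappears because \<open>v L = 0\<close>.\<close>
    also have "\<dots> = (\<Sum>j=k..<L. \<Sum>i=k..j. blinfun_apply (h' (unit_seq i) *\<^sub>R F i) (v j - v (Suc j)))"
      using sum_by_parts[where B = "\<lambda>i. blinfun_apply (h' (unit_seq i) *\<^sub>R F i)" and v = v, OF blinfun.bounded_linear_right L(1)] L(2)
      by (simp add: blinfun.zero_right)
    also have "\<bar>\<dots>\<bar> \<le> (\<Sum>j=k..<L. \<eta> * norm (v j - v (Suc j)))"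
    proof (rule order_trans[OF sum_abs sum_mono])
      fix j
      let ?B = "\<Sum>i=k..<Suc j. h' (unit_seq i) *\<^sub>R F i"
      have "(\<Sum>i=k..j. blinfun_apply (h' (unit_seq i) *\<^sub>R F i) (v j - v (Suc j))) = blinfun_apply ?B (v j - v (Suc j))"
        by (simp only: blinfun.sum_left atLeastLessThanSuc_atLeastAtMost)
      also have "\<bar>\<dots>\<bar> \<le> norm ?B * norm (v j - v (Suc j))"
        using norm_blinfun[of ?B "v j - v (Suc j)"] by (simp only: real_norm_def)
      also have "\<dots> \<le> \<eta> * norm (v j - v (Suc j))" using k[of "Suc j"] by (intro mult_right_mono) auto
      finally show "\<bar>\<Sum>i=k..j. blinfun_apply (h' (unit_seq i) *\<^sub>R F i) (v j - v (Suc j))\<bar> \<le> \<eta> * norm (v j - v (Suc j))" .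
    qed
    also have "\<dots> \<le> \<eta> * (\<Sum>j<L. norm (v j - v (Suc j)))"
      using \<eta> by (subst sum_distrib_left[symmetric], intro mult_left_mono sum_mono2) auto
    also have "\<dots> \<le> \<eta> * (2 ^ q * (2 * s))"
      using variation_ge[OF v(1), of L] var L(2) \<eta> by (intro mult_left_mono) auto
    also have "\<dots> = s * (e/4)" by (simp add: \<eta>_def)
    finally have part_v: "\<bar>h' (coeffs v - trunc k (coeffs v))\<bar> \<le> s * (e/4)" .
    have "h' a = h' (coeffs v - trunc k (coeffs v)) + h' (b - trunc k b)"
      using linear_add[OF h'(1)] split by metis
    then have "\<bar>h' a\<bar> \<le> s * (e/4) + s * (e/4)" using part_b part_v by linarith
    then have "\<bar>h' a\<bar> \<le> s * (e/2)" by (simp add: mult.commute)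
    moreover have "\<bar>h a - h' a\<bar> \<le> s * (e/2)" using h'(4)[OF a] by (simp add: s_def mult.commute)
    ultimately have "\<bar>h a\<bar> \<le> s * (e/2) + s * (e/2)" by linarith
    then show ?thesis by (simp add: s_def mult.commute)
  qed
  then show ?thesis by blast
qed

end

subsection \<open>Perturbing a frame to avoid zero vectors and zero functionals\<close>

lemma summable_perturbation:
  fixes s t :: "nat \<Rightarrow> 'a::banach"
  assumes s: "summable s" and close: "\<And>i. norm (t i - s i) \<le> K * (1/2) ^ i"
  shows "summable t"
proof -
  have "summable (\<lambda>i. t i - s i)"
    by (rule summable_comparison_test'[of "\<lambda>i. K * (1/2) ^ i" 0]) (use close in \<open>auto intro!: summable_mult\<close>)
  from summable_add[OF this s] show ?thesis by simp
qed

text \<open>The space is enlarged by one dimension, in which all vectors and functionals have small positive coordinates.\<close>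

locale perturbed_frame =
  fixes x :: "nat \<Rightarrow> 'a::banach" and f :: "nat \<Rightarrow> 'a \<Rightarrow>\<^sub>L real"
  assumes frame: "Schauder_frame x f"
begin

text \<open>The denominator bounds \<open>\<epsilon> i\<close>,
  \<open>\<epsilon> i * norm (x i)\<close> and \<open>\<epsilon> i * norm (f i)\<close> by the same
  geometric sequence; hence all cross terms of the perturbed series converge absolutely.\<close>

definition \<epsilon> :: "nat \<Rightarrow> real" where
  "\<epsilon> i = (1/2) ^ i / (1 + norm (x i) + norm (f i))"

definition y :: "nat \<Rightarrow> 'a \<times> real" where
  "y i = (x i, \<epsilon> i)"

definition fst_l :: "('a \<times> real) \<Rightarrow>\<^sub>L 'a" where
  "fst_l = Blinfun fst"

definition snd_l :: "('a \<times> real) \<Rightarrow>\<^sub>L real" where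
  "snd_l = Blinfun snd"

definition F :: "nat \<Rightarrow> ('a \<times> real) \<Rightarrow>\<^sub>L real" where
  "F i = (f i o\<^sub>L fst_l) + \<epsilon> i *\<^sub>R snd_l"

lemma fst_l_apply [simp]: "blinfun_apply fst_l w = fst w" and snd_l_apply [simp]: "blinfun_apply snd_l w = snd w"
  by (simp_all add: fst_l_def snd_l_def bounded_linear_Blinfun_apply bounded_linear_fst bounded_linear_snd)

lemma denominator_pos: "1 + norm (x i) + norm (f i) > 0"
  by (simp add: add_pos_nonneg)

lemma \<epsilon>_pos: "\<epsilon> i > 0"
  using denominator_pos[of i] by (simp add: \<epsilon>_def)

lemma \<epsilon>_mult_le:
  assumes "c \<le> 1 + norm (x i) + norm (f i)"
  shows "\<epsilon> i * c \<le> (1/2) ^ i"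
proof -
  have "\<epsilon> i * c \<le> \<epsilon> i * (1 + norm (x i) + norm (f i))"
    using \<epsilon>_pos[of i] assms by (intro mult_left_mono) auto
  then show ?thesis using denominator_pos[of i] by (simp add: \<epsilon>_def)
qed

lemma \<epsilon>_le: "\<epsilon> i \<le> (1/2) ^ i" and \<epsilon>_x: "\<epsilon> i * norm (x i) \<le> (1/2) ^ i" and \<epsilon>_f: "\<epsilon> i * norm (f i) \<le> (1/2) ^ i"
  using \<epsilon>_mult_le[of 1 i] \<epsilon>_mult_le[of "norm (x i)" i] \<epsilon>_mult_le[of "norm (f i)" i] by auto

lemma \<epsilon>_sq: "\<epsilon> i * \<epsilon> i \<le> (1/2) ^ i"
proof -
  have "\<epsilon> i \<le> 1" using order_trans[OF \<epsilon>_le[of i] power_le_one[of "1/2" i]] by simp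
  then have "\<epsilon> i * \<epsilon> i \<le> 1 * \<epsilon> i" using \<epsilon>_pos[of i] by (intro mult_right_mono) auto
  then show ?thesis using \<epsilon>_le[of i] by simp
qed

lemma F_apply: "blinfun_apply (F i) w = blinfun_apply (f i) (fst w) + \<epsilon> i * snd w"
  by (simp add: F_def blinfun.add_left blinfun.scaleR_left)

lemma interpolation: "interpolation y F"
proof
  show "y i \<noteq> 0" for i using \<epsilon>_pos[of i] by (simp add: y_def zero_prod_def)
  show "F i \<noteq> 0" for i
  proof
    assume "F i = 0"
    then show False using F_apply[of i "(0, 1)"] \<epsilon>_pos[of i] by (simp add: blinfun.zero_right)
  qed
  fix w :: "'a \<times> real"
  have "summable (\<lambda>i. blinfun_apply (f i) (fst w) *\<^sub>R x i)"
    using frame sums_summable unfolding Schauder_frame_def by blast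
  then have s: "summable (\<lambda>i. (blinfun_apply (f i) (fst w) *\<^sub>R x i, 0 :: real))"
    by (intro bounded_linear.summable[of "\<lambda>u. (u, 0)"] bounded_linear_Pair bounded_linear_ident bounded_linear_zero)
  show "summable (\<lambda>i. blinfun_apply (F i) w *\<^sub>R y i)"
  proof (rule summable_perturbation[OF s])
    fix i
    \<comment> \<open>The original frame series is the leading term in the first component;
      everything else carries a factor \<open>\<epsilon> i\<close>.\<close>
    have "blinfun_apply (F i) w *\<^sub>R y i - (blinfun_apply (f i) (fst w) *\<^sub>R x i, 0) =
        ((\<epsilon> i * snd w) *\<^sub>R x i, blinfun_apply (f i) (fst w) * \<epsilon> i + \<epsilon> i * \<epsilon> i * snd w)"
      by (simp add: F_apply y_def algebra_simps)
    then have "norm (blinfun_apply (F i) w *\<^sub>R y i - (blinfun_apply (f i) (fst w) *\<^sub>R x i, 0)) \<le>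
        norm ((\<epsilon> i * snd w) *\<^sub>R x i) + norm (blinfun_apply (f i) (fst w) * \<epsilon> i + \<epsilon> i * \<epsilon> i * snd w)"
      by (simp only: norm_Pair_le)
    also have "\<dots> \<le> \<bar>snd w\<bar> * (\<epsilon> i * norm (x i)) + (\<epsilon> i * norm (f i) * norm (fst w) + \<epsilon> i * \<epsilon> i * \<bar>snd w\<bar>)"
    proof (rule add_mono)
      have "\<bar>blinfun_apply (f i) (fst w)\<bar> * \<epsilon> i \<le> (norm (f i) * norm (fst w)) * \<epsilon> i"
        using norm_blinfun[of "f i" "fst w"] \<epsilon>_pos[of i] by (intro mult_right_mono) auto
      moreover have "norm (blinfun_apply (f i) (fst w) * \<epsilon> i + \<epsilon> i * \<epsilon> i * snd w) \<le>
          \<bar>blinfun_apply (f i) (fst w)\<bar> * \<epsilon> i + \<epsilon> i * \<epsilon> i * \<bar>snd w\<bar>"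
        using \<epsilon>_pos[of i] abs_triangle_ineq[of "blinfun_apply (f i) (fst w) * \<epsilon> i" "\<epsilon> i * \<epsilon> i * snd w"] by (simp add: abs_mult)
      ultimately show "norm (blinfun_apply (f i) (fst w) * \<epsilon> i + \<epsilon> i * \<epsilon> i * snd w) \<le>
          \<epsilon> i * norm (f i) * norm (fst w) + \<epsilon> i * \<epsilon> i * \<bar>snd w\<bar>" by (simp add: mult_ac)
    qed (use \<epsilon>_pos[of i] in \<open>simp add: abs_mult mult_ac\<close>)
    also have "\<dots> \<le> \<bar>snd w\<bar> * (1/2) ^ i + ((1/2) ^ i * norm (fst w) + (1/2) ^ i * \<bar>snd w\<bar>)"
      by (intro add_mono mult_left_mono mult_right_mono \<epsilon>_x \<epsilon>_f \<epsilon>_sq) auto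
    finally show "norm (blinfun_apply (F i) w *\<^sub>R y i - (blinfun_apply (f i) (fst w) *\<^sub>R x i, 0)) \<le>
        (2 * \<bar>snd w\<bar> + norm (fst w)) * (1/2) ^ i" by (simp add: algebra_simps)
  qed
qed

lemma bounded_linear_inl: "bounded_linear (\<lambda>u. (u, 0 :: real))"
  by (intro bounded_linear_Pair bounded_linear_ident bounded_linear_zero)

lemma norm_fst_l_le: "norm fst_l \<le> 1"
  by (rule norm_blinfun_bound) (simp_all add: norm_fst_le split_paired_all)

lemma norm_snd_l_le: "norm snd_l \<le> 1"
proof (rule norm_blinfun_bound)
  show "norm (blinfun_apply snd_l w) \<le> 1 * norm w" for w
    using norm_snd_le[of "snd w" "fst w"] by simp
qed simp

text \<open>A functional on the product is a functional \<open>g1\<close> on the given space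
  together with its value \<open>s\<close> at \<open>(0, 1)\<close>. The main part of the series is
  the dual series of \<open>g1\<close>, composed with the first projection.\<close>

lemma dual_summable:
  fixes g :: "('a \<times> real) \<Rightarrow>\<^sub>L real"
  assumes shr: "shrinking_frame x f"
  shows "summable (\<lambda>i. blinfun_apply g (y i) *\<^sub>R F i)"
proof -
  define g1 where "g1 = g o\<^sub>L Blinfun (\<lambda>u. (u, 0))"
  define s where "s = blinfun_apply g (0, 1)"
  have g1: "blinfun_apply g1 u = blinfun_apply g (u, 0)" for u
    by (simp add: g1_def bounded_linear_Blinfun_apply[OF bounded_linear_inl])
  have gy: "blinfun_apply g (y i) = blinfun_apply g1 (x i) + \<epsilon> i * s" for i
  proof -
    have "y i = (x i, 0) + \<epsilon> i *\<^sub>R (0, 1)" by (simp add: y_def)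
    then show ?thesis by (simp only: blinfun.add_right blinfun.scaleR_right g1 s_def real_scaleR_def)
  qed
  have "summable (\<lambda>i. blinfun_apply g1 (x i) *\<^sub>R f i)"
    using shr sums_summable unfolding shrinking_frame_iff[OF frame] by blast
  then have sm: "summable (\<lambda>i. (blinfun_apply g1 (x i) *\<^sub>R f i) o\<^sub>L fst_l)"
    by (rule bounded_linear.summable[OF bounded_bilinear.bounded_linear_left[OF bounded_bilinear_blinfun_compose]])
  show ?thesis
  proof (rule summable_perturbation[OF sm])
    fix i
    let ?P = fst_l and ?Q = snd_l
    have "blinfun_apply g (y i) *\<^sub>R F i - ((blinfun_apply g1 (x i) *\<^sub>R f i) o\<^sub>L ?P) =
        (\<epsilon> i * s) *\<^sub>R (f i o\<^sub>L ?P) + ((blinfun_apply g1 (x i) + \<epsilon> i * s) * \<epsilon> i) *\<^sub>R ?Q"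
      by (rule blinfun_eqI) (simp add: gy F_def blinfun.add_left blinfun.diff_left blinfun.scaleR_left algebra_simps)
    then have "norm (blinfun_apply g (y i) *\<^sub>R F i - ((blinfun_apply g1 (x i) *\<^sub>R f i) o\<^sub>L ?P)) \<le>
        norm ((\<epsilon> i * s) *\<^sub>R (f i o\<^sub>L ?P)) + norm (((blinfun_apply g1 (x i) + \<epsilon> i * s) * \<epsilon> i) *\<^sub>R ?Q)"
      by (simp only: norm_triangle_ineq)
    also have "\<dots> \<le> \<bar>s\<bar> * (\<epsilon> i * norm (f i)) + (norm g1 * (\<epsilon> i * norm (x i)) + \<epsilon> i * \<epsilon> i * \<bar>s\<bar>)"
    proof (rule add_mono)
      have "norm (f i o\<^sub>L ?P) \<le> norm (f i) * 1"
        using order_trans[OF norm_blinfun_compose mult_left_mono[OF norm_fst_l_le norm_ge_zero]] .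
      then have "\<epsilon> i * \<bar>s\<bar> * norm (f i o\<^sub>L ?P) \<le> \<epsilon> i * \<bar>s\<bar> * (norm (f i) * 1)"
        using \<epsilon>_pos[of i] by (intro mult_left_mono) auto
      then show "norm ((\<epsilon> i * s) *\<^sub>R (f i o\<^sub>L ?P)) \<le> \<bar>s\<bar> * (\<epsilon> i * norm (f i))"
        using \<epsilon>_pos[of i] by (simp add: abs_mult mult_ac)
      have "\<bar>blinfun_apply g1 (x i) + \<epsilon> i * s\<bar> \<le> norm g1 * norm (x i) + \<epsilon> i * \<bar>s\<bar>"
        using norm_blinfun[of g1 "x i"] abs_triangle_ineq[of "blinfun_apply g1 (x i)" "\<epsilon> i * s"] \<epsilon>_pos[of i]
        by (simp add: abs_mult)
      then have "\<bar>blinfun_apply g1 (x i) + \<epsilon> i * s\<bar> * \<epsilon> i * norm ?Q \<le> (norm g1 * norm (x i) + \<epsilon> i * \<bar>s\<bar>) * \<epsilon> i * 1"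
        using \<epsilon>_pos[of i] norm_snd_l_le by (intro mult_mono) auto
      then show "norm (((blinfun_apply g1 (x i) + \<epsilon> i * s) * \<epsilon> i) *\<^sub>R ?Q) \<le> norm g1 * (\<epsilon> i * norm (x i)) + \<epsilon> i * \<epsilon> i * \<bar>s\<bar>"
        using \<epsilon>_pos[of i] unfolding norm_scaleR real_norm_def abs_mult by (simp add: distrib_left mult_ac)
    qed
    also have "\<dots> \<le> \<bar>s\<bar> * (1/2) ^ i + (norm g1 * (1/2) ^ i + (1/2) ^ i * \<bar>s\<bar>)"
      by (intro add_mono mult_left_mono mult_right_mono \<epsilon>_x \<epsilon>_f \<epsilon>_sq) auto
    finally show "norm (blinfun_apply g (y i) *\<^sub>R F i - ((blinfun_apply g1 (x i) *\<^sub>R f i) o\<^sub>L ?P)) \<le>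
        (2 * \<bar>s\<bar> + norm g1) * (1/2) ^ i" by (simp add: algebra_simps)
  qed
qed

text \<open>On the functionals \<open>F i\<close>, an element of the bidual of the product acts
  through \<open>\<phi>1\<close>, an element of the bidual of the given space, and the number
  \<open>s\<close>; the remaining terms are dominated by a geometric series.\<close>

lemma bidual_summable:
  fixes \<phi> :: "(('a \<times> real) \<Rightarrow>\<^sub>L real) \<Rightarrow>\<^sub>L real"
  assumes bc: "boundedly_complete_frame x f"
  shows "summable (\<lambda>i. blinfun_apply \<phi> (F i) *\<^sub>R y i)"
proof -
  have bl: "bounded_linear (\<lambda>g :: 'a \<Rightarrow>\<^sub>L real. blinfun_apply \<phi> (g o\<^sub>L fst_l))"
    by (intro bounded_linear_compose[OF blinfun.bounded_linear_right]
        bounded_bilinear.bounded_linear_left[OF bounded_bilinear_blinfun_compose])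
  define \<phi>1 where "\<phi>1 = Blinfun (\<lambda>g :: 'a \<Rightarrow>\<^sub>L real. blinfun_apply \<phi> (g o\<^sub>L fst_l))"
  define s where "s = blinfun_apply \<phi> snd_l"
  have \<phi>F: "blinfun_apply \<phi> (F i) = blinfun_apply \<phi>1 (f i) + \<epsilon> i * s" for i
    by (simp add: F_def blinfun.add_right blinfun.scaleR_right s_def \<phi>1_def bounded_linear_Blinfun_apply[OF bl])
  have "summable (\<lambda>i. blinfun_apply \<phi>1 (f i) *\<^sub>R x i)"
    using bc by (simp add: boundedly_complete_frame_def)
  then have sm: "summable (\<lambda>i. (blinfun_apply \<phi>1 (f i) *\<^sub>R x i, 0 :: real))"
    by (rule bounded_linear.summable[OF bounded_linear_inl])
  show ?thesis
  proof (rule summable_perturbation[OF sm])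
    fix i
    let ?c = "blinfun_apply \<phi>1 (f i)"
    have "blinfun_apply \<phi> (F i) *\<^sub>R y i - (?c *\<^sub>R x i, 0) = ((\<epsilon> i * s) *\<^sub>R x i, ?c * \<epsilon> i + \<epsilon> i * \<epsilon> i * s)"
      by (simp add: \<phi>F y_def algebra_simps)
    then have "norm (blinfun_apply \<phi> (F i) *\<^sub>R y i - (?c *\<^sub>R x i, 0)) \<le>
        norm ((\<epsilon> i * s) *\<^sub>R x i) + norm (?c * \<epsilon> i + \<epsilon> i * \<epsilon> i * s)"
      by (simp only: norm_Pair_le)
    also have "\<dots> \<le> \<bar>s\<bar> * (\<epsilon> i * norm (x i)) + (norm \<phi>1 * (\<epsilon> i * norm (f i)) + \<epsilon> i * \<epsilon> i * \<bar>s\<bar>)"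
    proof (rule add_mono)
      have "\<bar>?c\<bar> * \<epsilon> i \<le> (norm \<phi>1 * norm (f i)) * \<epsilon> i"
        using norm_blinfun[of \<phi>1 "f i"] \<epsilon>_pos[of i] by (intro mult_right_mono) auto
      moreover have "norm (?c * \<epsilon> i + \<epsilon> i * \<epsilon> i * s) \<le> \<bar>?c\<bar> * \<epsilon> i + \<epsilon> i * \<epsilon> i * \<bar>s\<bar>"
        using \<epsilon>_pos[of i] abs_triangle_ineq[of "?c * \<epsilon> i" "\<epsilon> i * \<epsilon> i * s"] by (simp add: abs_mult)
      ultimately show "norm (?c * \<epsilon> i + \<epsilon> i * \<epsilon> i * s) \<le> norm \<phi>1 * (\<epsilon> i * norm (f i)) + \<epsilon> i * \<epsilon> i * \<bar>s\<bar>"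
        by (simp add: mult_ac)
    qed (use \<epsilon>_pos[of i] in \<open>simp add: abs_mult mult_ac\<close>)
    also have "\<dots> \<le> \<bar>s\<bar> * (1/2) ^ i + (norm \<phi>1 * (1/2) ^ i + (1/2) ^ i * \<bar>s\<bar>)"
      by (intro add_mono mult_left_mono mult_right_mono \<epsilon>_x \<epsilon>_f \<epsilon>_sq) auto
    finally show "norm (blinfun_apply \<phi> (F i) *\<^sub>R y i - (?c *\<^sub>R x i, 0)) \<le> (2 * \<bar>s\<bar> + norm \<phi>1) * (1/2) ^ i"
      by (simp add: algebra_simps)
  qed
qed

end

sublocale perturbed_frame \<subseteq> interpolation y F
  by (rule interpolation)

section \<open>The completion as a space associated to the original frame\<close>

context perturbed_frame
begin

text \<open>The enlargement leaves no trace: \<open>F i\<close> at \<open>(u, 0)\<close> is exactly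
  \<open>f i\<close> at \<open>u\<close>, and the first component of a synthesised vector is the
  series in the \<open>x i\<close>. So the operators for the original frame are obtained by
  restriction and projection.\<close>

lemma associated: "associated_basis x f Z.V Z.N unit_seq"
  unfolding associated_basis_def
proof (intro conjI)
  show "banach_space_on Z.V Z.N" by (rule Z.complete_V)
  show "Schauder_basis Z.V Z.N unit_seq" by (rule Z.basis_unit_seq)
  have f_eq: "(\<lambda>i. blinfun_apply (f i) u) = (\<lambda>i. blinfun_apply (F i) (u, 0))" for u by (simp add: F_apply)
  have "expansion Z.V Z.N unit_seq (\<lambda>i. blinfun_apply (f i) u) (\<lambda>i. blinfun_apply (f i) u)" for u
    unfolding f_eq using coefficient_seq_in_V by (simp only: Z.expansion_iff)
  moreover have "Z.N (\<lambda>i. blinfun_apply (f i) u) \<le> 2 * norm u" for u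
    unfolding f_eq using N_coefficient_seq[of "(u, 0)"] by (simp add: norm_Pair)
  ultimately show "\<exists>T. (\<forall>u. expansion Z.V Z.N unit_seq (\<lambda>i. blinfun_apply (f i) u) (T u)) \<and> (\<exists>C. \<forall>u. Z.N (T u) \<le> C * norm u)"
    by (intro exI[of _ "\<lambda>u i. blinfun_apply (f i) u"]) blast
  obtain D where D: "\<And>a. a \<in> Z.V \<Longrightarrow> summable (\<lambda>i. a i *\<^sub>R y i)" "\<And>a. a \<in> Z.V \<Longrightarrow> norm (\<Sum>i. a i *\<^sub>R y i) \<le> D * Z.N a"
    using synthesis by blast
  define S where "S a = fst (\<Sum>i. a i *\<^sub>R y i)" for a
  have "(\<lambda>i. coord Z.V Z.N unit_seq i a *\<^sub>R x i) sums S a" if a: "a \<in> Z.V" for a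
    using bounded_linear.sums[OF bounded_linear_fst summable_sums[OF D(1)[OF a]]]
    by (simp add: Z.coord_unit_seq[OF a] S_def y_def)
  moreover have "norm (S a) \<le> D * Z.N a" if "a \<in> Z.V" for a
    using norm_fst_le[of "fst (\<Sum>i. a i *\<^sub>R y i)" "snd (\<Sum>i. a i *\<^sub>R y i)"] D(2)[OF that] by (simp add: S_def)
  ultimately show "\<exists>S. (\<forall>a\<in>Z.V. (\<lambda>i. coord Z.V Z.N unit_seq i a *\<^sub>R x i) sums S a) \<and> (\<exists>C. \<forall>a\<in>Z.V. norm (S a) \<le> C * Z.N a)"
    by blast
qed

lemma shrinking: "shrinking_frame x f \<Longrightarrow> shrinking_basis Z.V Z.N unit_seq"
  by (rule Z.shrinking_unit_seq) (rule functional_tails[OF dual_summable])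

lemma reflexive: "shrinking_frame x f \<Longrightarrow> boundedly_complete_frame x f \<Longrightarrow> reflexive_space Z.V Z.N"
  by (rule Z.reflexive_unit_seq[OF shrinking]) (auto intro: boundedly_complete_V[OF bidual_summable])

end

section \<open>The implications of the theorem\<close>

lemma shrinking_frame_imp_associated:
  "Schauder_frame x f \<Longrightarrow> shrinking_frame x f \<Longrightarrow> has_shrinking_associated_basis TYPE(nat \<Rightarrow> real) x f"
  unfolding has_shrinking_associated_basis_def
  using perturbed_frame.associated[OF perturbed_frame.intro] perturbed_frame.shrinking[OF perturbed_frame.intro] by blast

lemma reflexive_frame_imp_associated:
  "Schauder_frame x f \<Longrightarrow> shrinking_frame x f \<Longrightarrow> boundedly_complete_frame x f \<Longrightarrow>
    has_reflexive_associated_space TYPE(nat \<Rightarrow> real) x f"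
  unfolding has_reflexive_associated_space_def
  using perturbed_frame.associated[OF perturbed_frame.intro] perturbed_frame.reflexive[OF perturbed_frame.intro] by blast

lemma shrinking_associated_imp_shrinking_frame:
  fixes x :: "nat \<Rightarrow> 'a::banach"
  assumes "Schauder_frame x f" "has_shrinking_associated_basis TYPE('z::real_vector) x f"
  shows "shrinking_frame x f"
proof -
  obtain V :: "'z set" and N z where "associated_basis x f V N z" and shr: "shrinking_basis V N z"
    using assms(2) by (auto simp: has_shrinking_associated_basis_def)
  then obtain T S C D where "associated_space V N z x f T S C D" using associated_basisE assms(1) by blast
  from associated_space.shrinking_basis_imp_shrinking_frame[OF this shr] show ?thesis .
qed

lemma reflexive_associated_imp:
  fixes x :: "nat \<Rightarrow> 'a::banach"
  assumes "Schauder_frame x f" "has_reflexive_associated_space TYPE('z::real_vector) x f"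
  shows "shrinking_frame x f \<and> boundedly_complete_frame x f"
proof -
  obtain V :: "'z set" and N z where "associated_basis x f V N z" and refl: "reflexive_space V N"
    using assms(2) by (auto simp: has_reflexive_associated_space_def)
  then obtain T S C D where as: "associated_space V N z x f T S C D" using associated_basisE assms(1) by blast
  show ?thesis
    using associated_space.reflexive_imp_shrinking_frame[OF as refl]
      associated_space.reflexive_imp_boundedly_complete[OF as refl] by blast
qed

text \<open>A carrier type cannot be quantified inside a formula. Existence is therefore claimed in
  the fixed type \<open>nat \<Rightarrow> real\<close>, and the converse implications are stated for
  an arbitrary carrier type as well.\<close>

theorem theorem1p5:
  fixes x :: "nat \<Rightarrow> 'a::banach" and f :: "nat \<Rightarrow> 'a \<Rightarrow>\<^sub>L real"
  assumes "separable_space (euclidean :: 'a topology)"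
    and "\<not> (\<exists>B :: 'a set. finite B \<and> span B = UNIV)"
    and "Schauder_frame x f"
  shows "(shrinking_frame x f \<longleftrightarrow> has_shrinking_associated_basis TYPE(nat \<Rightarrow> real) x f) \<and>
         (has_shrinking_associated_basis TYPE('z::real_vector) x f \<longrightarrow> shrinking_frame x f) \<and>
         (shrinking_frame x f \<and> boundedly_complete_frame x f \<longleftrightarrow>
            has_reflexive_associated_space TYPE(nat \<Rightarrow> real) x f) \<and>
         (has_reflexive_associated_space TYPE('z) x f \<longrightarrow>
            shrinking_frame x f \<and> boundedly_complete_frame x f)"
proof (intro conjI impI iffI)
  assume "shrinking_frame x f"
  then show "has_shrinking_associated_basis TYPE(nat \<Rightarrow> real) x f"
    by (rule shrinking_frame_imp_associated[OF assms(3)])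
next
  assume "has_shrinking_associated_basis TYPE(nat \<Rightarrow> real) x f"
  then show "shrinking_frame x f"
    by (rule shrinking_associated_imp_shrinking_frame[OF assms(3)])
next
  assume "has_shrinking_associated_basis TYPE('z) x f"
  then show "shrinking_frame x f"
    by (rule shrinking_associated_imp_shrinking_frame[OF assms(3)])
next
  assume "shrinking_frame x f \<and> boundedly_complete_frame x f"
  then show "has_reflexive_associated_space TYPE(nat \<Rightarrow> real) x f"
    using reflexive_frame_imp_associated[OF assms(3)] by blast
qed (use reflexive_associated_imp[OF assms(3)] in blast)+

end
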